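(* Fix $T>0$, branching points $0<\tau_1<\dots<\tau_\eta<T$ and $c\in\mathbb{R}$. Let $N_1,\dots,N_\eta$ be independent random variables with values in $\mathbb{N}=\{1,2,\dots\}$, put $\boldsymbol{N}=(N_1,\dots,N_\eta)$, and let $(B_\gamma(t))_{t\in[0,T],\gamma\in\Gamma}$ be the Brownian decision tree with random offspring numbers $\boldsymbol{N}$, i.e. conditionally on $\boldsymbol{N}=\boldsymbol{n}$ it is a Brownian decision tree with branching points $\tau_1,\dots,\tau_\eta$ and offspring numbers $\boldsymbol{n}$. Then, as $u\to\infty$, $$\mathbb{P}\{\exists\, t\in[0,T]\ \forall\,\gamma\in\Gamma:\ B_\gamma(t)-ct>u\}\sim \mathcal{H}_{P_\eta,1/\mu_0(T)}\prod_{i=1}^{\eta}\mathbb{P}\{N_i=\operatorname{essinf}(N_i)\}\;\mathbb{P}\{\forall\,\gamma\in\Gamma:\ B_\gamma(T)-cT>u\mid \boldsymbol{N}=\operatorname{essinf}(\boldsymbol{N})\},$$ where $\operatorname{essinf}(\boldsymbol{N})$ is the componentwise essential infimum, and the constant $\mathcal{H}_{P_\eta,1/\mu_0(T)}$ is computed with $\boldsymbol{N}$ replaced by $\operatorname{essinf}(\boldsymbol{N})$, i.e. with $P_\eta=\prod_{j=1}^\eta\operatorname{essinf}(N_j)$ and $\mu_0(T)=(T-\tau_\eta)+\sum_{l=1}^{\eta}(\tau_l-\tau_{l-1})\prod_{j=l}^{\eta}\operatorname{essinf}(N_j)$, $\tau_0=0$.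
   Context: Brownian decision tree (deterministic offspring numbers). Fix $T>0$, an integer $\eta\ge 1$, deterministic branching points $0<\tau_1<\dots<\tau_\eta<T$ and integers $N_1,\dots,N_\eta\ge 1$. Conventions: $\tau_0=0$, $\tau_{\eta+1}=T$, $P_0=1$. Put $P_i=\prod_{j=1}^iN_j$, $\Gamma=\{0,1,\dots,P_\eta-1\}$, and let $i(t)=\max\{i\in\{1,\dots,\eta\}: t>\tau_i\}$ for $t>\tau_1$, $i(t)=0$ for $t\in[0,\tau_1]$. Let $B_0^*$ be a standard one-dimensional Brownian motion and, for $i=1,\dots,\eta$, let $\boldsymbol{B}_i^*$ be a standard $\mathbb{R}^{P_i}$-valued Brownian motion (independent components), all of these being mutually independent. Define $\widetilde{\boldsymbol{B}}_\Gamma(t)=B_0^*(t)$ for $t\in[0,\tau_1]$ and, recursively for $t\in(\tau_i,\tau_{i+1}]$, let $\widetilde{\boldsymbol{B}}_\Gamma(t)\in\mathbb{R}^{P_i}$ be the vector obtained by stacking $N_i$ copies of $\widetilde{\boldsymbol{B}}_\Gamma(\tau_i)\in\mathbb{R}^{P_{i-1}}$, plus $\boldsymbol{B}_i^*(t-\tau_i)$. The branch indexed by $\gamma\in\Gamma$ is $B_\gamma(t)=(\widetilde{\boldsymbol{B}}_\Gamma(t))_{(\gamma \bmod P_{i(t)})+1}$. Constant: for $\mathcal{N}\in\mathbb{N}$ and $\lambda>0$, $$\mathcal{H}_{\mathcal{N},\lambda}=\int_{\mathbb{R}^{\mathcal{N}}}\mathbb{P}\{\exists\, t\in(0,\infty)\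 \forall\, i\in\{1,\dots,\mathcal{N}\}:\ \lambda B_i^*(t)-\lambda^2t>x_i\}\,e^{\sum_{i=1}^{\mathcal{N}}x_i}\,d\boldsymbol{x}$$ with $B_1^*,\dots,B_{\mathcal{N}}^*$ mutually independent standard Brownian motions on $[0,\infty)$. The notation $f(u)\sim g(u)$ means $f(u)/g(u)\to1$. *)

theory Defs
  imports "HOL-Probability.Probability"
begin

text \<open>
  Brownian motion is parametrised by its time set \<open>I\<close>, an interval with left endpoint \<open>0\<close>:
  \<open>{0..}\<close> gives the usual motion on the half-line, \<open>{0..L}\<close> the motion up to time \<open>L\<close>.
\<close>

definition brownian_motion :: "'a measure \<Rightarrow> real set \<Rightarrow> (real \<Rightarrow> 'a \<Rightarrow> real) \<Rightarrow> bool" where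
  "brownian_motion M I B \<longleftrightarrow>
     prob_space M \<and>
     (\<forall>t\<in>I. B t \<in> borel_measurable M) \<and>
     (\<forall>\<omega>\<in>space M. B 0 \<omega> = 0 \<and> continuous_on I (\<lambda>t. B t \<omega>)) \<and>
     (\<forall>s\<in>I. \<forall>t\<in>I. s < t \<longrightarrow>
        distributed M lborel (\<lambda>\<omega>. B t \<omega> - B s \<omega>) (normal_density 0 (sqrt (t - s)))) \<and>
     (\<forall>m (t :: nat \<Rightarrow> real). (\<forall>k\<le>m. t k \<in> I) \<and> (\<forall>k<m. t k < t (Suc k)) \<longrightarrow>
        prob_space.indep_vars M (\<lambda>_. borel) (\<lambda>k \<omega>. B (t (Suc k)) \<omega> - B (t k) \<omega>) {..<m})"

text \<open>Independence is that of the whole paths, as random elements of \<open>\<real>\<^bsup>I j\<^esup>\<close>.\<close>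

definition indep_brownian_motions ::
    "'a measure \<Rightarrow> 'j set \<Rightarrow> ('j \<Rightarrow> real set) \<Rightarrow> ('j \<Rightarrow> real \<Rightarrow> 'a \<Rightarrow> real) \<Rightarrow> bool" where
  "indep_brownian_motions M J I B \<longleftrightarrow>
     prob_space M \<and>
     (\<forall>j\<in>J. brownian_motion M (I j) (B j)) \<and>
     prob_space.indep_vars M (\<lambda>j. PiM (I j) (\<lambda>_. borel)) (\<lambda>j \<omega>. \<lambda>t\<in>I j. B j t \<omega>) J"

definition offspring_prod :: "(nat \<Rightarrow> nat) \<Rightarrow> nat \<Rightarrow> nat" where
  "offspring_prod n i = (\<Prod>j=1..i. n j)"

definition level :: "(nat \<Rightarrow> real) \<Rightarrow> nat \<Rightarrow> real \<Rightarrow> nat" where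
  "level \<tau> \<eta> t = (if t > \<tau> 1 then Max {i \<in> {1..\<eta>}. t > \<tau> i} else 0)"

text \<open>
  \<open>tree_vec W \<tau> n i t k\<close> is coordinate \<open>k\<close>, counted from \<open>0\<close>, of the \<open>P\<^sub>i\<close>-dimensional vector
  that the recursion for the time interval \<open>(\<tau>\<^sub>i, \<tau>\<^sub>i\<^sub>+\<^sub>1]\<close> assigns to the time \<open>t\<close>;
  \<open>W (i, k)\<close> is coordinate \<open>k\<close> of the \<open>i\<close>-th driving Brownian motion.  Coordinate \<open>k\<close> of several
  stacked copies of a \<open>P\<^sub>i\<close>-dimensional vector \<open>v\<close> is coordinate \<open>k mod P\<^sub>i\<close> of \<open>v\<close>.
\<close>

fun tree_vec :: "(nat \<times> nat \<Rightarrow> real \<Rightarrow> real) \<Rightarrow> (nat \<Rightarrow> real) \<Rightarrow> (nat \<Rightarrow> nat) \<Rightarrow>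
    nat \<Rightarrow> real \<Rightarrow> nat \<Rightarrow> real" where
  "tree_vec W \<tau> n 0 t k = W (0, k) t"
| "tree_vec W \<tau> n (Suc i) t k =
     tree_vec W \<tau> n i (\<tau> (Suc i)) (k mod offspring_prod n i) + W (Suc i, k) (t - \<tau> (Suc i))"

definition branch :: "(nat \<times> nat \<Rightarrow> real \<Rightarrow> real) \<Rightarrow> (nat \<Rightarrow> real) \<Rightarrow> (nat \<Rightarrow> nat) \<Rightarrow> nat \<Rightarrow>
    nat \<Rightarrow> real \<Rightarrow> real" where
  "branch W \<tau> n \<eta> \<gamma> t =
     tree_vec W \<tau> n (level \<tau> \<eta> t) t (\<gamma> mod offspring_prod n (level \<tau> \<eta> t))"

text \<open>
  Here \<open>\<tau> 0 = 0\<close> and \<open>\<tau> (Suc \<eta>) = T\<close> is the horizon.  The \<open>i\<close>-th driving motion is only ever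
  evaluated on \<open>[0, \<tau>\<^sub>i\<^sub>+\<^sub>1 - \<tau>\<^sub>i]\<close>, so no more is demanded of it; in particular the driving
  motions can be read off from the tree, and the underlying space need not carry
  continuations of them.
\<close>

definition brownian_decision_tree ::
    "'a measure \<Rightarrow> (nat \<Rightarrow> real) \<Rightarrow> (nat \<Rightarrow> nat) \<Rightarrow> nat \<Rightarrow> (nat \<Rightarrow> real \<Rightarrow> 'a \<Rightarrow> real) \<Rightarrow> bool" where
  "brownian_decision_tree M \<tau> n \<eta> B \<longleftrightarrow>
     (\<exists>W :: nat \<times> nat \<Rightarrow> real \<Rightarrow> 'a \<Rightarrow> real.
        indep_brownian_motions M (SIGMA i:{..\<eta>}. {..<offspring_prod n i})
          (\<lambda>(i, k). {0..\<tau> (Suc i) - \<tau> i}) W \<and>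
        (AE \<omega> in M. \<forall>t\<in>{0..\<tau> (Suc \<eta>)}. \<forall>\<gamma><offspring_prod n \<eta>.
           B \<gamma> t \<omega> = branch (\<lambda>j s. W j s \<omega>) \<tau> n \<eta> \<gamma> t))"

text \<open>
  With random offspring numbers \<open>N\<close>, the branches alive at \<open>\<omega>\<close> are the \<open>B \<gamma>\<close> with
  \<open>\<gamma> < offspring_prod (\<lambda>i. N i \<omega>) \<eta>\<close>; the remaining \<open>B \<gamma>\<close> are unconstrained at \<open>\<omega>\<close>.
  Conditioning on \<open>N = n\<close> is elementary, as \<open>N\<close> is discrete.
\<close>

definition random_brownian_decision_tree ::
    "'a measure \<Rightarrow> (nat \<Rightarrow> real) \<Rightarrow> (nat \<Rightarrow> 'a \<Rightarrow> nat) \<Rightarrow> nat \<Rightarrow> (nat \<Rightarrow> real \<Rightarrow> 'a \<Rightarrow> real) \<Rightarrow> bool" where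
  "random_brownian_decision_tree M \<tau> N \<eta> B \<longleftrightarrow>
     (\<forall>n. measure M {\<omega>\<in>space M. \<forall>i\<in>{1..\<eta>}. N i \<omega> = n i} > 0 \<longrightarrow>
        brownian_decision_tree
          (uniform_measure M {\<omega>\<in>space M. \<forall>i\<in>{1..\<eta>}. N i \<omega> = n i}) \<tau> n \<eta> B)"

definition essinf :: "'a measure \<Rightarrow> ('a \<Rightarrow> nat) \<Rightarrow> nat" where
  "essinf M X = Sup {k. AE \<omega> in M. k \<le> X \<omega>}"

definition essinf_vec :: "'a measure \<Rightarrow> (nat \<Rightarrow> 'a \<Rightarrow> nat) \<Rightarrow> nat \<Rightarrow> nat" where
  "essinf_vec M N i = essinf M (N i)"

definition \<mu>\<^sub>0 :: "(nat \<Rightarrow> real) \<Rightarrow> (nat \<Rightarrow> nat) \<Rightarrow> nat \<Rightarrow> real \<Rightarrow> real" where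
  "\<mu>\<^sub>0 \<tau> n \<eta> t =
     (t - \<tau> \<eta>) + (\<Sum>l=1..\<eta>. (\<tau> l - \<tau> (l - 1)) * real (\<Prod>j=l..\<eta>. n j))"

text \<open>
  The value of this constant depends only on the joint law of \<open>B 1, \<dots>, B K\<close>, hence not on
  the realisation when these are independent standard Brownian motions on \<open>{0..}\<close>.
\<close>

definition \<H> :: "'b measure \<Rightarrow> (nat \<Rightarrow> real \<Rightarrow> 'b \<Rightarrow> real) \<Rightarrow> nat \<Rightarrow> real \<Rightarrow> real" where
  "\<H> M B K l =
     (\<integral>x. measure M {\<omega>\<in>space M. \<exists>t>0. \<forall>i\<in>{1..K}. l * B i t \<omega> - l\<^sup>2 * t > x i} *
          exp (\<Sum>i=1..K. x i) \<partial>(PiM {1..K} (\<lambda>_. lborel)))"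

end

theory Submission
  imports Defs "HOL-Real_Asymp.Real_Asymp"
begin

text \<open>
  Consider first deterministic offspring numbers, and let \<open>K\<close> be the number of branches alive
  at \<open>T\<close>.  The covariance matrix of the \<open>K\<close> branches at time \<open>T\<close> has constant row sum \<open>\<mu>\<close>, the
  number \<open>\<mu>\<^sub>0(T)\<close>, so the cheapest way for all of them to exceed \<open>u\<close> is to be near \<open>u\<close>
  simultaneously, at the end of the time interval.  Write \<open>u' = u + cT\<close>,
  \<open>\<theta> = u'/\<mu>\<close> and \<open>\<nu> = \<theta> - c\<close>.  A Cameron-Martin shift of all driving motions gives every branch the
  mean \<open>u'\<close> at time \<open>T\<close> and a drift \<open>\<theta>\<close> on the last branching interval; it splits off the factor
  \<open>exp (- K u'\<^sup>2 / (2 \<mu>))\<close> and leaves the weight \<open>exp (- \<theta> \<Sum>\<^sub>\<gamma> b\<^sub>\<gamma>)\<close> on the shifted endpoints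
  \<open>b\<^sub>\<gamma>\<close>.  Seen backwards from \<open>T\<close>, the branches move on the last interval
  like independent Brownian motions, and now with the drift \<open>- \<nu>\<close> relative to the level that they have
  to exceed.  Substituting \<open>b\<^sub>\<gamma> = - x\<^sub>\<gamma> / \<nu>\<close> and rescaling time by \<open>\<nu>\<^sup>2 \<mu>\<^sup>2\<close> turns the exceedance into
  the event that \<open>K\<close> independent motions with drift satisfy \<open>\<lambda> B\<^sub>\<gamma>(t) - \<lambda>\<^sup>2 t > x\<^sub>\<gamma>\<close> for all \<open>\<gamma>\<close> at one
  time \<open>t\<close>, where \<open>\<lambda> = 1/\<mu>\<close>; the weight becomes \<open>exp (\<Sum>\<^sub>\<gamma> x\<^sub>\<gamma>)\<close> in the limit, and the density
  of the endpoints at \<open>- x / \<nu>\<close> tends to its value \<open>p\<close> at \<open>0\<close>.  Integration over \<open>x\<close> yields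
  \<open>p \<H>\<close>.  If only the time \<open>T\<close> is admitted, the same computation yields
  \<open>p \<integral>\<^bsub>x < 0\<^esub> exp (\<Sum>\<^sub>\<gamma> x\<^sub>\<gamma>) dx = p\<close>, so that the quotient of the two probabilities tends to \<open>\<H>\<close>.

  This argument covers the times in \<open>[T - \<delta>, T]\<close> with \<open>\<delta> = 1 / \<surd>u\<close>.  For earlier times
  and for larger offspring numbers it is enough to look at the average of all branches, which has
  independent Gaussian increments: if all branches exceed a level then so does their average, and the
  supremum of the average up to a given time has a Gaussian tail governed by the variance at that
  time (\<open>early_exceedance_bound\<close>).  Stopping at \<open>T - \<delta>\<close> lowers the variance by \<open>\<delta> / K\<close>, which
  is a factor \<open>exp (- const u\<^sup>3\<^sup>/\<^sup>2)\<close> in probability.  Raising any offspring number above its essential infimum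
  lowers the variance by at least a fixed amount, uniformly over the infinitely many
  possible vectors of offspring numbers.  Hence only the slice on which all offspring numbers are minimal
  contributes, and its probability is the product in the claim.

  All exact identities are first proved on finite time grids, where they are statements about
  products of one-dimensional normal laws, and carried over to the paths by continuity.
  The main steps are the tilting identity for the density (\<open>dens_tilt\<close>), the law of the last
  branching interval (\<open>last_interval_law\<close>), the exact formula for the exceedance probability on a grid
  (\<open>grid_exceedance\<close>), and its limit (\<open>integral_integrand_tendsto\<close>).
\<close>

section \<open>Product Gaussian measures\<close>

text \<open>
  Both sides agree on boxes, where the integral of a product of functions of single coordinates factorises.
\<close>
lemma PiM_density:
  fixes f :: "'i \<Rightarrow> 'a \<Rightarrow> ennreal"
  assumes fin: "finite I" and M: "product_sigma_finite M"
    and f[measurable]: "\<And>i. f i \<in> borel_measurable (M i)"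
    and sf: "\<And>i. sigma_finite_measure (density (M i) (f i))"
  shows "density (PiM I M) (\<lambda>x. \<Prod>i\<in>I. f i (x i)) = PiM I (\<lambda>i. density (M i) (f i))"
proof -
  interpret M: product_sigma_finite M by fact
  interpret D: product_sigma_finite "\<lambda>i. density (M i) (f i)"
    by (simp add: product_sigma_finite_def sf)
  show ?thesis
  proof (rule D.PiM_eqI[OF fin])
    show "sets (density (PiM I M) (\<lambda>x. \<Prod>i\<in>I. f i (x i))) = sets (PiM I (\<lambda>i. density (M i) (f i)))"
      by (simp cong: sets_PiM_cong)
  next
    fix A assume "\<And>i. i \<in> I \<Longrightarrow> A i \<in> sets (density (M i) (f i))"
    then have A: "\<And>i. i \<in> I \<Longrightarrow> A i \<in> sets (M i)" by simp
    have [measurable]: "Pi\<^sub>E I A \<in> sets (PiM I M)"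
      using A fin by (intro sets_PiM_I_finite) auto
    have [measurable]: "(\<lambda>x. \<Prod>i\<in>I. f i (x i)) \<in> borel_measurable (PiM I M)"
      by measurable
    have ind: "(\<Prod>i\<in>I. f i (x i)) * indicator (Pi\<^sub>E I A) x
        = (\<Prod>i\<in>I. f i (x i) * indicator (A i) (x i))" if x: "x \<in> space (PiM I M)" for x
    proof (cases "x \<in> Pi\<^sub>E I A")
      case True
      then show ?thesis by (auto simp: PiE_mem intro!: prod.cong)
    next
      case False
      then obtain i where "i \<in> I" "x i \<notin> A i"
        using x by (auto simp: space_PiM PiE_iff)
      then have "(\<Prod>i\<in>I. f i (x i) * indicator (A i) (x i)) = 0"
        using fin by (intro prod_zero bexI[of _ i]) auto
      then show ?thesis using False by simp
    qed
    have "emeasure (density (PiM I M) (\<lambda>x. \<Prod>i\<in>I. f i (x i))) (Pi\<^sub>E I A)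
        = (\<integral>\<^sup>+x. (\<Prod>i\<in>I. f i (x i) * indicator (A i) (x i)) \<partial>PiM I M)"
      by (subst emeasure_density) (auto intro!: nn_integral_cong simp: ind)
    also have "\<dots> = (\<Prod>i\<in>I. \<integral>\<^sup>+x. f i x * indicator (A i) x \<partial>M i)"
      using A by (intro M.product_nn_integral_prod fin borel_measurable_times_ennreal borel_measurable_indicator f) auto
    also have "\<dots> = (\<Prod>i\<in>I. emeasure (density (M i) (f i)) (A i))"
      using A by (intro prod.cong refl) (auto simp: emeasure_density)
    finally show "emeasure (density (PiM I M) (\<lambda>x. \<Prod>i\<in>I. f i (x i))) (Pi\<^sub>E I A)
        = (\<Prod>i\<in>I. emeasure (density (M i) (f i)) (A i))" .
  qed
qed

abbreviation (input) Leb :: "'i set \<Rightarrow> ('i \<Rightarrow> real) measure" where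
  "Leb I \<equiv> PiM I (\<lambda>_. lborel)"

lemma nn_integral_PiM_lborel_affine:
  fixes f :: "('i \<Rightarrow> real) \<Rightarrow> ennreal"
  assumes "finite I" "f \<in> borel_measurable (Leb I)" "r \<noteq> 0"
  shows "(\<integral>\<^sup>+x. f x \<partial>Leb I)
    = ennreal (\<bar>r\<bar> ^ card I) * (\<integral>\<^sup>+x. f (\<lambda>i\<in>I. a i + r * x i) \<partial>Leb I)"
  using assms(1,2)
proof (induction I arbitrary: f)
  case empty
  then show ?case
    by (simp add: PiM_empty nn_integral_count_space_finite)
next
  case (insert i I)
  note \<open>f \<in> _\<close>[measurable]
  interpret product_sigma_finite "\<lambda>_::'i. lborel :: real measure"
    by standard
  have 1: "(\<lambda>x. x(i := y)) \<in> measurable (Leb I) (Leb (insert i I))" for y :: real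
    by measurable
  have 2: "(\<lambda>x. \<lambda>i\<in>I. a i + r * x i) \<in> measurable (Leb I) (Leb I)"
    by measurable
  have 3: "(\<lambda>x. \<lambda>i\<in>insert i I. a i + r * x i) \<in> measurable (Leb (insert i I)) (Leb (insert i I))"
    by measurable
  have [measurable]: "(\<lambda>(x,y). f (x(i := y))) \<in> borel_measurable (Leb I \<Otimes>\<^sub>M lborel)"
    by measurable
  have inner: "(\<lambda>x. \<integral>\<^sup>+y. f (x(i := a i + r * y)) \<partial>lborel) \<in> borel_measurable (Leb I)"
    by measurable
  have slice: "(\<lambda>y. f (x(i := y))) \<in> borel_measurable borel" if "x \<in> space (Leb I)" for x
    using that by measurable
  have "(\<integral>\<^sup>+x. f x \<partial>Leb (insert i I))
     = (\<integral>\<^sup>+x. (\<integral>\<^sup>+y. f (x(i := y)) \<partial>lborel) \<partial>Leb I)"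
    using insert by (intro product_nn_integral_insert) auto
  also have "\<dots> = (\<integral>\<^sup>+x. \<bar>r\<bar> * (\<integral>\<^sup>+y. f (x(i := a i + r * y)) \<partial>lborel) \<partial>Leb I)"
    using slice assms(3) by (intro nn_integral_cong nn_integral_real_affine)
  also have "\<dots> = \<bar>r\<bar> * (\<integral>\<^sup>+x. (\<integral>\<^sup>+y. f (x(i := a i + r * y)) \<partial>lborel) \<partial>Leb I)"
    by (intro nn_integral_cmult inner)
  also have "\<dots> = \<bar>r\<bar> * (ennreal (\<bar>r\<bar> ^ card I) *
     (\<integral>\<^sup>+x. (\<integral>\<^sup>+y. f ((\<lambda>i\<in>I. a i + r * x i)(i := a i + r * y)) \<partial>lborel) \<partial>Leb I))"
    by (rule arg_cong[OF insert.IH[OF inner]])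
  also have "(\<integral>\<^sup>+x. (\<integral>\<^sup>+y. f ((\<lambda>i\<in>I. a i + r * x i)(i := a i + r * y)) \<partial>lborel) \<partial>Leb I)
     = (\<integral>\<^sup>+x. (\<integral>\<^sup>+y. f (\<lambda>j\<in>insert i I. a j + r * (x(i := y)) j) \<partial>lborel) \<partial>Leb I)"
    using insert(2) by (intro nn_integral_cong arg_cong[where f=f]) (auto simp: fun_eq_iff)
  also have "\<dots> = (\<integral>\<^sup>+x. f (\<lambda>j\<in>insert i I. a j + r * x j) \<partial>Leb (insert i I))"
    using insert(1,2) by (intro product_nn_integral_insert[symmetric] measurable_compose[OF 3]) auto
  finally show ?case
    by (simp only: card_insert_disjoint[OF insert(1,2)] power_Suc ennreal_mult abs_ge_zero zero_le_power mult.assoc)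
qed

text \<open>
  The parameter is the standard deviation.  For \<open>\<sigma> = 0\<close> this is the null measure, since
  \<^term>\<open>normal_density 0 0\<close> vanishes identically; it is \<open>\<sigma>\<close>-finite in every case.
\<close>
definition gauss :: "real \<Rightarrow> real measure" where
  "gauss \<sigma> = density lborel (normal_density 0 \<sigma>)"

lemma sets_gauss[simp, measurable_cong]: "sets (gauss \<sigma>) = sets borel"
  and space_gauss[simp]: "space (gauss \<sigma>) = UNIV"
  by (simp_all add: gauss_def)

lemma product_sigma_finite_gauss: "product_sigma_finite (\<lambda>i. gauss (\<sigma> i))"
  unfolding gauss_def product_sigma_finite_def
  by (subst sigma_finite_measure.sigma_finite_iff_density_finite[OF sigma_finite_lborel]) auto

lemma PiM_gauss:
  assumes "finite I"
  shows "PiM I (\<lambda>i. gauss (\<sigma> i))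
    = density (Leb I) (\<lambda>x. ennreal (\<Prod>i\<in>I. normal_density 0 (\<sigma> i) (x i)))"
proof -
  have "sigma_finite_measure (density lborel (\<lambda>x. ennreal (normal_density 0 (\<sigma> i) x)))" for i
    by (subst sigma_finite_measure.sigma_finite_iff_density_finite[OF sigma_finite_lborel]) auto
  then have "density (Leb I) (\<lambda>x. \<Prod>i\<in>I. ennreal (normal_density 0 (\<sigma> i) (x i)))
      = PiM I (\<lambda>i. gauss (\<sigma> i))"
    unfolding gauss_def
    by (intro PiM_density assms) (auto simp: product_sigma_finite_def sigma_finite_lborel)
  then show ?thesis
    by (simp add: prod_ennreal)
qed

lemma normal_density_add:
  assumes "\<sigma> \<noteq> 0"
  shows "normal_density 0 \<sigma> (x + a)
    = normal_density 0 \<sigma> x * exp (- (a * x / \<sigma>\<^sup>2 + a\<^sup>2 / (2 * \<sigma>\<^sup>2)))"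
proof -
  have "- (x + a)\<^sup>2 / (2 * \<sigma>\<^sup>2) = - x\<^sup>2 / (2 * \<sigma>\<^sup>2) + - (a * x / \<sigma>\<^sup>2 + a\<^sup>2 / (2 * \<sigma>\<^sup>2))"
    using assms by (simp add: field_simps power2_eq_square)
  then show ?thesis
    unfolding normal_density_def by (simp add: exp_add[symmetric])
qed

text \<open>
  The quotient of a centred normal density at \<open>x + a\<close> and at \<open>x\<close> is the exponential of an affine
  function of \<open>x\<close>; the formula is the translation invariance of Lebesgue measure, coordinate by
  coordinate.
\<close>
lemma Cameron_Martin:
  fixes f :: "('i \<Rightarrow> real) \<Rightarrow> ennreal"
  assumes fin: "finite I" and \<sigma>: "\<And>i. i \<in> I \<Longrightarrow> \<sigma> i \<noteq> 0"
    and f: "f \<in> borel_measurable (PiM I (\<lambda>_. borel))"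
  shows "(\<integral>\<^sup>+x. f x \<partial>PiM I (\<lambda>i. gauss (\<sigma> i)))
    = (\<integral>\<^sup>+x. ennreal (exp (- (\<Sum>i\<in>I. a i * x i / (\<sigma> i)\<^sup>2 + (a i)\<^sup>2 / (2 * (\<sigma> i)\<^sup>2))))
         * f (\<lambda>i\<in>I. x i + a i) \<partial>PiM I (\<lambda>i. gauss (\<sigma> i)))"
proof -
  have [measurable_cong]: "sets (Leb I) = sets (PiM I (\<lambda>_. borel :: real measure))"
    by (simp cong: sets_PiM_cong)
  note f[measurable]
  have [measurable]: "(\<lambda>x. \<lambda>i\<in>I. x i + a i) \<in> measurable (PiM I (\<lambda>_. borel)) (PiM I (\<lambda>_. borel :: real measure))"
    by measurable
  have [measurable]: "(\<lambda>x. \<Prod>i\<in>I. normal_density 0 (\<sigma> i) (x i)) \<in> borel_measurable (PiM I (\<lambda>_. borel))"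
    "(\<lambda>x. \<Sum>i\<in>I. a i * x i / (\<sigma> i)\<^sup>2 + (a i)\<^sup>2 / (2 * (\<sigma> i)\<^sup>2)) \<in> borel_measurable (PiM I (\<lambda>_. borel))"
    by measurable
  have eq: "(\<Prod>i\<in>I. normal_density 0 (\<sigma> i) (x i + a i)) = (\<Prod>i\<in>I. normal_density 0 (\<sigma> i) (x i))
     * exp (- (\<Sum>i\<in>I. a i * x i / (\<sigma> i)\<^sup>2 + (a i)\<^sup>2 / (2 * (\<sigma> i)\<^sup>2)))" for x
    using \<sigma> by (simp add: normal_density_add prod.distrib exp_sum[OF fin, symmetric] sum_negf del: minus_add_distrib)
  have "(\<integral>\<^sup>+x. f x \<partial>PiM I (\<lambda>i. gauss (\<sigma> i)))
     = (\<integral>\<^sup>+x. ennreal (\<Prod>i\<in>I. normal_density 0 (\<sigma> i) (x i)) * f x \<partial>Leb I)"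
    unfolding PiM_gauss[OF fin] by (subst nn_integral_density) auto
  also have "\<dots> = (\<integral>\<^sup>+x. ennreal (\<Prod>i\<in>I. normal_density 0 (\<sigma> i) (a i + x i)) * f (\<lambda>i\<in>I. a i + x i) \<partial>Leb I)"
    by (subst nn_integral_PiM_lborel_affine[OF fin, where r = 1 and a = a])
       (auto intro!: nn_integral_cong cong: prod.cong)
  also have "\<dots> = (\<integral>\<^sup>+x. ennreal (\<Prod>i\<in>I. normal_density 0 (\<sigma> i) (x i))
     * (ennreal (exp (- (\<Sum>i\<in>I. a i * x i / (\<sigma> i)\<^sup>2 + (a i)\<^sup>2 / (2 * (\<sigma> i)\<^sup>2)))) * f (\<lambda>i\<in>I. x i + a i)) \<partial>Leb I)"
    by (intro nn_integral_cong)
       (simp add: add.commute[of "a _"] eq ennreal_mult prod_nonneg mult.assoc)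
  also have "\<dots> = (\<integral>\<^sup>+x. ennreal (exp (- (\<Sum>i\<in>I. a i * x i / (\<sigma> i)\<^sup>2 + (a i)\<^sup>2 / (2 * (\<sigma> i)\<^sup>2))))
         * f (\<lambda>i\<in>I. x i + a i) \<partial>PiM I (\<lambda>i. gauss (\<sigma> i)))"
    unfolding PiM_gauss[OF fin] by (subst nn_integral_density) auto
  finally show ?thesis .
qed

section \<open>Independent families and Brownian increments\<close>

context prob_space begin

lemma indep_vars_inj_reindex:
  assumes ind: "indep_vars M' Z I" and \<alpha>: "inj_on \<alpha> A" "\<alpha> ` A \<subseteq> I"
  shows "indep_vars (\<lambda>a. M' (\<alpha> a)) (\<lambda>a. Z (\<alpha> a)) A"
proof -
  have "indep_vars (\<lambda>a. PiM {\<alpha> a} M') (\<lambda>a \<omega>. restrict (\<lambda>i. Z i \<omega>) {\<alpha> a}) A"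
    using \<alpha> by (intro indep_vars_restrict[OF ind]) (auto simp: disjoint_family_on_def inj_on_def)
  then have "indep_vars (\<lambda>a. M' (\<alpha> a)) (\<lambda>a \<omega>. (\<lambda>x. x (\<alpha> a)) (restrict (\<lambda>i. Z i \<omega>) {\<alpha> a})) A"
    by (rule indep_vars_compose2) (auto intro!: measurable_component_singleton)
  then show ?thesis by simp
qed

text \<open>
  If random vectors are independent and the entries of each vector are independent, then all entries
  together are independent: the probability of a box factorises first over the vectors and then
  within each of them.  Used to flatten independent paths into one family of increments.
\<close>
lemma indep_vars_Sigma:
  fixes Z :: "'j \<times> 'k \<Rightarrow> 'a \<Rightarrow> real"
  assumes fin: "finite J" "\<And>j. j \<in> J \<Longrightarrow> finite (L j)"
    and outer: "indep_vars (\<lambda>j. PiM (L j) (\<lambda>_. borel)) (\<lambda>j \<omega>. \<lambda>k\<in>L j. Z (j, k) \<omega>) J"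
    and inner: "\<And>j. j \<in> J \<Longrightarrow> indep_vars (\<lambda>_. borel) (\<lambda>k. Z (j, k)) (L j)"
  shows "indep_vars (\<lambda>_. borel) Z (SIGMA j:J. L j)"
proof (cases "(SIGMA j:J. L j) = {}")
  case True
  then show ?thesis by (auto simp: indep_vars_def indep_sets_def)
next
  case False
  let ?S = "SIGMA j:J. L j"
  from False have J: "J \<noteq> {}" by auto
  have finS: "finite ?S" using fin by auto
  have rv[measurable]: "Z (j, k) \<in> borel_measurable M" if "j \<in> J" "k \<in> L j" for j k
    using inner[OF that(1)] that(2) by (auto simp: indep_vars_def)
  have "(\<forall>A\<in>(\<Pi> i\<in>?S. sets borel). prob (\<Inter>i\<in>?S. Z i -` A i \<inter> space M)
      = (\<Prod>i\<in>?S. prob (Z i -` A i \<inter> space M)))"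
  proof
    fix A :: "'j \<times> 'k \<Rightarrow> real set" assume A: "A \<in> (\<Pi> i\<in>?S. sets borel)"
    let ?R = "\<lambda>j. {x \<in> space (PiM (L j) (\<lambda>_. borel)). \<forall>k\<in>L j. x k \<in> A (j, k)}"
    have R: "?R j \<in> sets (PiM (L j) (\<lambda>_. borel))" if "j \<in> J" for j
    proof -
      have [measurable]: "A (j, k) \<in> sets borel" if "k \<in> L j" for k
        using A that \<open>j \<in> J\<close> by auto
      show ?thesis using fin(2)[OF that] by measurable
    qed
    have pre: "(\<lambda>\<omega>. \<lambda>k\<in>L j. Z (j, k) \<omega>) -` ?R j \<inter> space M
      = {\<omega>\<in>space M. \<forall>k\<in>L j. Z (j, k) \<omega> \<in> A (j, k)}" for j
      by (auto simp: space_PiM)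
    have one: "prob {\<omega>\<in>space M. \<forall>k\<in>L j. Z (j, k) \<omega> \<in> A (j, k)}
      = (\<Prod>k\<in>L j. prob (Z (j, k) -` A (j, k) \<inter> space M))" if "j \<in> J" for j
    proof (cases "L j = {}")
      case True
      then show ?thesis by (simp add: prob_space)
    next
      case False
      have "prob (\<Inter>k\<in>L j. Z (j, k) -` A (j, k) \<inter> space M)
        = (\<Prod>k\<in>L j. prob (Z (j, k) -` A (j, k) \<inter> space M))"
        using A that by (intro indep_varsD[OF inner[OF that]] False fin) auto
      also have "(\<Inter>k\<in>L j. Z (j, k) -` A (j, k) \<inter> space M)
        = {\<omega>\<in>space M. \<forall>k\<in>L j. Z (j, k) \<omega> \<in> A (j, k)}"
        using False by auto
      finally show ?thesis .
    qed
    have "(\<Inter>i\<in>?S. Z i -` A i \<inter> space M)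
      = (\<Inter>j\<in>J. (\<lambda>\<omega>. \<lambda>k\<in>L j. Z (j, k) \<omega>) -` ?R j \<inter> space M)"
      unfolding pre using False by auto
    also have "prob \<dots> = (\<Prod>j\<in>J. prob ((\<lambda>\<omega>. \<lambda>k\<in>L j. Z (j, k) \<omega>) -` ?R j \<inter> space M))"
      by (intro indep_varsD[OF outer] J fin R) auto
    also have "\<dots> = (\<Prod>j\<in>J. \<Prod>k\<in>L j. prob (Z (j, k) -` A (j, k) \<inter> space M))"
      unfolding pre by (intro prod.cong refl one)
    also have "\<dots> = (\<Prod>i\<in>?S. prob (Z i -` A i \<inter> space M))"
      using fin by (subst prod.Sigma) (auto intro!: prod.cong)
    finally show "prob (\<Inter>i\<in>?S. Z i -` A i \<inter> space M)
      = (\<Prod>i\<in>?S. prob (Z i -` A i \<inter> space M))" .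
  qed
  then show ?thesis
    by (subst indep_vars_finite[where E = "\<lambda>_. sets borel"])
       (auto simp: False finS sets.sigma_sets_eq[of borel, simplified] Int_stable_def)
qed

lemma nn_integral_indep_gauss:
  fixes Z :: "'i \<Rightarrow> 'a \<Rightarrow> real"
  assumes ind: "indep_vars (\<lambda>_. borel) Z I" and I: "I \<noteq> {}"
    and Z: "\<And>i. i \<in> I \<Longrightarrow> distributed M lborel (Z i) (normal_density 0 (\<sigma> i))"
    and f: "f \<in> borel_measurable (PiM I (\<lambda>_. borel))"
  shows "(\<integral>\<^sup>+\<omega>. f (\<lambda>i\<in>I. Z i \<omega>) \<partial>M) = (\<integral>\<^sup>+x. f x \<partial>PiM I (\<lambda>i. gauss (\<sigma> i)))"
proof -
  have rv: "Z i \<in> borel_measurable M" if "i \<in> I" for i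
    using ind that by (auto simp: indep_vars_def)
  then have [measurable]: "(\<lambda>\<omega>. \<lambda>i\<in>I. Z i \<omega>) \<in> measurable M (PiM I (\<lambda>_. borel))"
    by (intro measurable_restrict)
  note f[measurable]
  have "distr M borel (Z i) = gauss (\<sigma> i)" if "i \<in> I" for i
  proof -
    have "distr M borel (Z i) = distr M lborel (Z i)"
      by (rule distr_cong) auto
    also have "\<dots> = gauss (\<sigma> i)"
      using distributed_distr_eq_density[OF Z[OF that]] by (simp add: gauss_def)
    finally show ?thesis .
  qed
  then have "(\<Pi>\<^sub>M i\<in>I. gauss (\<sigma> i)) = (\<Pi>\<^sub>M i\<in>I. distr M borel (Z i))"
    by (intro PiM_cong) auto
  also have "\<dots> = distr M (\<Pi>\<^sub>M i\<in>I. borel) (\<lambda>\<omega>. \<lambda>i\<in>I. Z i \<omega>)"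
    using ind rv indep_vars_iff_distr_eq_PiM'[OF I, where M' = "\<lambda>_. borel" and X = Z] by simp
  finally show ?thesis
    by (simp add: nn_integral_distr)
qed

text \<open>
  Functions of disjoint parts of an independent family may be evaluated at two independent sample
  points.  The reindexings \<open>\<alpha>\<close> and \<open>\<beta>\<close> allow the two parts to be presented as vectors over different
  index types.
\<close>
lemma nn_integral_indep_decouple:
  assumes ind: "indep_vars M' Z I"
    and \<alpha>: "inj_on \<alpha> A" "\<alpha> ` A \<subseteq> I" and \<beta>: "inj_on \<beta> B" "\<beta> ` B \<subseteq> I"
    and disj: "\<alpha> ` A \<inter> \<beta> ` B = {}"
    and f: "f \<in> borel_measurable (PiM A (\<lambda>a. M' (\<alpha> a)) \<Otimes>\<^sub>M PiM B (\<lambda>b. M' (\<beta> b)))"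
  shows "(\<integral>\<^sup>+\<omega>. f (\<lambda>a\<in>A. Z (\<alpha> a) \<omega>, \<lambda>b\<in>B. Z (\<beta> b) \<omega>) \<partial>M)
    = (\<integral>\<^sup>+\<omega>. (\<integral>\<^sup>+\<omega>'. f (\<lambda>a\<in>A. Z (\<alpha> a) \<omega>, \<lambda>b\<in>B. Z (\<beta> b) \<omega>') \<partial>M) \<partial>M)"
proof -
  let ?S = "PiM (\<alpha> ` A) M'" and ?T = "PiM (\<beta> ` B) M'"
  let ?X = "\<lambda>\<omega>. restrict (\<lambda>i. Z i \<omega>) (\<alpha> ` A)" and ?Y = "\<lambda>\<omega>. restrict (\<lambda>i. Z i \<omega>) (\<beta> ` B)"
  let ?g = "\<lambda>(x, y). f (\<lambda>a\<in>A. x (\<alpha> a), \<lambda>b\<in>B. y (\<beta> b))"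
  note f[measurable]
  have [measurable]: "(\<lambda>x. \<lambda>a\<in>A. x (\<alpha> a)) \<in> measurable ?S (PiM A (\<lambda>a. M' (\<alpha> a)))"
    "(\<lambda>x. \<lambda>b\<in>B. x (\<beta> b)) \<in> measurable ?T (PiM B (\<lambda>b. M' (\<beta> b)))"
    by (auto intro!: measurable_restrict measurable_component_singleton)
  have g[measurable]: "?g \<in> borel_measurable (?S \<Otimes>\<^sub>M ?T)"
    by measurable
  have "indep_var ?S ?X ?T ?Y"
    using \<alpha> \<beta> disj by (intro indep_var_restrict[OF ind])
  then have [measurable]: "?X \<in> measurable M ?S" "?Y \<in> measurable M ?T"
    and eq: "distr M ?S ?X \<Otimes>\<^sub>M distr M ?T ?Y = distr M (?S \<Otimes>\<^sub>M ?T) (\<lambda>\<omega>. (?X \<omega>, ?Y \<omega>))"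
    unfolding indep_var_distribution_eq by blast+
  interpret Y: prob_space "distr M ?T ?Y" by (rule prob_space_distr) simp
  have X: "(\<lambda>a\<in>A. ?X \<omega> (\<alpha> a)) = (\<lambda>a\<in>A. Z (\<alpha> a) \<omega>)"
    and Y: "(\<lambda>b\<in>B. ?Y \<omega> (\<beta> b)) = (\<lambda>b\<in>B. Z (\<beta> b) \<omega>)" for \<omega>
    by (auto simp: fun_eq_iff)
  have "(\<integral>\<^sup>+\<omega>. ?g (?X \<omega>, ?Y \<omega>) \<partial>M) = (\<integral>\<^sup>+z. ?g z \<partial>(distr M ?S ?X \<Otimes>\<^sub>M distr M ?T ?Y))"
    unfolding eq by (rule nn_integral_distr[symmetric]) auto
  also have "\<dots> = (\<integral>\<^sup>+x. (\<integral>\<^sup>+y. ?g (x, y) \<partial>distr M ?T ?Y) \<partial>distr M ?S ?X)"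
    by (rule Y.nn_integral_fst[symmetric]) simp
  also have "\<dots> = (\<integral>\<^sup>+\<omega>. (\<integral>\<^sup>+y. ?g (?X \<omega>, y) \<partial>distr M ?T ?Y) \<partial>M)"
    by (rule nn_integral_distr) auto
  also have "\<dots> = (\<integral>\<^sup>+\<omega>. (\<integral>\<^sup>+\<omega>'. ?g (?X \<omega>, ?Y \<omega>') \<partial>M) \<partial>M)"
    using measurable_space[OF \<open>?X \<in> measurable M ?S\<close>]
    by (intro nn_integral_cong nn_integral_distr measurable_compose[OF _ g] measurable_Pair measurable_const) auto
  finally show ?thesis
    by (simp only: case_prod_conv X Y)
qed

end

text \<open>
  The increments of all motions, each along its own grid \<open>t j\<close> with \<open>m j\<close> steps, form a single
  independent normal family.  All later computations with laws refer to such families only.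
\<close>
lemma indep_brownian_increments:
  assumes ibm: "indep_brownian_motions M J I B" and fin: "finite J"
    and tI: "\<And>j k. j \<in> J \<Longrightarrow> k \<le> m j \<Longrightarrow> t j k \<in> I j"
    and t: "\<And>j k. j \<in> J \<Longrightarrow> k < m j \<Longrightarrow> t j k < t j (Suc k)"
  shows "prob_space.indep_vars M (\<lambda>_. borel)
      (\<lambda>i \<omega>. B (fst i) (t (fst i) (Suc (snd i))) \<omega> - B (fst i) (t (fst i) (snd i)) \<omega>) (SIGMA j:J. {..<m j})"
    and "\<And>i. i \<in> (SIGMA j:J. {..<m j}) \<Longrightarrow>
      distributed M lborel (\<lambda>\<omega>. B (fst i) (t (fst i) (Suc (snd i))) \<omega> - B (fst i) (t (fst i) (snd i)) \<omega>)
        (normal_density 0 (sqrt (t (fst i) (Suc (snd i)) - t (fst i) (snd i))))"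
proof -
  interpret prob_space M using ibm by (simp add: indep_brownian_motions_def)
  have bm: "brownian_motion M (I j) (B j)" if "j \<in> J" for j
    using ibm that by (simp add: indep_brownian_motions_def)
  have paths: "indep_vars (\<lambda>j. PiM (I j) (\<lambda>_. borel)) (\<lambda>j \<omega>. \<lambda>s\<in>I j. B j s \<omega>) J"
    using ibm by (simp add: indep_brownian_motions_def)
  show "indep_vars (\<lambda>_. borel)
      (\<lambda>i \<omega>. B (fst i) (t (fst i) (Suc (snd i))) \<omega> - B (fst i) (t (fst i) (snd i)) \<omega>) (SIGMA j:J. {..<m j})"
  proof (rule indep_vars_Sigma[OF fin])
    have tI': "t j k \<in> I j" "t j (Suc k) \<in> I j" if "j \<in> J" "k < m j" for j k
      using tI that by auto
    have "indep_vars (\<lambda>j. PiM {..<m j} (\<lambda>_. borel))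
       (\<lambda>j \<omega>. (\<lambda>x. \<lambda>k\<in>{..<m j}. x (t j (Suc k)) - x (t j k)) (\<lambda>s\<in>I j. B j s \<omega>)) J"
      using tI' by (intro indep_vars_compose2[OF paths] measurable_restrict borel_measurable_diff
          measurable_component_singleton) auto
    then show "indep_vars (\<lambda>j. PiM {..<m j} (\<lambda>_. borel))
       (\<lambda>j \<omega>. \<lambda>k\<in>{..<m j}. B (fst (j, k)) (t (fst (j, k)) (Suc (snd (j, k)))) \<omega>
          - B (fst (j, k)) (t (fst (j, k)) (snd (j, k))) \<omega>) J"
      by (rule indep_vars_cong[THEN iffD1, rotated 3]) (use tI' in \<open>auto simp: fun_eq_iff\<close>)
    show "indep_vars (\<lambda>_. borel) (\<lambda>k \<omega>. B (fst (j, k)) (t (fst (j, k)) (Suc (snd (j, k)))) \<omega>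
          - B (fst (j, k)) (t (fst (j, k)) (snd (j, k))) \<omega>) {..<m j}" if "j \<in> J" for j
      using bm[OF that] tI[OF that] t[OF that] unfolding brownian_motion_def by simp
  qed auto
  show "distributed M lborel (\<lambda>\<omega>. B (fst i) (t (fst i) (Suc (snd i))) \<omega> - B (fst i) (t (fst i) (snd i)) \<omega>)
        (normal_density 0 (sqrt (t (fst i) (Suc (snd i)) - t (fst i) (snd i))))"
    if "i \<in> (SIGMA j:J. {..<m j})" for i
    using that bm[of "fst i"] tI[of "fst i" "snd i"] tI[of "fst i" "Suc (snd i)"] t[of "fst i" "snd i"]
    unfolding brownian_motion_def by auto
qed

section \<open>Exponential maximal inequalities\<close>

text \<open>
  Doob's inequality for the supermartingale of the exponentials of the partial sums.
\<close>
lemma (in prob_space) exponential_maximal_inequality: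
  fixes X :: "nat \<Rightarrow> 'a \<Rightarrow> real"
  assumes ind: "indep_vars (\<lambda>_. borel) X {..<m}"
    and exp: "\<And>k. k < m \<Longrightarrow> (\<integral>\<^sup>+\<omega>. ennreal (exp (X k \<omega>)) \<partial>M) \<le> 1"
  shows "prob {\<omega>\<in>space M. \<exists>q\<le>m. z \<le> (\<Sum>k<q. X k \<omega>)} \<le> exp (- z)"
proof -
  have rv[measurable]: "X k \<in> borel_measurable M" if "k < m" for k
    using ind that by (auto simp: indep_vars_def)
  \<comment> \<open>the exponential of the partial sum, divided by \<open>exp z\<close>, and replaced by \<open>1\<close> once the level has been reached: its mean does not increase\<close>
  define \<Phi> where "\<Phi> n \<omega> = (if \<exists>q\<le>n. z \<le> (\<Sum>k<q. X k \<omega>) then 1 else ennreal (exp ((\<Sum>k<n. X k \<omega>) - z)))"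
    for n \<omega>
  have "(\<integral>\<^sup>+\<omega>. \<Phi> n \<omega> \<partial>M) \<le> ennreal (exp (- z))" if "n \<le> m" for n
    using that
  proof (induction n)
    case 0
    have "\<Phi> 0 \<omega> \<le> ennreal (exp (- z))" for \<omega>
      by (auto simp: \<Phi>_def ennreal_ge_1)
    then have "(\<integral>\<^sup>+\<omega>. \<Phi> 0 \<omega> \<partial>M) \<le> (\<integral>\<^sup>+\<omega>. ennreal (exp (- z)) \<partial>M)"
      by (intro nn_integral_mono)
    then show ?case by (simp add: emeasure_space_1)
  next
    case (Suc n)
    then have n: "n < m" by simp
    define f :: "(nat \<Rightarrow> real) \<times> (nat \<Rightarrow> real) \<Rightarrow> ennreal" where
      "f = (\<lambda>(x, y). if \<exists>q\<le>n. z \<le> (\<Sum>k<q. x k) then 1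
         else ennreal (exp ((\<Sum>k<n. x k) - z)) * ennreal (exp (y n)))"
    have [measurable]: "(\<lambda>x::nat \<Rightarrow> real. \<Sum>k<q. x k) \<in> borel_measurable (PiM {..<n} (\<lambda>_. borel))" if "q \<le> n" for q
      using that by (intro borel_measurable_sum measurable_component_singleton) auto
    have fm: "f \<in> borel_measurable (PiM {..<n} (\<lambda>_. borel) \<Otimes>\<^sub>M PiM {n} (\<lambda>_. borel))"
      unfolding f_def
      by (simp add: split_beta')
    have le: "\<Phi> (Suc n) \<omega> \<le> f (\<lambda>k\<in>{..<n}. X k \<omega>, \<lambda>k\<in>{n}. X k \<omega>)" for \<omega>
    proof -
      have *: "(\<Sum>k<q. (\<lambda>k\<in>{..<n}. X k \<omega>) k) = (\<Sum>k<q. X k \<omega>)" if "q \<le> n" for q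
        using that by (intro sum.cong) auto
      have iff: "(\<exists>q\<le>n. z \<le> (\<Sum>k<q. (\<lambda>k\<in>{..<n}. X k \<omega>) k)) \<longleftrightarrow> (\<exists>q\<le>n. z \<le> (\<Sum>k<q. X k \<omega>))"
        using * by auto
      show ?thesis
        unfolding f_def prod.case iff *[OF order_refl] \<Phi>_def
        by (auto simp: le_Suc_eq ennreal_mult[symmetric] exp_add[symmetric] algebra_simps ennreal_ge_1)
    qed
    have "(\<integral>\<^sup>+\<omega>. \<Phi> (Suc n) \<omega> \<partial>M) \<le> (\<integral>\<^sup>+\<omega>. f (\<lambda>k\<in>{..<n}. X k \<omega>, \<lambda>k\<in>{n}. X k \<omega>) \<partial>M)"
      by (intro nn_integral_mono le)
    also have "\<dots> = (\<integral>\<^sup>+\<omega>. (\<integral>\<^sup>+\<omega>'. f (\<lambda>k\<in>{..<n}. X k \<omega>, \<lambda>k\<in>{n}. X k \<omega>') \<partial>M) \<partial>M)"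
      using n by (intro nn_integral_indep_decouple[OF ind, of "\<lambda>k. k" "{..<n}" "\<lambda>k. k" "{n}", simplified] fm) auto
    also have "\<dots> \<le> (\<integral>\<^sup>+\<omega>. \<Phi> n \<omega> \<partial>M)"
    proof (intro nn_integral_mono)
      fix \<omega>
      have *: "(\<Sum>k<q. (\<lambda>k\<in>{..<n}. X k \<omega>) k) = (\<Sum>k<q. X k \<omega>)" if "q \<le> n" for q
        using that by (intro sum.cong) auto
      define H where "H \<longleftrightarrow> (\<exists>q\<le>n. z \<le> (\<Sum>k<q. X k \<omega>))"
      have iff: "(\<exists>q\<le>n. z \<le> (\<Sum>k<q. (\<lambda>k\<in>{..<n}. X k \<omega>) k)) \<longleftrightarrow> H"
        using * by (auto simp: H_def)
      have "(\<integral>\<^sup>+\<omega>'. ennreal (exp ((\<Sum>k<n. X k \<omega>) - z)) * ennreal (exp (X n \<omega>')) \<partial>M)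
         \<le> ennreal (exp ((\<Sum>k<n. X k \<omega>) - z)) * 1"
        using n mult_left_mono[OF exp[OF n], of "ennreal (exp ((\<Sum>k<n. X k \<omega>) - z))"]
        by (subst nn_integral_cmult) auto
      then show "(\<integral>\<^sup>+\<omega>'. f (\<lambda>k\<in>{..<n}. X k \<omega>, \<lambda>k\<in>{n}. X k \<omega>') \<partial>M) \<le> \<Phi> n \<omega>"
        unfolding f_def prod.case iff *[OF order_refl] \<Phi>_def H_def[symmetric]
        by (cases H) (simp_all add: emeasure_space_1)
    qed
    finally show ?case using Suc by auto
  qed
  then have *: "(\<integral>\<^sup>+\<omega>. \<Phi> m \<omega> \<partial>M) \<le> ennreal (exp (- z))" by simp
  have [measurable]: "(\<lambda>\<omega>. \<Sum>k<q. X k \<omega>) \<in> borel_measurable M" if "q \<le> m" for q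
    using that by (intro borel_measurable_sum rv) auto
  have "{\<omega>\<in>space M. \<exists>q\<in>{..m}. z \<le> (\<Sum>k<q. X k \<omega>)} \<in> sets M"
    by measurable
  then have ev: "{\<omega>\<in>space M. \<exists>q\<le>m. z \<le> (\<Sum>k<q. X k \<omega>)} \<in> sets M"
    by (simp add: Bex_def)
  have "emeasure M {\<omega>\<in>space M. \<exists>q\<le>m. z \<le> (\<Sum>k<q. X k \<omega>)}
      = (\<integral>\<^sup>+\<omega>. indicator {\<omega>\<in>space M. \<exists>q\<le>m. z \<le> (\<Sum>k<q. X k \<omega>)} \<omega> \<partial>M)"
    using ev by simp
  also have "\<dots> \<le> (\<integral>\<^sup>+\<omega>. \<Phi> m \<omega> \<partial>M)"
    by (intro nn_integral_mono) (auto simp: \<Phi>_def indicator_def)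
  also note *
  finally show ?thesis
    by (simp add: emeasure_eq_measure)
qed

text \<open>
  The integrand is the Cameron-Martin density of a shift, so this is \<open>Cameron_Martin\<close> for the constant
  function \<open>1\<close>.
\<close>
lemma (in prob_space) nn_integral_exp_gauss:
  fixes Z :: "'i \<Rightarrow> 'a \<Rightarrow> real"
  assumes fin: "finite I" and ind: "indep_vars (\<lambda>_. borel) Z I"
    and \<sigma>: "\<And>i. i \<in> I \<Longrightarrow> \<sigma> i \<noteq> 0"
    and Z: "\<And>i. i \<in> I \<Longrightarrow> distributed M lborel (Z i) (normal_density 0 (\<sigma> i))"
  shows "(\<integral>\<^sup>+\<omega>. ennreal (exp (\<Sum>i\<in>I. a i * Z i \<omega> - (a i)\<^sup>2 * (\<sigma> i)\<^sup>2 / 2)) \<partial>M) = 1"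
proof (cases "I = {}")
  case True
  then show ?thesis by (simp add: emeasure_space_1)
next
  case False
  have "(\<integral>\<^sup>+\<omega>. ennreal (exp (\<Sum>i\<in>I. a i * Z i \<omega> - (a i)\<^sup>2 * (\<sigma> i)\<^sup>2 / 2)) \<partial>M)
      = (\<integral>\<^sup>+\<omega>. ennreal (exp (\<Sum>i\<in>I. a i * (\<lambda>i\<in>I. Z i \<omega>) i - (a i)\<^sup>2 * (\<sigma> i)\<^sup>2 / 2)) \<partial>M)"
    by (intro nn_integral_cong) (auto intro!: sum.cong)
  also have "\<dots> = (\<integral>\<^sup>+x. ennreal (exp (\<Sum>i\<in>I. a i * x i - (a i)\<^sup>2 * (\<sigma> i)\<^sup>2 / 2)) \<partial>PiM I (\<lambda>i. gauss (\<sigma> i)))"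
    by (rule nn_integral_indep_gauss[OF ind False Z, where f = "\<lambda>x. ennreal (exp (\<Sum>i\<in>I. a i * x i - (a i)\<^sup>2 * (\<sigma> i)\<^sup>2 / 2))"]) measurable
  also have "\<dots> = (\<integral>\<^sup>+x. 1 \<partial>PiM I (\<lambda>i. gauss (\<sigma> i)))"
  proof (subst (2) Cameron_Martin[OF fin \<sigma>, where a = "\<lambda>i. - a i * (\<sigma> i)\<^sup>2"])
    have "(\<Sum>i\<in>I. a i * x i - (a i)\<^sup>2 * (\<sigma> i)\<^sup>2 / 2)
        = - (\<Sum>i\<in>I. - a i * (\<sigma> i)\<^sup>2 * x i / (\<sigma> i)\<^sup>2 + (- a i * (\<sigma> i)\<^sup>2)\<^sup>2 / (2 * (\<sigma> i)\<^sup>2))" for x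
      unfolding sum_negf[symmetric] using \<sigma> by (intro sum.cong refl) (auto simp: field_simps power2_eq_square)
    then show "(\<integral>\<^sup>+x. ennreal (exp (\<Sum>i\<in>I. a i * x i - (a i)\<^sup>2 * (\<sigma> i)\<^sup>2 / 2)) \<partial>PiM I (\<lambda>i. gauss (\<sigma> i)))
      = (\<integral>\<^sup>+x. ennreal (exp (- (\<Sum>i\<in>I. - a i * (\<sigma> i)\<^sup>2 * x i / (\<sigma> i)\<^sup>2 + (- a i * (\<sigma> i)\<^sup>2)\<^sup>2 / (2 * (\<sigma> i)\<^sup>2)))) * 1 \<partial>PiM I (\<lambda>i. gauss (\<sigma> i)))"
      by (simp only: mult_1_right)
  qed auto
  also have "\<dots> = (\<integral>\<^sup>+\<omega>. 1 \<partial>M)"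
    by (rule nn_integral_indep_gauss[OF ind False Z, symmetric]) auto
  finally show ?thesis by (simp add: emeasure_space_1)
qed

lemma (in prob_space) gaussian_maximal_inequality:
  fixes Z :: "'i \<Rightarrow> 'a \<Rightarrow> real" and G :: "nat \<Rightarrow> 'i set"
  assumes ind: "indep_vars (\<lambda>_. borel) Z I"
    and \<sigma>: "\<And>i. i \<in> I \<Longrightarrow> \<sigma> i \<noteq> 0"
    and Z: "\<And>i. i \<in> I \<Longrightarrow> distributed M lborel (Z i) (normal_density 0 (\<sigma> i))"
    and G: "\<And>q. q < m \<Longrightarrow> G q \<subseteq> I" "\<And>q. q < m \<Longrightarrow> finite (G q)" "disjoint_family_on G {..<m}"
  shows "prob {\<omega>\<in>space M. \<exists>q\<le>m. z \<le> (\<Sum>k<q. \<Sum>i\<in>G k. a i * Z i \<omega> - (a i)\<^sup>2 * (\<sigma> i)\<^sup>2 / 2)} \<le> exp (- z)"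
proof (rule exponential_maximal_inequality[where X = "\<lambda>q \<omega>. \<Sum>i\<in>G q. a i * Z i \<omega> - (a i)\<^sup>2 * (\<sigma> i)\<^sup>2 / 2"])
  have "indep_vars (\<lambda>q. PiM (G q) (\<lambda>_. borel)) (\<lambda>q \<omega>. restrict (\<lambda>i. Z i \<omega>) (G q)) {..<m}"
    using G by (intro indep_vars_restrict[OF ind]) auto
  then have "indep_vars (\<lambda>_. borel)
     (\<lambda>q \<omega>. (\<lambda>x. \<Sum>i\<in>G q. a i * x i - (a i)\<^sup>2 * (\<sigma> i)\<^sup>2 / 2) (restrict (\<lambda>i. Z i \<omega>) (G q))) {..<m}"
    by (rule indep_vars_compose2) measurable
  then show "indep_vars (\<lambda>_. borel) (\<lambda>q \<omega>. \<Sum>i\<in>G q. a i * Z i \<omega> - (a i)\<^sup>2 * (\<sigma> i)\<^sup>2 / 2) {..<m}"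
    by (simp cong: sum.cong)
  show "(\<integral>\<^sup>+\<omega>. ennreal (exp (\<Sum>i\<in>G k. a i * Z i \<omega> - (a i)\<^sup>2 * (\<sigma> i)\<^sup>2 / 2)) \<partial>M) \<le> 1" if "k < m" for k
    using nn_integral_exp_gauss[OF G(2)[OF that] indep_vars_subset[OF ind G(1)[OF that]], of \<sigma> a] \<sigma> Z G(1)[OF that]
    by (simp add: subset_eq)
qed

text \<open>
  Only the sum of the motions over the indices with \<open>x \<gamma> > 0\<close> is used: it has to exceed the
  sum of these levels, and the exponential of twice this sum, drift included, is a martingale.  As
  the rate is \<open>2\<close>, the bound beats the weight \<open>exp (\<Sum> x)\<close> in the definition of \<open>\<H>\<close> in every direction.
\<close>
lemma indep_brownian_drift_maximal_inequality:
  assumes ibm: "indep_brownian_motions M \<Gamma> (\<lambda>_. {0..}) B" and fin: "finite \<Gamma>" and d: "d > 0"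
  shows "measure M {\<omega>\<in>space M. \<exists>j\<le>m. \<forall>\<gamma>\<in>\<Gamma>. l * B \<gamma> (real j * d) \<omega> - l\<^sup>2 * (real j * d) > x \<gamma>}
    \<le> exp (- 2 * (\<Sum>\<gamma>\<in>\<Gamma>. max 0 (x \<gamma>)))"
proof -
  interpret prob_space M using ibm by (simp add: indep_brownian_motions_def)
  have bm: "brownian_motion M {0..} (B \<gamma>)" if "\<gamma> \<in> \<Gamma>" for \<gamma>
    using ibm that by (simp add: indep_brownian_motions_def)
  define S where "S = {\<gamma>\<in>\<Gamma>. x \<gamma> > 0}"
  have S: "S \<subseteq> \<Gamma>" "finite S" using fin by (auto simp: S_def)
  define Z where "Z = (\<lambda>i \<omega>. B (fst i) (real (Suc (snd i)) * d) \<omega> - B (fst i) (real (snd i) * d) \<omega>)"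
  have Z: "distributed M lborel (Z i) (normal_density 0 (sqrt d))" if "i \<in> (SIGMA \<gamma>:\<Gamma>. {..<m})" for i
    using indep_brownian_increments[OF ibm fin, of "\<lambda>_. m" "\<lambda>_ k. real k * d"] d that
    by (auto simp: Z_def algebra_simps)
  have ind: "indep_vars (\<lambda>_. borel) Z (SIGMA \<gamma>:\<Gamma>. {..<m})"
    using indep_brownian_increments[OF ibm fin, of "\<lambda>_. m" "\<lambda>_ k. real k * d"] d
    by (auto simp: Z_def)
  have sum: "(\<Sum>k<q. \<Sum>i\<in>S \<times> {k}. 2 * l * Z i \<omega> - (2 * l)\<^sup>2 * (sqrt d)\<^sup>2 / 2)
     = 2 * (\<Sum>\<gamma>\<in>S. l * B \<gamma> (real q * d) \<omega> - l\<^sup>2 * (real q * d))" if "\<omega> \<in> space M" for q \<omega>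
  proof -
    have "(\<Sum>i\<in>S \<times> {k}. 2 * l * Z i \<omega> - (2 * l)\<^sup>2 * (sqrt d)\<^sup>2 / 2)
      = (\<Sum>\<gamma>\<in>S. 2 * l * Z (\<gamma>, k) \<omega> - (2 * l)\<^sup>2 * (sqrt d)\<^sup>2 / 2)" for k
      by (rule sum.reindex_bij_witness[of _ "\<lambda>\<gamma>. (\<gamma>, k)" fst]) auto
    then have "(\<Sum>k<q. \<Sum>i\<in>S \<times> {k}. 2 * l * Z i \<omega> - (2 * l)\<^sup>2 * (sqrt d)\<^sup>2 / 2)
      = (\<Sum>\<gamma>\<in>S. \<Sum>k<q. 2 * l * Z (\<gamma>, k) \<omega> - (2 * l)\<^sup>2 * (sqrt d)\<^sup>2 / 2)"
      by (simp only: sum.swap[of _ S])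
    also have "\<dots> = (\<Sum>\<gamma>\<in>S. 2 * l * (\<Sum>k<q. Z (\<gamma>, k) \<omega>) - q * ((2 * l)\<^sup>2 * (sqrt d)\<^sup>2 / 2))"
      by (simp add: sum_subtractf sum_distrib_left)
    also have "\<dots> = (\<Sum>\<gamma>\<in>S. 2 * (l * B \<gamma> (real q * d) \<omega> - l\<^sup>2 * (real q * d)))"
    proof (intro sum.cong refl)
      fix \<gamma> assume "\<gamma> \<in> S"
      then have "B \<gamma> 0 \<omega> = 0" using bm[of \<gamma>] S that by (auto simp: brownian_motion_def)
      then have "(\<Sum>k<q. Z (\<gamma>, k) \<omega>) = B \<gamma> (real q * d) \<omega>"
        unfolding Z_def fst_conv snd_conv by (subst sum_lessThan_telescope) simp
      then show "2 * l * (\<Sum>k<q. Z (\<gamma>, k) \<omega>) - q * ((2 * l)\<^sup>2 * (sqrt d)\<^sup>2 / 2)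
        = 2 * (l * B \<gamma> (real q * d) \<omega> - l\<^sup>2 * (real q * d))"
        using d by (simp add: power2_eq_square algebra_simps)
    qed
    finally show ?thesis by (simp add: sum_distrib_left)
  qed
  define z where "z = 2 * (\<Sum>\<gamma>\<in>S. x \<gamma>)"
  have rv[measurable]: "Z i \<in> borel_measurable M" if "i \<in> (SIGMA \<gamma>:\<Gamma>. {..<m})" for i
    using ind that by (auto simp: indep_vars_def)
  have "prob {\<omega>\<in>space M. \<exists>j\<le>m. \<forall>\<gamma>\<in>\<Gamma>. l * B \<gamma> (real j * d) \<omega> - l\<^sup>2 * (real j * d) > x \<gamma>}
    \<le> prob {\<omega>\<in>space M. \<exists>q\<le>m. z \<le> (\<Sum>k<q. \<Sum>i\<in>S \<times> {k}. 2 * l * Z i \<omega> - (2 * l)\<^sup>2 * (sqrt d)\<^sup>2 / 2)}"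
  proof (rule finite_measure_mono)
    show "{\<omega>\<in>space M. \<exists>j\<le>m. \<forall>\<gamma>\<in>\<Gamma>. l * B \<gamma> (real j * d) \<omega> - l\<^sup>2 * (real j * d) > x \<gamma>}
      \<subseteq> {\<omega>\<in>space M. \<exists>q\<le>m. z \<le> (\<Sum>k<q. \<Sum>i\<in>S \<times> {k}. 2 * l * Z i \<omega> - (2 * l)\<^sup>2 * (sqrt d)\<^sup>2 / 2)}"
    proof safe
      fix \<omega> j assume "\<omega> \<in> space M" "j \<le> m"
        and *: "\<forall>\<gamma>\<in>\<Gamma>. l * B \<gamma> (real j * d) \<omega> - l\<^sup>2 * (real j * d) > x \<gamma>"
      then show "\<exists>q\<le>m. z \<le> (\<Sum>k<q. \<Sum>i\<in>S \<times> {k}. 2 * l * Z i \<omega> - (2 * l)\<^sup>2 * (sqrt d)\<^sup>2 / 2)"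
      proof (intro exI[of _ j] conjI)
        have "(\<Sum>\<gamma>\<in>S. x \<gamma>) \<le> (\<Sum>\<gamma>\<in>S. l * B \<gamma> (real j * d) \<omega> - l\<^sup>2 * (real j * d))"
          using * S by (intro sum_mono) (auto simp: less_imp_le)
        then show "z \<le> (\<Sum>k<j. \<Sum>i\<in>S \<times> {k}. 2 * l * Z i \<omega> - (2 * l)\<^sup>2 * (sqrt d)\<^sup>2 / 2)"
          unfolding sum[OF \<open>\<omega> \<in> space M\<close>] z_def by simp
      qed simp
    qed
    have [measurable]: "(\<lambda>\<omega>. \<Sum>k<q. \<Sum>i\<in>S \<times> {k}. 2 * l * Z i \<omega> - (2 * l)\<^sup>2 * (sqrt d)\<^sup>2 / 2) \<in> borel_measurable M"
      if "q \<in> {..m}" for q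
      using S that by (intro borel_measurable_sum borel_measurable_diff borel_measurable_times rv) auto
    have "{\<omega>\<in>space M. \<exists>q\<in>{..m}. z \<le> (\<Sum>k<q. \<Sum>i\<in>S \<times> {k}. 2 * l * Z i \<omega> - (2 * l)\<^sup>2 * (sqrt d)\<^sup>2 / 2)} \<in> events"
      by measurable
    then show "{\<omega>\<in>space M. \<exists>q\<le>m. z \<le> (\<Sum>k<q. \<Sum>i\<in>S \<times> {k}. 2 * l * Z i \<omega> - (2 * l)\<^sup>2 * (sqrt d)\<^sup>2 / 2)} \<in> events"
      by (simp only: Bex_def atMost_iff)
  qed
  also have "\<dots> \<le> exp (- z)"
    using S d by (intro gaussian_maximal_inequality[OF ind] Z) (auto simp: disjoint_family_on_def)
  also have "z = 2 * (\<Sum>\<gamma>\<in>\<Gamma>. max 0 (x \<gamma>))"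
  proof -
    have "(\<Sum>\<gamma>\<in>S. x \<gamma>) = (\<Sum>\<gamma>\<in>\<Gamma>. max 0 (x \<gamma>))"
      unfolding S_def using fin by (intro sum.mono_neutral_cong_left) auto
    then show ?thesis by (simp add: z_def)
  qed
  finally show ?thesis by simp
qed

section \<open>Time grids\<close>

text \<open>
  The way in which probabilities on grids determine probabilities on intervals: the events \<open>A m\<close> need
  not be monotone in \<open>m\<close>.
\<close>
lemma (in prob_space) events_grid_limit:
  assumes A: "\<And>m. A m \<in> events" "\<And>m. A m \<subseteq> C"
    and ev: "\<And>\<omega>. \<omega> \<in> C \<Longrightarrow> eventually (\<lambda>m. \<omega> \<in> A m) sequentially"
  shows "C \<in> events" "(\<lambda>m. prob (A m)) \<longlonglongrightarrow> prob C"
proof -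
  define D where "D m = (\<Inter>k\<in>{m..}. A k)" for m
  have D: "D m \<in> events" for m unfolding D_def using A(1) by (intro sets.countable_INT) auto
  have "C = (\<Union>m. D m)"
    using A(2) ev by (fastforce simp: D_def eventually_sequentially)
  moreover have "incseq D" by (force simp: D_def incseq_def)
  ultimately have "(\<lambda>m. prob (D m)) \<longlonglongrightarrow> prob C"
    using D finite_Lim_measure_incseq[of D] by auto
  show C: "C \<in> events" using \<open>C = (\<Union>m. D m)\<close> D by auto
  show "(\<lambda>m. prob (A m)) \<longlonglongrightarrow> prob C"
  proof (rule tendsto_sandwich[OF _ _ \<open>(\<lambda>m. prob (D m)) \<longlonglongrightarrow> prob C\<close> tendsto_const])
    show "\<forall>\<^sub>F m in sequentially. prob (D m) \<le> prob (A m)"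
      using A(1) by (intro always_eventually allI finite_measure_mono) (auto simp: D_def)
    show "\<forall>\<^sub>F m in sequentially. prob (A m) \<le> prob C"
      using A(2) C by (intro always_eventually allI finite_measure_mono) auto
  qed
qed

text \<open>
  Finitely many continuous functions that strictly exceed their levels at \<open>t\<close> also do so at the
  grid points next to \<open>t\<close>.  Strictness of the inequality is what makes passing from grids to intervals
  possible in both directions.
\<close>
lemma eventually_grid_point_exceeds:
  fixes f :: "'b \<Rightarrow> real \<Rightarrow> real"
  assumes fin: "finite \<Gamma>" and cont: "\<And>\<gamma>. \<gamma> \<in> \<Gamma> \<Longrightarrow> continuous_on {0..L} (f \<gamma>)"
    and L: "L > 0" and t: "t \<in> {0..L}" and ex: "\<And>\<gamma>. \<gamma> \<in> \<Gamma> \<Longrightarrow> f \<gamma> t > x \<gamma>"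
  shows "\<forall>\<^sub>F m in sequentially. \<exists>j\<le>Suc m. \<forall>\<gamma>\<in>\<Gamma>. f \<gamma> (real j * (L / real (Suc m))) > x \<gamma>"
proof -
  define j where "j m = nat \<lfloor>t * real (Suc m) / L\<rfloor>" for m
  define s where "s m = real (j m) * (L / real (Suc m))" for m
  have j: "real (j m) \<le> t * real (Suc m) / L" "t * real (Suc m) / L < real (j m) + 1" for m
    unfolding j_def using t L by (auto simp: of_nat_nat)
  have jm: "j m \<le> Suc m" for m
  proof -
    have "t * real (Suc m) / L \<le> real (Suc m)" using t L mult_right_mono[of t L "real (Suc m)"]
      by (simp add: divide_le_eq mult.commute)
    then have "real (j m) \<le> real (Suc m)" using j(1)[of m] by linarith
    then show ?thesis by (simp only: of_nat_le_iff)
  qed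
  have le: "s m \<le> t" "t - L / real (Suc m) \<le> s m" for m
  proof -
    define r where "r = L / real (Suc m)"
    have r: "r > 0" using L by (simp add: r_def)
    have "t * real (Suc m) / L = t / r" by (simp add: r_def)
    then have "real (j m) * r \<le> t" "t < (real (j m) + 1) * r"
      using j[of m] r by (simp_all add: pos_le_divide_eq pos_divide_less_eq)
    then show "s m \<le> t" "t - L / real (Suc m) \<le> s m"
      unfolding s_def r_def[symmetric] by (simp_all add: algebra_simps)
  qed
  have "s m \<in> {0..L}" for m
    using le[of m] t L by (auto simp: s_def)
  moreover have "s \<longlonglongrightarrow> t"
  proof (rule tendsto_sandwich[OF _ _ _ tendsto_const])
    show "(\<lambda>m. t - L / real (Suc m)) \<longlonglongrightarrow> t" by real_asymp
  qed (auto intro!: always_eventually le simp del: of_nat_Suc)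
  ultimately have "(\<lambda>m. f \<gamma> (s m)) \<longlonglongrightarrow> f \<gamma> t" if "\<gamma> \<in> \<Gamma>" for \<gamma>
    using t by (intro continuous_on_tendsto_compose[OF cont[OF that]] always_eventually) auto
  then have "\<forall>\<^sub>F m in sequentially. \<forall>\<gamma>\<in>\<Gamma>. f \<gamma> (s m) > x \<gamma>"
    using ex by (intro eventually_ball_finite[OF fin] ballI order_tendstoD) auto
  then show ?thesis
    by eventually_elim (use jm in \<open>auto simp: s_def\<close>)
qed

lemma sum_div_mod:
  fixes f :: "nat \<Rightarrow> nat \<Rightarrow> 'b :: comm_monoid_add"
  assumes "m > 0" "j \<le> m"
  shows "(\<Sum>k<a * m + j. f (k div m) (k mod m)) = (\<Sum>i<a. \<Sum>j<m. f i j) + (\<Sum>j<j. f a j)"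
proof -
  have block: "(\<Sum>k = i * m..<i * m + j. f (k div m) (k mod m)) = (\<Sum>j<j. f i j)" if "j \<le> m" for i j
    using that \<open>m > 0\<close>
    by (intro sum.reindex_bij_witness[of _ "\<lambda>j. i * m + j" "\<lambda>k. k - i * m"])
       (auto simp: div_add1_eq mod_simps less_diff_conv2 dest!: le_Suc_ex)
  have "(\<Sum>k<a * m + j. f (k div m) (k mod m))
    = (\<Sum>k<a * m. f (k div m) (k mod m)) + (\<Sum>k = a * m..<a * m + j. f (k div m) (k mod m))"
    by (subst sum.union_disjoint[symmetric]) (auto intro!: sum.cong)
  also have "(\<Sum>k<a * m. f (k div m) (k mod m)) = (\<Sum>i<a. \<Sum>k = i * m..<i * m + m. f (k div m) (k mod m))"
    by (rule sum.nat_group[symmetric])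
  finally show ?thesis using block assms by simp
qed

lemma sum_mod:
  fixes f :: "nat \<Rightarrow> real"
  assumes "p > 0"
  shows "(\<Sum>\<gamma><q * p. f (\<gamma> mod p)) = real q * (\<Sum>k<p. f k)"
  using sum_div_mod[OF assms, of 0 "\<lambda>_. f" q] by simp

section \<open>The tree with fixed offspring numbers\<close>

text \<open>
  The driving motions of a Brownian decision tree with fixed offspring numbers, separated from the
  process \<open>B\<close> of branches, which agrees with the branches built from \<open>W\<close> only almost surely.
\<close>
locale gaussian_tree = prob_space M for M :: "'a measure" +
  fixes W :: "nat \<times> nat \<Rightarrow> real \<Rightarrow> 'a \<Rightarrow> real" and \<tau> :: "nat \<Rightarrow> real" and n :: "nat \<Rightarrow> nat" and \<eta> :: nat
  assumes W: "indep_brownian_motions M (SIGMA i:{..\<eta>}. {..<offspring_prod n i})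
          (\<lambda>(i, k). {0..\<tau> (Suc i) - \<tau> i}) W"
    and \<eta>: "\<eta> \<ge> 1" and \<tau>0: "\<tau> 0 = 0" and \<tau>: "\<And>i. i \<le> \<eta> \<Longrightarrow> \<tau> i < \<tau> (Suc i)"
    and n: "\<And>i. i \<in> {1..\<eta>} \<Longrightarrow> n i \<ge> 1"
begin

abbreviation "P \<equiv> offspring_prod n"
abbreviation "K \<equiv> P \<eta>"
abbreviation "T \<equiv> \<tau> (Suc \<eta>)"
abbreviation "\<Delta> i \<equiv> \<tau> (Suc i) - \<tau> i"

abbreviation (input) "tree_branch \<omega> \<equiv> branch (\<lambda>j s. W j s \<omega>) \<tau> n \<eta>"

text \<open>
  Branch \<open>\<gamma>\<close> at time \<open>\<tau> i + s\<close> with the recursion unfolded: each of its ancestors contributes one complete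
  increment.  Unlike \<^const>\<open>level\<close>, which assigns a branching point to the interval on its left,
  this makes sense on both closed intervals that meet there.
\<close>
definition path :: "nat \<Rightarrow> nat \<Rightarrow> real \<Rightarrow> 'a \<Rightarrow> real" where
  "path i \<gamma> s \<omega> = (\<Sum>i'<i. W (i', \<gamma> mod P i') (\<Delta> i') \<omega>) + W (i, \<gamma> mod P i) s \<omega>"

text \<open>
  The variance at the final time of the average of all branches.  On level \<open>i\<close> the average is that of
  \<open>P i\<close> independent motions.
\<close>
definition v :: real where "v = (\<Sum>i\<le>\<eta>. \<Delta> i / real (P i))"

lemma P_pos: "i \<le> \<eta> \<Longrightarrow> P i > 0"
  using n unfolding offspring_prod_def by (force intro!: prod_pos)

lemma P_dvd: "i \<le> j \<Longrightarrow> P i dvd P j"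
  unfolding offspring_prod_def by (intro prod_dvd_prod_subset) auto

lemma \<tau>_mono: "i \<le> j \<Longrightarrow> j \<le> Suc \<eta> \<Longrightarrow> \<tau> i \<le> \<tau> j"
proof (induction j)
  case (Suc j)
  then show ?case using \<tau>[of j] by (cases "i = Suc j") auto
qed simp

lemma \<Delta>_pos: "i \<le> \<eta> \<Longrightarrow> \<Delta> i > 0"
  using \<tau> by simp

lemma bm: "i \<le> \<eta> \<Longrightarrow> k < P i \<Longrightarrow> brownian_motion M {0..\<Delta> i} (W (i, k))"
  using W unfolding indep_brownian_motions_def by force

lemma W_measurable: "i \<le> \<eta> \<Longrightarrow> k < P i \<Longrightarrow> s \<in> {0..\<Delta> i} \<Longrightarrow> W (i, k) s \<in> borel_measurable M"
  using bm[of i k] unfolding brownian_motion_def by auto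

lemma W_0: "i \<le> \<eta> \<Longrightarrow> k < P i \<Longrightarrow> \<omega> \<in> space M \<Longrightarrow> W (i, k) 0 \<omega> = 0"
  using bm[of i k] unfolding brownian_motion_def by auto

lemma W_continuous:
  "i \<le> \<eta> \<Longrightarrow> k < P i \<Longrightarrow> \<omega> \<in> space M \<Longrightarrow> continuous_on {0..\<Delta> i} (\<lambda>s. W (i, k) s \<omega>)"
  using bm[of i k] unfolding brownian_motion_def by auto

lemma path_measurable: "i \<le> \<eta> \<Longrightarrow> s \<in> {0..\<Delta> i} \<Longrightarrow> path i \<gamma> s \<in> borel_measurable M"
  unfolding path_def[abs_def] using \<Delta>_pos P_pos
  by (intro borel_measurable_add borel_measurable_sum W_measurable) (auto simp: less_imp_le)

lemma path_continuous: "i \<le> \<eta> \<Longrightarrow> \<omega> \<in> space M \<Longrightarrow> continuous_on {0..\<Delta> i} (\<lambda>s. path i \<gamma> s \<omega>)"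
  unfolding path_def using P_pos by (intro continuous_on_add continuous_on_const W_continuous) auto

lemma tree_vec_eq:
  "i \<le> \<eta> \<Longrightarrow> tree_vec (\<lambda>j s. W j s \<omega>) \<tau> n i t (\<gamma> mod P i) = path i \<gamma> (t - \<tau> i) \<omega>"
proof (induction i arbitrary: t)
  case 0
  then show ?case by (simp add: path_def \<tau>0)
next
  case (Suc i)
  have "\<gamma> mod P (Suc i) mod P i = \<gamma> mod P i"
    by (intro mod_mod_cancel P_dvd) simp
  then show ?case using Suc by (simp add: path_def)
qed

text \<open>
  At a branching point the two descriptions agree because the driving motions start at \<open>0\<close>.
\<close>
lemma branch_eq:
  assumes "\<omega> \<in> space M" "i \<le> \<eta>" "t \<in> {\<tau> i..\<tau> (Suc i)}"
  shows "tree_branch \<omega> \<gamma> t = path i \<gamma> (t - \<tau> i) \<omega>"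
proof -
  have level: "level \<tau> \<eta> t = i" if "i \<le> \<eta>" "\<tau> i < t \<or> i = 0" "t \<le> \<tau> (Suc i)" for i
  proof (cases "i = 0")
    case True
    then show ?thesis using that by (auto simp: level_def)
  next
    case False
    have "t > \<tau> 1" using \<tau>_mono[of 1 i] that False by auto
    moreover have "Max {i \<in> {1..\<eta>}. t > \<tau> i} = i"
    proof (rule Max_eqI)
      fix k assume k: "k \<in> {i \<in> {1..\<eta>}. t > \<tau> i}"
      then show "k \<le> i" using \<tau>_mono[of "Suc i" k] that by force
    qed (use that False in auto)
    ultimately show ?thesis by (simp add: level_def)
  qed
  show ?thesis
  proof (cases "\<tau> i < t \<or> i = 0")
    case True
    then show ?thesis
      using level[of i] assms by (simp add: branch_def tree_vec_eq)
  next
    case False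
    then obtain k where i: "i = Suc k" by (cases i) auto
    have t: "t = \<tau> (Suc k)" using False assms i by auto
    have "level \<tau> \<eta> t = k" using assms i t \<tau>[of k] by (intro level) auto
    then have "tree_branch \<omega> \<gamma> t = path k \<gamma> (\<Delta> k) \<omega>"
      using assms i t by (simp add: branch_def tree_vec_eq)
    also have "\<dots> = path i \<gamma> 0 \<omega>"
      using W_0[OF assms(2) _ assms(1), of "\<gamma> mod P i"] P_pos[OF assms(2)] by (simp add: path_def i)
    finally show ?thesis by (simp add: t i)
  qed
qed

text \<open>
  In the average over all \<open>K\<close> branches every vertex of level \<open>i\<close> occurs equally often, since \<open>P i\<close>
  divides \<open>K\<close>.
\<close>
lemma sum_path:
  assumes "i \<le> \<eta>"
  shows "(\<Sum>\<gamma><K. path i \<gamma> s \<omega>) / real K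
    = (\<Sum>i'<i. (\<Sum>k<P i'. W (i', k) (\<Delta> i') \<omega>) / real (P i')) + (\<Sum>k<P i. W (i, k) s \<omega>) / real (P i)"
proof -
  have *: "(\<Sum>\<gamma><K. f (\<gamma> mod P i)) / real K = (\<Sum>k<P i. f k) / real (P i)" if "i \<le> \<eta>" for i and f :: "nat \<Rightarrow> real"
  proof -
    have "P i dvd K" using P_dvd that by simp
    then obtain q where q: "K = q * P i" by (auto simp: dvd_def mult.commute)
    show ?thesis using sum_mod[OF P_pos[OF that], of f q] P_pos[OF that] P_pos[of \<eta>] q by (auto simp: field_simps)
  qed
  have "(\<Sum>\<gamma><K. path i \<gamma> s \<omega>) / real K
     = (\<Sum>i'<i. (\<Sum>\<gamma><K. W (i', \<gamma> mod P i') (\<Delta> i') \<omega>) / real K) + (\<Sum>\<gamma><K. W (i, \<gamma> mod P i) s \<omega>) / real K"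
    unfolding path_def by (simp add: sum.distrib add_divide_distrib sum_divide_distrib sum.swap[of _ "{..<i}"])
  also have "\<dots> = (\<Sum>i'<i. (\<Sum>k<P i'. W (i', k) (\<Delta> i') \<omega>) / real (P i')) + (\<Sum>k<P i. W (i, k) s \<omega>) / real (P i)"
    using assms by (intro arg_cong2[where f = "(+)"] sum.cong refl *[of _ "\<lambda>k. W (_, k) _ \<omega>"]) auto
  finally show ?thesis .
qed

end

section \<open>Early exceedances\<close>

context gaussian_tree begin

lemma segment_exists:
  assumes "t \<in> {0..\<tau> (Suc k)}" "k \<le> \<eta>"
  shows "\<exists>i\<le>k. \<tau> i \<le> t \<and> t \<le> \<tau> (Suc i)"
  using assms
proof (induction k)
  case 0
  then show ?case by (auto simp: \<tau>0)
next
  case (Suc k)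
  then show ?case by (cases "t \<le> \<tau> (Suc k)") (force simp: le_Suc_eq)+
qed

text \<open>
  If all branches exceed a level then so does their average, which has independent Gaussian increments
  and reaches the variance \<open>v - \<delta> / K\<close> at time \<open>T - \<delta>\<close>.  The bound is the maximal inequality for
  the exponential martingale of the average with parameter \<open>\<theta>\<close>; the drift is estimated by
  \<open>\<bar>c\<bar> T\<close>.
\<close>
lemma early_exceedance_bound:
  fixes \<delta> \<theta> u c :: real
  assumes \<delta>: "0 \<le> \<delta>" "\<delta> < \<Delta> \<eta>" and \<theta>: "\<theta> \<ge> 0"
  defines "A \<equiv> {\<omega>\<in>space M. \<exists>t\<in>{0..T - \<delta>}. \<forall>\<gamma><K. tree_branch \<omega> \<gamma> t - c * t > u}"
  shows "A \<in> events"
    and "prob A \<le> exp (- \<theta> * (u - \<bar>c\<bar> * T) + \<theta>\<^sup>2 * (v - \<delta> / real K) / 2)"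
proof -
  define L where "L i = \<Delta> i - (if i = \<eta> then \<delta> else 0)" for i
  have L: "L i > 0" "L i \<le> \<Delta> i" if "i \<le> \<eta>" for i
    using \<delta> \<Delta>_pos[OF that] by (auto simp: L_def)
  have TL: "\<tau> i + L i \<le> T" if "i \<le> \<eta>" for i
    using L[OF that] \<tau>_mono[of "Suc i" "Suc \<eta>"] that by auto
  have A_eq: "A = {\<omega>\<in>space M. \<exists>i\<le>\<eta>. \<exists>s\<in>{0..L i}. \<forall>\<gamma><K. path i \<gamma> s \<omega> - c * (\<tau> i + s) > u}" (is "_ = ?A'")
  proof safe
    fix \<omega> assume "\<omega> \<in> A"
    then obtain t where \<omega>: "\<omega> \<in> space M" and t: "t \<in> {0..T - \<delta>}"
      and ex: "\<forall>\<gamma><K. tree_branch \<omega> \<gamma> t - c * t > u"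
      unfolding A_def by blast
    obtain i where i: "i \<le> \<eta>" "\<tau> i \<le> t" "t \<le> \<tau> (Suc i)"
      using segment_exists[of t \<eta>] t \<delta> by auto
    have "t - \<tau> i \<in> {0..L i}" using i t by (auto simp: L_def)
    moreover have "\<forall>\<gamma><K. path i \<gamma> (t - \<tau> i) \<omega> - c * (\<tau> i + (t - \<tau> i)) > u"
      using ex branch_eq[OF \<omega> i(1), of t] i by simp
    ultimately show "\<omega> \<in> space M" "\<exists>i\<le>\<eta>. \<exists>s\<in>{0..L i}. \<forall>\<gamma><K. path i \<gamma> s \<omega> - c * (\<tau> i + s) > u"
      using \<omega> i by blast+
  next
    fix \<omega> i s assume \<omega>: "\<omega> \<in> space M" and i: "i \<le> \<eta>" and s: "s \<in> {0..L i}"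
      and ex: "\<forall>\<gamma><K. path i \<gamma> s \<omega> - c * (\<tau> i + s) > u"
    have "\<tau> i + s \<in> {\<tau> i..\<tau> (Suc i)}" using s L[OF i] by auto
    then have "\<forall>\<gamma><K. tree_branch \<omega> \<gamma> (\<tau> i + s) - c * (\<tau> i + s) > u"
      using ex branch_eq[OF \<omega> i, of "\<tau> i + s"] by simp
    moreover have "\<tau> i + s \<in> {0..T - \<delta>}"
    proof -
      have "\<tau> i \<ge> 0" using \<tau>_mono[of 0 i] i \<tau>0 by simp
      moreover have "\<tau> i + s \<le> T - \<delta>"
      proof (cases "i = \<eta>")
        case True
        then show ?thesis using s by (simp add: L_def)
      next
        case False
        then have "\<tau> (Suc i) \<le> \<tau> \<eta>" using i by (intro \<tau>_mono) auto
        then show ?thesis using False s \<delta> by (simp add: L_def)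
      qed
      ultimately show ?thesis using s by simp
    qed
    ultimately show "\<omega> \<in> A" using \<omega> unfolding A_def by blast
  qed
  define G where "G m = {\<omega>\<in>space M. \<exists>i\<in>{..\<eta>}. \<exists>j\<in>{..Suc m}. \<forall>\<gamma>\<in>{..<K}.
    path i \<gamma> (real j * (L i / real (Suc m))) \<omega> - c * (\<tau> i + real j * (L i / real (Suc m))) > u}" for m
  have grid: "real j * (L i / real (Suc m)) \<in> {0..L i}" if "i \<le> \<eta>" "j \<le> Suc m" for i j m
  proof -
    have "real j * L i \<le> real (Suc m) * L i"
      using that L(1)[OF that(1)] by (intro mult_right_mono) auto
    then show ?thesis using L(1)[OF that(1)] by (simp add: divide_le_eq mult.commute)
  qed
  have grid': "real j * (L i / real (Suc m)) \<in> {0..\<Delta> i}" if "i \<le> \<eta>" "j \<le> Suc m" for i j m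
    using grid[OF that] L[OF that(1)] by auto
  have [measurable]: "path i \<gamma> (real j * (L i / real (Suc m))) \<in> borel_measurable M"
    if "i \<in> {..\<eta>}" "j \<in> {..Suc m}" for i \<gamma> j m
    using that by (intro path_measurable grid') auto
  have G_meas: "G m \<in> events" for m
    unfolding G_def by measurable
  have G_sub: "G m \<subseteq> A" for m
  proof
    fix \<omega> assume "\<omega> \<in> G m"
    then obtain i j where \<omega>: "\<omega> \<in> space M" and i: "i \<le> \<eta>" "j \<le> Suc m"
      and "\<forall>\<gamma>\<in>{..<K}. path i \<gamma> (real j * (L i / real (Suc m))) \<omega> - c * (\<tau> i + real j * (L i / real (Suc m))) > u"
      unfolding G_def by blast
    then show "\<omega> \<in> A"
      unfolding A_eq using grid[OF i] by blast
  qed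
  have G_ev: "\<forall>\<^sub>F m in sequentially. \<omega> \<in> G m" if "\<omega> \<in> A" for \<omega>
  proof -
    from that obtain i s where \<omega>: "\<omega> \<in> space M" and i: "i \<le> \<eta>" and s: "s \<in> {0..L i}"
      and ex: "\<forall>\<gamma><K. path i \<gamma> s \<omega> - c * (\<tau> i + s) > u"
      unfolding A_eq by blast
    have "\<forall>\<^sub>F m in sequentially. \<exists>j\<le>Suc m. \<forall>\<gamma>\<in>{..<K}.
      path i \<gamma> (real j * (L i / real (Suc m))) \<omega> - c * (\<tau> i + real j * (L i / real (Suc m))) > u"
      using ex L[OF i] s
      by (intro eventually_grid_point_exceeds[where x = "\<lambda>_. u" and
            f = "\<lambda>\<gamma> s. path i \<gamma> s \<omega> - c * (\<tau> i + s)"] continuous_intros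
            continuous_on_subset[OF path_continuous[OF i \<omega>]]) auto
    then show ?thesis
      by eventually_elim (use \<omega> i in \<open>auto simp: G_def simp del: of_nat_Suc\<close>)
  qed
  note lim = events_grid_limit[of G A, OF G_meas G_sub G_ev]
  show "A \<in> events" by (rule lim(1))
  have K: "K > 0" by (rule P_pos) simp
  have bound: "prob (G m) \<le> exp (- \<theta> * (u - \<bar>c\<bar> * T) + \<theta>\<^sup>2 * (v - \<delta> / real K) / 2)" for m
  proof -
    define M' where "M' = Suc m"
    define d where "d i = L i / real M'" for i
    have M': "M' > 0" by (simp add: M'_def)
    have d: "d i > 0" if "i \<le> \<eta>" for i using L(1)[OF that] by (simp add: d_def M'_def)
    define J where "J = (SIGMA i:{..\<eta>}. {..<P i})"
    have finJ: "finite J" by (simp add: J_def)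
    define Z where "Z = (\<lambda>x \<omega>. W (fst x) (real (Suc (snd x)) * d (fst (fst x))) \<omega> - W (fst x) (real (snd x) * d (fst (fst x))) \<omega>)"
    have tI: "real k * d (fst p) \<in> (\<lambda>(i, k). {0..\<Delta> i}) p" if "p \<in> J" "k \<le> M'" for p k
      using grid'[of "fst p" k m] that by (auto simp: J_def d_def M'_def simp del: of_nat_Suc)
    have inc: "indep_vars (\<lambda>_. borel) Z (SIGMA p:J. {..<M'})"
      using indep_brownian_increments(1)[OF W[folded J_def] finJ, of "\<lambda>_. M'" "\<lambda>p k. real k * d (fst p)", OF tI] d
      by (auto simp: Z_def J_def simp del: of_nat_Suc)
    have dist: "distributed M lborel (Z x) (normal_density 0 (sqrt (d (fst (fst x)))))" if "x \<in> (SIGMA p:J. {..<M'})" for x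
      using indep_brownian_increments(2)[OF W[folded J_def] finJ, of "\<lambda>_. M'" "\<lambda>p k. real k * d (fst p)", OF tI _ that] d
      by (auto simp: Z_def J_def algebra_simps)
    \<comment> \<open>\<open>q = i M' + j\<close> numbers the step \<open>j\<close> on level \<open>i\<close>; a group collects the increments of all motions of that level in that step\<close>
    define Gr where "Gr q = (\<lambda>k. ((q div M', k), q mod M')) ` {..<P (q div M')}" for q
    define a where "a x = \<theta> / real (P (fst (fst x)))" for x :: "(nat \<times> nat) \<times> nat"
    define z where "z = \<theta> * (u - \<bar>c\<bar> * T) - \<theta>\<^sup>2 * (v - \<delta> / real K) / 2"
    define S where "S q \<omega> = (\<Sum>k<q. \<Sum>x\<in>Gr k. a x * Z x \<omega> - (a x)\<^sup>2 * (sqrt (d (fst (fst x))))\<^sup>2 / 2)" for q \<omega>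
    have qlt: "q div M' \<le> \<eta>" if "q < Suc \<eta> * M'" for q
      using that less_mult_imp_div_less less_Suc_eq_le by blast
    have "prob {\<omega>\<in>space M. \<exists>q\<le>Suc \<eta> * M'. z \<le> S q \<omega>} \<le> exp (- z)"
      unfolding S_def
    proof (rule gaussian_maximal_inequality[OF inc _ dist])
      show "sqrt (d (fst (fst x))) \<noteq> 0" if "x \<in> (SIGMA p:J. {..<M'})" for x
        using that d[of "fst (fst x)"] by (auto simp: J_def)
      show "Gr q \<subseteq> (SIGMA p:J. {..<M'})" if "q < Suc \<eta> * M'" for q
        using qlt[OF that] M' by (auto simp: Gr_def J_def)
      show "disjoint_family_on Gr {..<Suc \<eta> * M'}"
        unfolding disjoint_family_on_def Gr_def by (auto, metis div_mult_mod_eq)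
    qed (auto simp: Gr_def)
    moreover have "G m \<subseteq> {\<omega>\<in>space M. \<exists>q\<le>Suc \<eta> * M'. z \<le> S q \<omega>}"
    proof
      fix \<omega> assume "\<omega> \<in> G m"
      then obtain i j where \<omega>: "\<omega> \<in> space M" and i: "i \<le> \<eta>" and j: "j \<le> M'"
        and ex: "\<And>\<gamma>. \<gamma> < K \<Longrightarrow> path i \<gamma> (real j * d i) \<omega> - c * (\<tau> i + real j * d i) > u"
        unfolding G_def d_def M'_def by auto
      define A where "A = (\<Sum>\<gamma><K. path i \<gamma> (real j * d i) \<omega>) / real K"
      define V where "V = (\<Sum>i'<i. \<Delta> i' / real (P i')) + real j * d i / real (P i)"
      define g where "g i j = (\<theta> / real (P i)) * (\<Sum>k<P i. Z ((i, k), j) \<omega>) - \<theta>\<^sup>2 * d i / (2 * real (P i))" for i j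
      have Gr_sum: "(\<Sum>x\<in>Gr q. a x * Z x \<omega> - (a x)\<^sup>2 * (sqrt (d (fst (fst x))))\<^sup>2 / 2) = g (q div M') (q mod M')"
        if "q < Suc \<eta> * M'" for q
      proof -
        have "(\<Sum>x\<in>Gr q. a x * Z x \<omega> - (a x)\<^sup>2 * (sqrt (d (fst (fst x))))\<^sup>2 / 2)
          = (\<Sum>k<P (q div M'). \<theta> / real (P (q div M')) * Z ((q div M', k), q mod M') \<omega> - (\<theta> / real (P (q div M')))\<^sup>2 * d (q div M') / 2)"
          unfolding Gr_def using d[OF qlt[OF that]] by (subst sum.reindex) (auto simp: a_def inj_on_def)
        also have "\<dots> = g (q div M') (q mod M')"
          unfolding g_def sum_subtractf sum_distrib_left[symmetric] using P_pos[OF qlt[OF that]]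
          by (simp add: power2_eq_square field_simps)
        finally show ?thesis .
      qed
      have tel: "(\<Sum>j'<j. g i j') = (\<theta> / real (P i)) * (\<Sum>k<P i. W (i, k) (real j * d i) \<omega>) - \<theta>\<^sup>2 * (real j * d i) / (2 * real (P i))"
        if "i \<le> \<eta>" for i j
      proof -
        have eq: "(\<Sum>j'<j. \<Sum>k<P i. Z ((i, k), j') \<omega>) = (\<Sum>k<P i. W (i, k) (real j * d i) \<omega>)"
          by (subst sum.swap, intro sum.cong refl)
             (use sum_lessThan_telescope[of "\<lambda>j. W (i, _) (real j * d i) \<omega>" j] W_0[OF that _ \<omega>] in \<open>simp add: Z_def del: of_nat_Suc\<close>)
        show ?thesis
          unfolding g_def sum_subtractf sum_distrib_left[symmetric] eq by simp
      qed
      have full: "real M' * d i' = \<Delta> i'" if "i' < i" for i'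
        using that i M' by (simp add: d_def L_def)
      have q: "i * M' + j \<le> Suc \<eta> * M'"
        using add_mono[OF j mult_le_mono1[OF i, of M']] by (simp add: add.commute)
      have "S (i * M' + j) \<omega> = (\<Sum>q<i * M' + j. g (q div M') (q mod M'))"
        unfolding S_def using q by (intro sum.cong refl Gr_sum) auto
      also have "\<dots> = (\<Sum>i'<i. \<Sum>j'<M'. g i' j') + (\<Sum>j'<j. g i j')"
        by (rule sum_div_mod[OF M' j])
      also have "\<dots> = (\<Sum>i'<i. (\<theta> / real (P i')) * (\<Sum>k<P i'. W (i', k) (\<Delta> i') \<omega>) - \<theta>\<^sup>2 * \<Delta> i' / (2 * real (P i')))
          + ((\<theta> / real (P i)) * (\<Sum>k<P i. W (i, k) (real j * d i) \<omega>) - \<theta>\<^sup>2 * (real j * d i) / (2 * real (P i)))"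
        using i full by (intro arg_cong2[where f = "(+)"] sum.cong refl) (simp_all add: tel)
      also have "\<dots> = \<theta> * A - \<theta>\<^sup>2 * V / 2"
        unfolding A_def V_def sum_path[OF i]
        by (simp add: sum_subtractf sum_distrib_left sum_divide_distrib algebra_simps add_divide_distrib)
      finally have S: "S (i * M' + j) \<omega> = \<theta> * A - \<theta>\<^sup>2 * V / 2" .
      have "V \<le> (\<Sum>i'<i. L i' / real (P i')) + L i / real (P i)"
      proof -
        have "real j * d i \<le> L i" using grid[OF i, of j m] j by (simp add: d_def M'_def)
        moreover have "(\<Sum>i'<i. \<Delta> i' / real (P i')) = (\<Sum>i'<i. L i' / real (P i'))"
          using i by (intro sum.cong) (auto simp: L_def)
        ultimately show ?thesis unfolding V_def by (simp add: divide_right_mono)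
      qed
      also have "\<dots> = (\<Sum>i'\<le>i. L i' / real (P i'))"
        by (simp add: lessThan_Suc_atMost[symmetric])
      also have "\<dots> \<le> (\<Sum>i'\<le>\<eta>. L i' / real (P i'))"
        using i L(1) by (intro sum_mono2) (auto simp: less_imp_le)
      also have "\<dots> = v - \<delta> / real K"
        by (simp add: v_def L_def diff_divide_distrib sum_subtractf if_distrib[of "\<lambda>x. x / _"] sum.delta cong: if_cong)
      finally have V: "V \<le> v - \<delta> / real K" .
      have "u - \<bar>c\<bar> * T \<le> path i \<gamma> (real j * d i) \<omega>" if "\<gamma> < K" for \<gamma>
      proof -
        have t: "\<tau> i + real j * d i \<le> T" "0 \<le> \<tau> i + real j * d i"
          using grid[OF i, of j m] j TL[OF i] \<tau>_mono[of 0 i] i \<tau>0 by (auto simp: d_def M'_def)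
        have "\<bar>c * (\<tau> i + real j * d i)\<bar> \<le> \<bar>c\<bar> * T"
          unfolding abs_mult using t by (intro mult_left_mono) auto
        then show ?thesis using ex[OF that] by linarith
      qed
      then have "(\<Sum>\<gamma><K. u - \<bar>c\<bar> * T) \<le> (\<Sum>\<gamma><K. path i \<gamma> (real j * d i) \<omega>)"
        by (intro sum_mono) auto
      then have "u - \<bar>c\<bar> * T \<le> A"
        using K by (simp add: A_def le_divide_eq mult.commute)
      then have "z \<le> S (i * M' + j) \<omega>"
        unfolding S z_def using \<theta> V
        by (intro diff_mono mult_left_mono divide_right_mono) auto
      then show "\<omega> \<in> {\<omega>\<in>space M. \<exists>q\<le>Suc \<eta> * M'. z \<le> S q \<omega>}"
        using \<omega> q by blast
    qed
    moreover have "{\<omega>\<in>space M. \<exists>q\<le>Suc \<eta> * M'. z \<le> S q \<omega>} \<in> events"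
    proof -
      have Zm: "Z x \<in> borel_measurable M" if "x \<in> (SIGMA p:J. {..<M'})" for x
        using inc that by (auto simp: indep_vars_def)
      have [measurable]: "S q \<in> borel_measurable M" if "q \<in> {..Suc \<eta> * M'}" for q
        unfolding S_def[abs_def] using that qlt M'
        by (intro borel_measurable_sum borel_measurable_diff borel_measurable_times borel_measurable_const Zm)
           (auto simp: Gr_def J_def)
      have "{\<omega>\<in>space M. \<exists>q\<in>{..Suc \<eta> * M'}. z \<le> S q \<omega>} \<in> events"
        by measurable
      then show ?thesis by (simp add: Bex_def)
    qed
    ultimately have "prob (G m) \<le> exp (- z)"
      using finite_measure_mono order_trans by blast
    then show ?thesis by (simp add: z_def algebra_simps)
  qed
  show "prob A \<le> exp (- \<theta> * (u - \<bar>c\<bar> * T) + \<theta>\<^sup>2 * (v - \<delta> / real K) / 2)"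
    by (rule LIMSEQ_le_const2[OF lim(2)]) (use bound in auto)
qed

end

section \<open>The joint density of the branches and its tilt\<close>

context gaussian_tree begin

abbreviation (input) "\<Gamma> \<equiv> {1..K}"

text \<open>
  The part of branch \<open>\<gamma>\<close> that stems from the levels below the last one.  Several branches can share it,
  so the vector of these parts need not have a density.
\<close>
definition X :: "nat \<Rightarrow> 'a \<Rightarrow> real" where
  "X \<gamma> \<omega> = (\<Sum>i<\<eta>. W (i, \<gamma> mod P i) (\<Delta> i) \<omega>)"

text \<open>
  The row sum of the covariance matrix of the \<open>K\<close> branches after time \<open>h\<close> in the last branching interval:
  a motion of level \<open>i\<close> is shared by \<open>K / P i\<close> branches.
\<close>
definition rowsum :: "real \<Rightarrow> real" where
  "rowsum h = h + (\<Sum>i<\<eta>. \<Delta> i * real K / real (P i))"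

text \<open>
  The density of the vector of all branches after time \<open>h\<close> in the last branching interval, as the convolution of
  the law of \<open>X\<close> with a product of normal densities.  Coordinates run from \<open>1\<close> to \<open>K\<close>, as in \<open>\<H>\<close>, whereas
  branches are numbered from \<open>0\<close>.
\<close>
definition dens :: "real \<Rightarrow> (nat \<Rightarrow> real) \<Rightarrow> real" where
  "dens h y = (\<integral>\<omega>. (\<Prod>\<gamma>\<in>\<Gamma>. normal_density 0 (sqrt h) (y \<gamma> - X (\<gamma> - 1) \<omega>)) \<partial>M)"

lemma X_measurable[measurable]: "X \<gamma> \<in> borel_measurable M"
  unfolding X_def[abs_def] using \<Delta>_pos P_pos
  by (intro borel_measurable_sum W_measurable) (auto simp: less_imp_le)

lemma path_last: "\<gamma> < K \<Longrightarrow> path \<eta> \<gamma> s \<omega> = X \<gamma> \<omega> + W (\<eta>, \<gamma>) s \<omega>"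
  by (simp add: path_def X_def)

lemma normal_density_le: "h > 0 \<Longrightarrow> normal_density 0 (sqrt h) x \<le> 1 / sqrt (2 * pi * h)"
  unfolding normal_density_def by (simp add: divide_right_mono mult_le_cancel_left1)

lemma prod_density_le:
  "h > 0 \<Longrightarrow> (\<Prod>\<gamma>\<in>\<Gamma>. normal_density 0 (sqrt h) (f \<gamma>)) \<le> (1 / sqrt (2 * pi * h)) ^ K"
  using prod_mono[of \<Gamma> "\<lambda>\<gamma>. normal_density 0 (sqrt h) (f \<gamma>)" "\<lambda>_. 1 / sqrt (2 * pi * h)"]
  by (simp add: normal_density_le)

lemma dens_integrable:
  assumes "h > 0"
  shows "integrable M (\<lambda>\<omega>. \<Prod>\<gamma>\<in>\<Gamma>. normal_density 0 (sqrt h) (y \<gamma> - X (\<gamma> - 1) \<omega>))"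
  by (rule integrable_const_bound[where B = "(1 / sqrt (2 * pi * h)) ^ K"])
     (use prod_density_le[OF assms] in \<open>auto simp: prod_nonneg\<close>)

lemma dens_nonneg: "dens h y \<ge> 0"
  unfolding dens_def by (intro integral_nonneg_AE always_eventually allI prod_nonneg) auto

lemma dens_le:
  assumes "h > 0"
  shows "dens h y \<le> (1 / sqrt (2 * pi * h)) ^ K"
  unfolding dens_def
  using integral_mono[OF dens_integrable[OF assms], of "\<lambda>_. (1 / sqrt (2 * pi * h)) ^ K" y] prod_density_le[OF assms]
  by (simp add: prob_space)

lemma ennreal_dens:
  "h > 0 \<Longrightarrow> ennreal (dens h y) = (\<integral>\<^sup>+\<omega>. ennreal (\<Prod>\<gamma>\<in>\<Gamma>. normal_density 0 (sqrt h) (y \<gamma> - X (\<gamma> - 1) \<omega>)) \<partial>M)"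
  unfolding dens_def by (intro nn_integral_eq_integral[symmetric] dens_integrable) (auto simp: prod_nonneg)

lemma dens_cong: "(\<And>\<gamma>. \<gamma> \<in> \<Gamma> \<Longrightarrow> y \<gamma> = y' \<gamma>) \<Longrightarrow> dens h y = dens h y'"
  unfolding dens_def by (intro Bochner_Integration.integral_cong prod.cong refl) auto

lemma dens_measurable:
  assumes "\<And>\<gamma>. \<gamma> \<in> \<Gamma> \<Longrightarrow> (\<lambda>x. g x \<gamma>) \<in> borel_measurable N"
  shows "(\<lambda>x. dens h (g x)) \<in> borel_measurable N"
proof -
  note assms[measurable]
  show ?thesis
    unfolding dens_def by measurable
qed

text \<open>
  The covariance matrix \<open>\<Sigma>\<close> satisfies \<open>\<Sigma> 1 = rowsum h \<cdot> 1\<close>, so the quadratic form in the exponent of a Gaussian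
  density changes along the vector \<open>1\<close> by a multiple of the sum of coordinates.  The proof avoids inverting
  \<open>\<Sigma>\<close>: it shifts every driving increment of level \<open>i\<close> by \<open>\<theta>\<close> times its variance and the
  number \<open>K / P i\<close> of branches that share it.
\<close>
lemma dens_tilt:
  assumes h: "h > 0"
  shows "dens h (\<lambda>\<gamma>. y \<gamma> + \<theta> * rowsum h)
    = exp (- \<theta> * (\<Sum>\<gamma>\<in>\<Gamma>. y \<gamma>) - real K * \<theta>\<^sup>2 * rowsum h / 2) * dens h y"
proof -
  define J where "J = (SIGMA i:{..<\<eta>}. {..<P i})"
  have finJ: "finite J" by (simp add: J_def)
  have J0: "J \<noteq> {}" using P_pos[of 0] \<eta> by (force simp: J_def)
  have PJ: "P i > 0" "\<Delta> i > 0" if "i < \<eta>" for i using that P_pos[of i] \<Delta>_pos[of i] by auto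
  have subJ: "(\<lambda>p. (p, 0::nat)) ` J \<subseteq> (SIGMA p:(SIGMA i:{..\<eta>}. {..<P i}). {..<1})"
    by (auto simp: J_def)
  have tI: "real k * \<Delta> (fst p) \<in> (\<lambda>(i, k). {0..\<Delta> i}) p" if "p \<in> (SIGMA i:{..\<eta>}. {..<P i})" "k \<le> 1" for p k
    using that \<Delta>_pos[of "fst p"] by (auto simp: le_Suc_eq numeral_eq_Suc)
  have ti: "real k * \<Delta> (fst p) < real (Suc k) * \<Delta> (fst p)" if "p \<in> (SIGMA i:{..\<eta>}. {..<P i})" for p k
    using that \<Delta>_pos[of "fst p"] by (auto simp: algebra_simps)
  define Z where "Z = (\<lambda>p \<omega>. W p (\<Delta> (fst p)) \<omega> - W p 0 \<omega>)"
  note inc = indep_brownian_increments[OF W _, of "\<lambda>_. 1" "\<lambda>p k. real k * \<Delta> (fst p)", OF _ tI ti]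
  have ind: "indep_vars (\<lambda>_. borel) Z J"
    using indep_vars_inj_reindex[OF inc(1) _ subJ] by (simp add: Z_def inj_on_def)
  have Z: "distributed M lborel (Z p) (normal_density 0 (sqrt (\<Delta> (fst p))))" if "p \<in> J" for p
    using inc(2)[of "(p, 0)"] subJ that by (simp add: Z_def image_subset_iff)
  define Xf where "Xf z \<gamma> = (\<Sum>i<\<eta>. z (i, \<gamma> mod P i))" for z :: "nat \<times> nat \<Rightarrow> real" and \<gamma>
  have XJ: "(i, \<gamma> mod P i) \<in> J" if "i < \<eta>" for i \<gamma>
    using PJ(1)[OF that] that by (simp add: J_def)
  have X_eq: "X \<gamma> \<omega> = Xf (\<lambda>p\<in>J. Z p \<omega>) \<gamma>" if "\<omega> \<in> space M" for \<gamma> \<omega>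
    unfolding X_def Xf_def using that XJ W_0 PJ
    by (intro sum.cong refl) (auto simp: Z_def)
  have [measurable]: "(\<lambda>z. Xf z \<gamma>) \<in> borel_measurable (PiM J (\<lambda>_. borel))" for \<gamma>
    unfolding Xf_def using XJ by (intro borel_measurable_sum measurable_component_singleton) auto
  define F where "F y z = ennreal (\<Prod>\<gamma>\<in>\<Gamma>. normal_density 0 (sqrt h) (y \<gamma> - Xf z (\<gamma> - 1)))" for y z
  have [measurable]: "F y \<in> borel_measurable (PiM J (\<lambda>_. borel))" for y
    unfolding F_def by measurable
  have law: "ennreal (dens h y) = (\<integral>\<^sup>+z. F y z \<partial>PiM J (\<lambda>p. gauss (sqrt (\<Delta> (fst p)))))" for y
  proof -
    have "ennreal (dens h y) = (\<integral>\<^sup>+\<omega>. F y (\<lambda>p\<in>J. Z p \<omega>) \<partial>M)"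
      unfolding ennreal_dens[OF h] F_def by (intro nn_integral_cong) (simp add: X_eq)
    also have "\<dots> = (\<integral>\<^sup>+z. F y z \<partial>PiM J (\<lambda>p. gauss (sqrt (\<Delta> (fst p)))))"
      by (rule nn_integral_indep_gauss[OF ind J0 Z]) auto
    finally show ?thesis .
  qed
  define s where "s p = \<theta> * \<Delta> (fst p) * real K / real (P (fst p))" for p :: "nat \<times> nat"
  have sumJ: "(\<Sum>p\<in>J. f p) = (\<Sum>i<\<eta>. \<Sum>k<P i. f (i, k))" for f :: "nat \<times> nat \<Rightarrow> real"
    unfolding J_def by (subst sum.Sigma) (auto simp: split_def)
  \<comment> \<open>each branch collects one shift per level; together with \<open>\<theta> * h\<close> from the last level they make up \<open>\<theta> * rowsum h\<close>\<close>
  have shiftX: "Xf (\<lambda>p\<in>J. z p + s p) \<gamma> = Xf z \<gamma> + \<theta> * (rowsum h - h)" for z \<gamma>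
  proof -
    have "Xf (\<lambda>p\<in>J. z p + s p) \<gamma> = (\<Sum>i<\<eta>. z (i, \<gamma> mod P i) + s (i, \<gamma> mod P i))"
      unfolding Xf_def using XJ by (intro sum.cong) auto
    then show ?thesis
      by (simp add: Xf_def s_def rowsum_def sum.distrib sum_distrib_left mult.assoc)
  qed
  have XfK: "(\<Sum>\<gamma>\<in>\<Gamma>. Xf z (\<gamma> - 1)) = (\<Sum>i<\<eta>. real K / real (P i) * (\<Sum>k<P i. z (i, k)))" for z
  proof -
    have "(\<Sum>\<gamma>\<in>\<Gamma>. Xf z (\<gamma> - 1)) = (\<Sum>\<gamma><K. Xf z \<gamma>)"
      by (rule sum.reindex_bij_witness[of _ Suc "\<lambda>\<gamma>. \<gamma> - 1"]) auto
    also have "\<dots> = (\<Sum>i<\<eta>. \<Sum>\<gamma><K. z (i, \<gamma> mod P i))"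
      unfolding Xf_def by (rule sum.swap)
    also have "\<dots> = (\<Sum>i<\<eta>. real K / real (P i) * (\<Sum>k<P i. z (i, k)))"
    proof (intro sum.cong refl)
      fix i assume "i \<in> {..<\<eta>}"
      then have i: "i < \<eta>" by simp
      then have "P i dvd K" by (intro P_dvd) simp
      then obtain q where q: "K = q * P i" by (auto simp: dvd_def mult.commute)
      show "(\<Sum>\<gamma><K. z (i, \<gamma> mod P i)) = real K / real (P i) * (\<Sum>k<P i. z (i, k))"
        using sum_mod[OF PJ(1)[OF i], of "\<lambda>k. z (i, k)" q] PJ(1)[OF i] by (simp add: q)
    qed
    finally show ?thesis .
  qed
  have expo: "(\<Sum>p\<in>J. s p * z p / (sqrt (\<Delta> (fst p)))\<^sup>2 + (s p)\<^sup>2 / (2 * (sqrt (\<Delta> (fst p)))\<^sup>2))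
     = \<theta> * (\<Sum>\<gamma>\<in>\<Gamma>. Xf z (\<gamma> - 1)) + \<theta>\<^sup>2 * real K * (rowsum h - h) / 2" for z
  proof -
    have gen: "\<theta> * D * real K / p * z / (sqrt D)\<^sup>2 + (\<theta> * D * real K / p)\<^sup>2 / (2 * (sqrt D)\<^sup>2)
        = \<theta> * real K / p * z + \<theta>\<^sup>2 * (real K)\<^sup>2 * D / (2 * p\<^sup>2)" if "p > 0" "D > 0" for D p z :: real
      using that by (simp add: field_simps power2_eq_square)
    have "(\<Sum>k<P i. s (i, k) * z (i, k) / (sqrt (\<Delta> i))\<^sup>2 + (s (i, k))\<^sup>2 / (2 * (sqrt (\<Delta> i))\<^sup>2))
       = \<theta> * (real K / real (P i) * (\<Sum>k<P i. z (i, k))) + \<theta>\<^sup>2 * real K / 2 * (\<Delta> i * real K / real (P i))" if "i < \<eta>" for i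
    proof -
      have "(\<Sum>k<P i. s (i, k) * z (i, k) / (sqrt (\<Delta> i))\<^sup>2 + (s (i, k))\<^sup>2 / (2 * (sqrt (\<Delta> i))\<^sup>2))
         = (\<Sum>k<P i. \<theta> * real K / real (P i) * z (i, k) + \<theta>\<^sup>2 * (real K)\<^sup>2 * \<Delta> i / (2 * (real (P i))\<^sup>2))"
        unfolding s_def fst_conv using PJ[OF that] by (intro sum.cong refl gen) auto
      also have "\<dots> = \<theta> * (real K / real (P i) * (\<Sum>k<P i. z (i, k))) + \<theta>\<^sup>2 * real K / 2 * (\<Delta> i * real K / real (P i))"
        unfolding sum.distrib sum_distrib_left[symmetric] using PJ[OF that] by (simp add: field_simps power2_eq_square)
      finally show ?thesis .
    qed
    then show ?thesis
      unfolding sumJ XfK by (simp add: sum.distrib sum_distrib_left rowsum_def sum_divide_distrib[symmetric] algebra_simps)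
  qed
  have shiftF: "F (\<lambda>\<gamma>. y \<gamma> + \<theta> * rowsum h) (\<lambda>p\<in>J. z p + s p)
     = ennreal (exp (- (\<theta> * (\<Sum>\<gamma>\<in>\<Gamma>. y \<gamma> - Xf z (\<gamma> - 1)) + real K * \<theta>\<^sup>2 * h / 2))) * F y z" for z
  proof -
    have "normal_density 0 (sqrt h) (y \<gamma> + \<theta> * rowsum h - Xf (\<lambda>p\<in>J. z p + s p) (\<gamma> - 1))
      = normal_density 0 (sqrt h) (y \<gamma> - Xf z (\<gamma> - 1)) * exp (- (\<theta> * (y \<gamma> - Xf z (\<gamma> - 1)) + \<theta>\<^sup>2 * h / 2))" for \<gamma>
    proof -
      define w where "w = y \<gamma> - Xf z (\<gamma> - 1)"
      have a: "\<theta> * h * w / (sqrt h)\<^sup>2 + (\<theta> * h)\<^sup>2 / (2 * (sqrt h)\<^sup>2) = \<theta> * w + \<theta>\<^sup>2 * h / 2"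
        using h by (simp add: field_simps power2_eq_square)
      have b: "y \<gamma> + \<theta> * rowsum h - Xf (\<lambda>p\<in>J. z p + s p) (\<gamma> - 1) = w + \<theta> * h"
        unfolding shiftX w_def by (simp add: algebra_simps)
      have "sqrt h \<noteq> 0" using h by simp
      from normal_density_add[OF this, of w "\<theta> * h"] show ?thesis
        unfolding a b unfolding w_def .
    qed
    then have "F (\<lambda>\<gamma>. y \<gamma> + \<theta> * rowsum h) (\<lambda>p\<in>J. z p + s p)
      = ennreal ((\<Prod>\<gamma>\<in>\<Gamma>. normal_density 0 (sqrt h) (y \<gamma> - Xf z (\<gamma> - 1)))
        * exp (\<Sum>\<gamma>\<in>\<Gamma>. - (\<theta> * (y \<gamma> - Xf z (\<gamma> - 1)) + \<theta>\<^sup>2 * h / 2)))"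
      by (simp only: F_def prod.distrib exp_sum finite_atLeastAtMost)
    also have "(\<Sum>\<gamma>\<in>\<Gamma>. - (\<theta> * (y \<gamma> - Xf z (\<gamma> - 1)) + \<theta>\<^sup>2 * h / 2))
        = - (\<theta> * (\<Sum>\<gamma>\<in>\<Gamma>. y \<gamma> - Xf z (\<gamma> - 1)) + real K * \<theta>\<^sup>2 * h / 2)"
      unfolding sum_negf sum.distrib sum_distrib_left[symmetric] by simp
    also have "ennreal ((\<Prod>\<gamma>\<in>\<Gamma>. normal_density 0 (sqrt h) (y \<gamma> - Xf z (\<gamma> - 1)))
        * exp (- (\<theta> * (\<Sum>\<gamma>\<in>\<Gamma>. y \<gamma> - Xf z (\<gamma> - 1)) + real K * \<theta>\<^sup>2 * h / 2)))
      = ennreal (exp (- (\<theta> * (\<Sum>\<gamma>\<in>\<Gamma>. y \<gamma> - Xf z (\<gamma> - 1)) + real K * \<theta>\<^sup>2 * h / 2))) * F y z"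
      by (simp add: F_def ennreal_mult prod_nonneg mult.commute)
    finally show ?thesis .
  qed
  have "ennreal (dens h (\<lambda>\<gamma>. y \<gamma> + \<theta> * rowsum h))
    = (\<integral>\<^sup>+z. ennreal (exp (- (\<Sum>p\<in>J. s p * z p / (sqrt (\<Delta> (fst p)))\<^sup>2 + (s p)\<^sup>2 / (2 * (sqrt (\<Delta> (fst p)))\<^sup>2))))
        * F (\<lambda>\<gamma>. y \<gamma> + \<theta> * rowsum h) (\<lambda>p\<in>J. z p + s p) \<partial>PiM J (\<lambda>p. gauss (sqrt (\<Delta> (fst p)))))"
    unfolding law
  proof (rule Cameron_Martin[OF finJ])
    show "sqrt (\<Delta> (fst p)) \<noteq> 0" if "p \<in> J" for p
      using that PJ(2)[of "fst p"] by (auto simp: J_def)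
  qed measurable
  also have "\<dots> = (\<integral>\<^sup>+z. ennreal (exp (- \<theta> * (\<Sum>\<gamma>\<in>\<Gamma>. y \<gamma>) - real K * \<theta>\<^sup>2 * rowsum h / 2)) * F y z
       \<partial>PiM J (\<lambda>p. gauss (sqrt (\<Delta> (fst p)))))"
  proof (intro nn_integral_cong)
    fix z
    have "- (\<theta> * (\<Sum>\<gamma>\<in>\<Gamma>. Xf z (\<gamma> - 1)) + \<theta>\<^sup>2 * real K * (rowsum h - h) / 2)
        + - (\<theta> * (\<Sum>\<gamma>\<in>\<Gamma>. y \<gamma> - Xf z (\<gamma> - 1)) + real K * \<theta>\<^sup>2 * h / 2)
        = - \<theta> * (\<Sum>\<gamma>\<in>\<Gamma>. y \<gamma>) - real K * \<theta>\<^sup>2 * rowsum h / 2"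
      by (simp add: sum_subtractf algebra_simps add_divide_distrib[symmetric] diff_divide_distrib)
    then show "ennreal (exp (- (\<Sum>p\<in>J. s p * z p / (sqrt (\<Delta> (fst p)))\<^sup>2 + (s p)\<^sup>2 / (2 * (sqrt (\<Delta> (fst p)))\<^sup>2))))
        * F (\<lambda>\<gamma>. y \<gamma> + \<theta> * rowsum h) (\<lambda>p\<in>J. z p + s p)
      = ennreal (exp (- \<theta> * (\<Sum>\<gamma>\<in>\<Gamma>. y \<gamma>) - real K * \<theta>\<^sup>2 * rowsum h / 2)) * F y z"
      unfolding expo shiftF by (simp only: mult.assoc[symmetric] ennreal_mult[symmetric] exp_ge_zero exp_add[symmetric])
  qed
  also have "\<dots> = ennreal (exp (- \<theta> * (\<Sum>\<gamma>\<in>\<Gamma>. y \<gamma>) - real K * \<theta>\<^sup>2 * rowsum h / 2) * dens h y)"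
    by (subst nn_integral_cmult) (auto simp: law ennreal_mult dens_nonneg cong: measurable_cong_sets)
  finally show ?thesis
    by (simp add: dens_nonneg)
qed

end

section \<open>The last branching interval\<close>

context gaussian_tree begin

text \<open>
  Increments of the driving motions of the last level, numbered backwards from the final time.
\<close>
definition rev_increment :: "real \<Rightarrow> nat \<times> nat \<Rightarrow> 'a \<Rightarrow> real" where
  "rev_increment d x \<omega> = W (\<eta>, fst x - 1) (\<Delta> \<eta> - real (snd x) * d) \<omega>
     - W (\<eta>, fst x - 1) (\<Delta> \<eta> - real (Suc (snd x)) * d) \<omega>"

text \<open>
  The branches at time \<open>T - \<delta>\<close> are independent of the subsequent increments.  The integrals over
  \<open>X\<close> and over the motion of the last interval up to time \<open>h\<close> are merged into the density.
\<close>
lemma last_interval_law: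
  fixes \<Phi> :: "(nat \<Rightarrow> real) \<times> (nat \<times> nat \<Rightarrow> real) \<Rightarrow> ennreal"
  assumes m: "m > 0" and \<delta>: "0 < \<delta>" "\<delta> < \<Delta> \<eta>"
    and \<Phi>[measurable]: "\<Phi> \<in> borel_measurable (PiM \<Gamma> (\<lambda>_. borel) \<Otimes>\<^sub>M PiM (\<Gamma> \<times> {..<m}) (\<lambda>_. borel))"
  defines "h \<equiv> \<Delta> \<eta> - \<delta>" and "d \<equiv> \<delta> / real m"
  shows "(\<integral>\<^sup>+\<omega>. \<Phi> (\<lambda>\<gamma>\<in>\<Gamma>. path \<eta> (\<gamma> - 1) h \<omega>, \<lambda>x\<in>\<Gamma> \<times> {..<m}. rev_increment d x \<omega>) \<partial>M)
    = (\<integral>\<^sup>+y. ennreal (dens h y) * (\<integral>\<^sup>+z. \<Phi> (y, z) \<partial>PiM (\<Gamma> \<times> {..<m}) (\<lambda>_. gauss (sqrt d))) \<partial>Leb \<Gamma>)"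
proof -
  have h: "h > 0" and d: "d > 0" "real m * d = \<delta>" and D: "\<Delta> \<eta> = h + real m * d"
    using \<delta> m by (auto simp: h_def d_def)
  have K: "K > 0" by (rule P_pos) simp
  define J where "J = (SIGMA i:{..\<eta>}. {..<P i})"
  define J1 where "J1 = (SIGMA i:{..<\<eta>}. {..<P i})"
  have finJ: "finite J" by (simp add: J_def)
  define mm where "mm p = (if fst p < \<eta> then 1 else Suc m)" for p :: "nat \<times> nat"
  define t where "t p j = (if fst p < \<eta> then real j * \<Delta> (fst p) else if j = 0 then 0 else h + real (j - 1) * d)"
    for p :: "nat \<times> nat" and j :: nat
  have tI: "t p j \<in> (\<lambda>(i, k). {0..\<Delta> i}) p" if "p \<in> J" "j \<le> mm p" for p j
  proof (cases "fst p < \<eta>")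
    case True
    then show ?thesis using that \<Delta>_pos[of "fst p"] by (auto simp: t_def mm_def J_def le_Suc_eq split: prod.splits)
  next
    case False
    then have p: "fst p = \<eta>" using that by (auto simp: J_def)
    then have "real (j - 1) * d \<le> real m * d"
      using that d by (intro mult_right_mono) (auto simp: mm_def)
    then show ?thesis using p h d D \<Delta>_pos[of \<eta>] by (auto simp: t_def split: prod.splits)
  qed
  have ti: "t p j < t p (Suc j)" if "p \<in> J" "j < mm p" for p j
    using that \<Delta>_pos[of "fst p"] h d
    by (cases j) (auto simp: t_def mm_def J_def algebra_simps)
  define Z where "Z = (\<lambda>x \<omega>. W (fst x) (t (fst x) (Suc (snd x))) \<omega> - W (fst x) (t (fst x) (snd x)) \<omega>)"
  define I where "I = (SIGMA p:J. {..<mm p})"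
  note inc = indep_brownian_increments[OF W[folded J_def] finJ, of mm t, OF tI ti]
  have ind: "indep_vars (\<lambda>_. borel) Z I"
    using inc(1) by (simp add: Z_def I_def)
  have Z: "distributed M lborel (Z x) (normal_density 0 (sqrt (t (fst x) (Suc (snd x)) - t (fst x) (snd x))))" if "x \<in> I" for x
    using inc(2)[of x] that by (simp add: Z_def I_def)
  \<comment> \<open>\<open>k = 0\<close> is the increment up to time \<open>h\<close>, and \<open>k = s + 1\<close> the one with backward number \<open>s\<close>\<close>
  define \<beta> where "\<beta> b = ((\<eta>, fst b - 1 :: nat), if snd b = 0 then 0 else Suc m - snd b)" for b :: "nat \<times> nat"
  let ?\<alpha> = "\<lambda>p::nat \<times> nat. (p, 0::nat)"
  let ?B = "\<Gamma> \<times> {..m}"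
  have \<alpha>I: "?\<alpha> ` J1 \<subseteq> I" by (auto simp: J1_def I_def J_def mm_def)
  have \<alpha>inj: "inj_on ?\<alpha> J1" by (simp add: inj_on_def)
  have \<beta>I: "\<beta> ` ?B \<subseteq> I" using K by (auto simp: \<beta>_def I_def J_def mm_def)
  have \<beta>inj: "inj_on \<beta> ?B"
    by (auto simp: inj_on_def \<beta>_def split: if_splits)
  have disj: "?\<alpha> ` J1 \<inter> \<beta> ` ?B = {}" by (auto simp: J1_def \<beta>_def)
  have PJ: "P i > 0" "\<Delta> i > 0" if "i < \<eta>" for i using that P_pos[of i] \<Delta>_pos[of i] by auto
  define Xf where "Xf z \<gamma> = (\<Sum>i<\<eta>. z (i, \<gamma> mod P i))" for z :: "nat \<times> nat \<Rightarrow> real" and \<gamma>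
  have XJ: "(i, \<gamma> mod P i) \<in> J1" if "i < \<eta>" for i \<gamma>
    using PJ(1)[OF that] that by (simp add: J1_def)
  have X_eq: "Xf (\<lambda>p\<in>J1. Z (?\<alpha> p) \<omega>) \<gamma> = X \<gamma> \<omega>" if "\<omega> \<in> space M" for \<gamma> \<omega>
    unfolding X_def Xf_def using that XJ W_0 PJ
    by (intro sum.cong refl) (auto simp: Z_def t_def)
  have [measurable]: "(\<lambda>z. Xf z \<gamma>) \<in> borel_measurable (PiM J1 (\<lambda>_. borel))" for \<gamma>
    unfolding Xf_def using XJ by (intro borel_measurable_sum measurable_component_singleton) auto
  have Z0: "Z (\<beta> (\<gamma>, 0)) \<omega> = W (\<eta>, \<gamma> - 1) h \<omega>" if "\<gamma> \<in> \<Gamma>" "\<omega> \<in> space M" for \<gamma> \<omega>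
    using that W_0[of \<eta> "\<gamma> - 1" \<omega>] by (auto simp: Z_def \<beta>_def t_def)
  have ZS: "Z (\<beta> (\<gamma>, Suc s)) \<omega> = rev_increment d (\<gamma>, s) \<omega>" if "\<gamma> \<in> \<Gamma>" "s < m" for \<gamma> s \<omega>
  proof -
    obtain k where k: "m = Suc (s + k)" using \<open>s < m\<close> less_iff_Suc_add by blast
    have "h + real (Suc k) * d = \<Delta> \<eta> - real s * d" "h + real k * d = \<Delta> \<eta> - real (Suc s) * d"
      unfolding D k by (auto simp: algebra_simps)
    then show ?thesis
      by (simp add: Z_def \<beta>_def t_def rev_increment_def k Suc_diff_le del: of_nat_Suc)
  qed
  define f :: "(nat \<times> nat \<Rightarrow> real) \<times> (nat \<times> nat \<Rightarrow> real) \<Rightarrow> ennreal" where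
    "f = (\<lambda>(x, w). \<Phi> (\<lambda>\<gamma>\<in>\<Gamma>. Xf x (\<gamma> - 1) + w (\<gamma>, 0), \<lambda>b\<in>\<Gamma> \<times> {..<m}. w (fst b, Suc (snd b))))"
  have fm: "f \<in> borel_measurable (PiM J1 (\<lambda>_. borel) \<Otimes>\<^sub>M PiM ?B (\<lambda>_. borel))"
    unfolding f_def by measurable auto
  have Zrv: "Z x \<in> borel_measurable M" if "x \<in> I" for x
    using ind that by (auto simp: indep_vars_def)
  define \<Psi> where "\<Psi> y = (\<integral>\<^sup>+z. \<Phi> (y, z) \<partial>PiM (\<Gamma> \<times> {..<m}) (\<lambda>_. gauss (sqrt d)))" for y
  interpret G: product_sigma_finite "\<lambda>_::nat \<times> nat. gauss (sqrt d)" by (rule product_sigma_finite_gauss)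
  interpret GS: sigma_finite_measure "PiM (\<Gamma> \<times> {..<m}) (\<lambda>_. gauss (sqrt d))" by (rule G.sigma_finite) simp
  interpret L: product_sigma_finite "\<lambda>_::nat. lborel :: real measure" by standard
  interpret LS: sigma_finite_measure "Leb \<Gamma>" by (rule L.sigma_finite) simp
  interpret PS: pair_sigma_finite M "Leb \<Gamma>" ..
  have [measurable]: "\<Psi> \<in> borel_measurable (PiM \<Gamma> (\<lambda>_. borel))"
    unfolding \<Psi>_def by measurable
  have [measurable]: "\<Psi> \<in> borel_measurable (Leb \<Gamma>)"
    using \<open>\<Psi> \<in> borel_measurable (PiM \<Gamma> (\<lambda>_. borel))\<close> by (simp cong: measurable_cong_sets sets_PiM_cong)
  define Z' where "Z' b = Z (\<beta> b)" for b
  have ind': "indep_vars (\<lambda>_. borel) Z' ?B"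
    using indep_vars_inj_reindex[OF ind \<beta>inj \<beta>I] by (simp add: Z'_def[abs_def])
  have Z'1: "distributed M lborel (Z' (\<gamma>, 0)) (normal_density 0 (sqrt h))" if "\<gamma> \<in> \<Gamma>" for \<gamma>
  proof -
    have "\<beta> (\<gamma>, 0) \<in> I" using \<beta>I that by (auto simp: image_subset_iff)
    from Z[OF this] show ?thesis by (simp add: Z'_def \<beta>_def t_def)
  qed
  have Z'2: "distributed M lborel (Z' (fst b, Suc (snd b))) (normal_density 0 (sqrt d))" if "b \<in> \<Gamma> \<times> {..<m}" for b
  proof -
    have "\<beta> (fst b, Suc (snd b)) \<in> I" using \<beta>I that by (auto simp: image_subset_iff)
    from Z[OF this] show ?thesis
      using that by (cases "m - snd b") (auto simp: Z'_def \<beta>_def t_def algebra_simps Suc_diff_le)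
  qed
  have inner: "(\<integral>\<^sup>+\<omega>'. f (x, \<lambda>b\<in>?B. Z (\<beta> b) \<omega>') \<partial>M)
    = (\<integral>\<^sup>+y. ennreal (\<Prod>\<gamma>\<in>\<Gamma>. normal_density 0 (sqrt h) (y \<gamma> - Xf x (\<gamma> - 1))) * \<Psi> y \<partial>Leb \<Gamma>)" for x
  proof -
    define c where "c \<gamma> = Xf x (\<gamma> - 1)" for \<gamma>
    have [measurable]: "(\<lambda>g. \<lambda>\<gamma>\<in>\<Gamma>. c \<gamma> + g \<gamma>) \<in> measurable (PiM \<Gamma> (\<lambda>_. borel)) (PiM \<Gamma> (\<lambda>_. borel :: real measure))"
      by measurable
    have [measurable]: "(\<lambda>g. \<lambda>\<gamma>\<in>\<Gamma>. c \<gamma> + g \<gamma>) \<in> measurable (Leb \<Gamma>) (Leb \<Gamma>)"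
      by measurable
    define \<Phi>' where "\<Phi>' = (\<lambda>(g, z). \<Phi> (\<lambda>\<gamma>\<in>\<Gamma>. c \<gamma> + g \<gamma>, z))"
    have \<Phi>'m[measurable]: "\<Phi>' \<in> borel_measurable (PiM \<Gamma> (\<lambda>_. borel) \<Otimes>\<^sub>M PiM (\<Gamma> \<times> {..<m}) (\<lambda>_. borel))"
      unfolding \<Phi>'_def by measurable
    have "(\<integral>\<^sup>+\<omega>'. f (x, \<lambda>b\<in>?B. Z (\<beta> b) \<omega>') \<partial>M)
      = (\<integral>\<^sup>+\<omega>'. \<Phi>' (\<lambda>\<gamma>\<in>\<Gamma>. Z' (\<gamma>, 0) \<omega>', \<lambda>b\<in>\<Gamma> \<times> {..<m}. Z' (fst b, Suc (snd b)) \<omega>') \<partial>M)"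
      unfolding f_def \<Phi>'_def prod.case c_def Z'_def
      by (intro nn_integral_cong arg_cong[where f = \<Phi>] arg_cong2[where f = Pair] restrict_ext) auto
    also have "\<dots> = (\<integral>\<^sup>+\<omega>1. (\<integral>\<^sup>+\<omega>2. \<Phi>' (\<lambda>\<gamma>\<in>\<Gamma>. Z' (\<gamma>, 0) \<omega>1, \<lambda>b\<in>\<Gamma> \<times> {..<m}. Z' (fst b, Suc (snd b)) \<omega>2) \<partial>M) \<partial>M)"
      by (rule nn_integral_indep_decouple[OF ind' _ _ _ _ _ \<Phi>'m]) (auto simp: inj_on_def)
    also have "\<dots> = (\<integral>\<^sup>+\<omega>1. (\<integral>\<^sup>+z. \<Phi>' (\<lambda>\<gamma>\<in>\<Gamma>. Z' (\<gamma>, 0) \<omega>1, z) \<partial>PiM (\<Gamma> \<times> {..<m}) (\<lambda>_. gauss (sqrt d))) \<partial>M)"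
    proof (intro nn_integral_cong)
      fix \<omega>1 assume "\<omega>1 \<in> space M"
      have ii: "indep_vars (\<lambda>_. borel) (\<lambda>b. Z' (fst b, Suc (snd b))) (\<Gamma> \<times> {..<m})"
        by (rule indep_vars_inj_reindex[OF ind']) (auto simp: inj_on_def)
      have sl: "(\<lambda>z. \<Phi>' (\<lambda>\<gamma>\<in>\<Gamma>. Z' (\<gamma>, 0) \<omega>1, z)) \<in> borel_measurable (PiM (\<Gamma> \<times> {..<m}) (\<lambda>_. borel))"
        by (rule measurable_compose[OF _ \<Phi>'m], rule measurable_Pair1') (auto simp: space_PiM)
      show "(\<integral>\<^sup>+\<omega>2. \<Phi>' (\<lambda>\<gamma>\<in>\<Gamma>. Z' (\<gamma>, 0) \<omega>1, \<lambda>b\<in>\<Gamma> \<times> {..<m}. Z' (fst b, Suc (snd b)) \<omega>2) \<partial>M)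
        = (\<integral>\<^sup>+z. \<Phi>' (\<lambda>\<gamma>\<in>\<Gamma>. Z' (\<gamma>, 0) \<omega>1, z) \<partial>PiM (\<Gamma> \<times> {..<m}) (\<lambda>_. gauss (sqrt d)))"
        using K m by (intro nn_integral_indep_gauss[OF ii _ Z'2 sl]) auto
    qed
    also have "\<dots> = (\<integral>\<^sup>+g. (\<integral>\<^sup>+z. \<Phi>' (g, z) \<partial>PiM (\<Gamma> \<times> {..<m}) (\<lambda>_. gauss (sqrt d))) \<partial>PiM \<Gamma> (\<lambda>_. gauss (sqrt h)))"
    proof (rule nn_integral_indep_gauss)
      show "indep_vars (\<lambda>_. borel) (\<lambda>\<gamma>. Z' (\<gamma>, 0)) \<Gamma>"
        by (rule indep_vars_inj_reindex[OF ind']) (auto simp: inj_on_def)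
      show "(\<lambda>g. \<integral>\<^sup>+z. \<Phi>' (g, z) \<partial>PiM (\<Gamma> \<times> {..<m}) (\<lambda>_. gauss (sqrt d))) \<in> borel_measurable (PiM \<Gamma> (\<lambda>_. borel))"
        by measurable
    qed (use K Z'1 in auto)
    also have "\<dots> = (\<integral>\<^sup>+g. \<Psi> (\<lambda>\<gamma>\<in>\<Gamma>. c \<gamma> + g \<gamma>) \<partial>PiM \<Gamma> (\<lambda>_. gauss (sqrt h)))"
      unfolding \<Phi>'_def prod.case \<Psi>_def ..
    also have "\<dots> = (\<integral>\<^sup>+g. ennreal (\<Prod>\<gamma>\<in>\<Gamma>. normal_density 0 (sqrt h) (g \<gamma>)) * \<Psi> (\<lambda>\<gamma>\<in>\<Gamma>. c \<gamma> + g \<gamma>) \<partial>Leb \<Gamma>)"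
      unfolding PiM_gauss[OF finite_atLeastAtMost] by (rule nn_integral_density) measurable
    also have "\<dots> = ennreal (\<bar>1\<bar> ^ card \<Gamma>) * (\<integral>\<^sup>+y. ennreal (\<Prod>\<gamma>\<in>\<Gamma>. normal_density 0 (sqrt h) ((\<lambda>\<gamma>\<in>\<Gamma>. - c \<gamma> + 1 * y \<gamma>) \<gamma>))
        * \<Psi> (\<lambda>\<gamma>\<in>\<Gamma>. c \<gamma> + (\<lambda>\<gamma>\<in>\<Gamma>. - c \<gamma> + 1 * y \<gamma>) \<gamma>) \<partial>Leb \<Gamma>)"
    proof (rule nn_integral_PiM_lborel_affine)
      show "(\<lambda>g. ennreal (\<Prod>\<gamma>\<in>\<Gamma>. normal_density 0 (sqrt h) (g \<gamma>)) * \<Psi> (\<lambda>\<gamma>\<in>\<Gamma>. c \<gamma> + g \<gamma>))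
        \<in> borel_measurable (Leb \<Gamma>)"
        by measurable
    qed auto
    also have "\<dots> = (\<integral>\<^sup>+y. ennreal (\<Prod>\<gamma>\<in>\<Gamma>. normal_density 0 (sqrt h) (y \<gamma> - c \<gamma>)) * \<Psi> y \<partial>Leb \<Gamma>)"
    proof -
      have "(\<lambda>\<gamma>\<in>\<Gamma>. c \<gamma> + (\<lambda>\<gamma>\<in>\<Gamma>. - c \<gamma> + 1 * y \<gamma>) \<gamma>) = y" if "y \<in> space (Leb \<Gamma>)" for y
        using that by (auto simp: fun_eq_iff space_PiM PiE_def extensional_def)
      moreover have "(\<Prod>\<gamma>\<in>\<Gamma>. normal_density 0 (sqrt h) ((\<lambda>\<gamma>\<in>\<Gamma>. - c \<gamma> + 1 * y \<gamma>) \<gamma>))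
         = (\<Prod>\<gamma>\<in>\<Gamma>. normal_density 0 (sqrt h) (y \<gamma> - c \<gamma>))" for y
        by (intro prod.cong) auto
      ultimately have "(\<integral>\<^sup>+y. ennreal (\<Prod>\<gamma>\<in>\<Gamma>. normal_density 0 (sqrt h) ((\<lambda>\<gamma>\<in>\<Gamma>. - c \<gamma> + 1 * y \<gamma>) \<gamma>))
        * \<Psi> (\<lambda>\<gamma>\<in>\<Gamma>. c \<gamma> + (\<lambda>\<gamma>\<in>\<Gamma>. - c \<gamma> + 1 * y \<gamma>) \<gamma>) \<partial>Leb \<Gamma>)
        = (\<integral>\<^sup>+y. ennreal (\<Prod>\<gamma>\<in>\<Gamma>. normal_density 0 (sqrt h) (y \<gamma> - c \<gamma>)) * \<Psi> y \<partial>Leb \<Gamma>)"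
        by (intro nn_integral_cong arg_cong2[where f = "(*)"] arg_cong[where f = ennreal] arg_cong[where f = \<Psi>])
      then show ?thesis by simp
    qed
    finally show ?thesis by (simp only: c_def)
  qed
  have "(\<integral>\<^sup>+\<omega>. \<Phi> (\<lambda>\<gamma>\<in>\<Gamma>. path \<eta> (\<gamma> - 1) h \<omega>, \<lambda>x\<in>\<Gamma> \<times> {..<m}. rev_increment d x \<omega>) \<partial>M)
    = (\<integral>\<^sup>+\<omega>. f (\<lambda>p\<in>J1. Z (?\<alpha> p) \<omega>, \<lambda>b\<in>?B. Z (\<beta> b) \<omega>) \<partial>M)"
  proof (intro nn_integral_cong)
    fix \<omega> assume \<omega>: "\<omega> \<in> space M"
    show "\<Phi> (\<lambda>\<gamma>\<in>\<Gamma>. path \<eta> (\<gamma> - 1) h \<omega>, \<lambda>x\<in>\<Gamma> \<times> {..<m}. rev_increment d x \<omega>)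
       = f (\<lambda>p\<in>J1. Z (?\<alpha> p) \<omega>, \<lambda>b\<in>?B. Z (\<beta> b) \<omega>)"
      unfolding f_def prod.case X_eq[OF \<omega>]
      by (intro arg_cong[where f = \<Phi>] arg_cong2[where f = Pair] restrict_ext)
         (auto simp: Z0[OF _ \<omega>] ZS path_last split: prod.splits)
  qed
  also have "\<dots> = (\<integral>\<^sup>+\<omega>. (\<integral>\<^sup>+\<omega>'. f (\<lambda>p\<in>J1. Z (?\<alpha> p) \<omega>, \<lambda>b\<in>?B. Z (\<beta> b) \<omega>') \<partial>M) \<partial>M)"
    by (rule nn_integral_indep_decouple[OF ind \<alpha>inj \<alpha>I \<beta>inj \<beta>I disj fm])
  also have "\<dots> = (\<integral>\<^sup>+\<omega>. (\<integral>\<^sup>+y. ennreal (\<Prod>\<gamma>\<in>\<Gamma>. normal_density 0 (sqrt h) (y \<gamma> - X (\<gamma> - 1) \<omega>)) * \<Psi> y \<partial>Leb \<Gamma>) \<partial>M)"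
    unfolding inner by (rule nn_integral_cong) (simp only: X_eq)
  also have "\<dots> = (\<integral>\<^sup>+y. (\<integral>\<^sup>+\<omega>. ennreal (\<Prod>\<gamma>\<in>\<Gamma>. normal_density 0 (sqrt h) (y \<gamma> - X (\<gamma> - 1) \<omega>)) * \<Psi> y \<partial>M) \<partial>Leb \<Gamma>)"
    by (rule PS.Fubini'[symmetric]) measurable
  also have "\<dots> = (\<integral>\<^sup>+y. ennreal (dens h y) * \<Psi> y \<partial>Leb \<Gamma>)"
    unfolding ennreal_dens[OF h] by (rule nn_integral_cong, rule nn_integral_multc) measurable
  finally show ?thesis by (simp only: \<Psi>_def)
qed

lemma rowsum_add: "rowsum (h + d) = rowsum h + d"
  by (simp add: rowsum_def)

text \<open>
  \<open>y\<close> is the position of the branches at time \<open>T - \<delta>\<close> and \<open>z\<close> the family of later increments, numbered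
  backwards, so that the sum is the position \<open>j\<close> grid steps before the end.
\<close>
abbreviation (input) "crossing R m a y z \<equiv>
  \<exists>j\<in>R. \<forall>\<gamma>\<in>\<Gamma>. y \<gamma> + (\<Sum>k=j..<m. z (\<gamma>, k)) > real j * a"

text \<open>
  The Cameron-Martin shift with parameter \<open>\<theta>\<close>, applied to the density at time \<open>T - \<delta>\<close> and to the
  increments afterwards.  By the hypothesis on \<open>\<theta>\<close> the shift at the final time is exactly
  \<open>u + c * T\<close>; \<open>j\<close> steps earlier it is smaller by \<open>\<theta> * (j * d)\<close>, which becomes the drift.
\<close>
lemma grid_exceedance_tilted:
  assumes m: "m > 0" and \<delta>: "0 < \<delta>" "\<delta> < \<Delta> \<eta>" and R: "R \<subseteq> {..m}"
    and \<theta>: "\<theta> * rowsum (\<Delta> \<eta>) = u + c * T"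
  defines "h \<equiv> \<Delta> \<eta> - \<delta>" and "d \<equiv> \<delta> / real m"
  shows "emeasure M {\<omega>\<in>space M. \<exists>j\<in>R. \<forall>\<gamma>\<in>\<Gamma>. path \<eta> (\<gamma> - 1) (\<Delta> \<eta> - real j * d) \<omega> - c * (T - real j * d) > u}
    = ennreal (exp (- real K * \<theta>\<^sup>2 * rowsum (\<Delta> \<eta>) / 2)) *
      (\<integral>\<^sup>+y. (\<integral>\<^sup>+z. ennreal (exp (- \<theta> * ((\<Sum>\<gamma>\<in>\<Gamma>. y \<gamma>) + (\<Sum>x\<in>\<Gamma> \<times> {..<m}. z x))) * dens h y) *
          indicator {z. crossing R m ((\<theta> - c) * d) y z} z
        \<partial>PiM (\<Gamma> \<times> {..<m}) (\<lambda>_. gauss (sqrt d))) \<partial>Leb \<Gamma>)"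
proof -
  have h: "h > 0" and d: "d > 0" "real m * d = \<delta>" and D: "\<Delta> \<eta> = h + real m * d"
    using \<delta> m by (auto simp: h_def d_def)
  have K: "K > 0" by (rule P_pos) simp
  let ?B = "\<Gamma> \<times> {..<m}"
  let ?G = "PiM ?B (\<lambda>_. gauss (sqrt d))"
  have mR: "j \<le> m" if "j \<in> R" for j using R that by auto
  define E where "E y z \<longleftrightarrow> (\<exists>j\<in>R. \<forall>\<gamma>\<in>\<Gamma>. y \<gamma> + (\<Sum>k=j..<m. z (\<gamma>, k)) - c * (T - real j * d) > u)"
    for y :: "nat \<Rightarrow> real" and z :: "nat \<times> nat \<Rightarrow> real"
  define \<Phi> where "\<Phi> = (\<lambda>(y, z). indicator {z. E y z} z :: ennreal)"
  have [measurable]: "(\<lambda>x. snd x (\<gamma>, k)) \<in> borel_measurable (PiM \<Gamma> (\<lambda>_. borel) \<Otimes>\<^sub>M PiM ?B (\<lambda>_. borel :: real measure))"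
    if "\<gamma> \<in> \<Gamma>" "k < m" for \<gamma> k
    using that by (intro measurable_compose[OF measurable_snd measurable_component_singleton]) auto
  have "Measurable.pred (PiM \<Gamma> (\<lambda>_. borel) \<Otimes>\<^sub>M PiM ?B (\<lambda>_. borel)) (\<lambda>x. E (fst x) (snd x))"
    unfolding E_def by measurable
  then have \<Phi>m[measurable]: "\<Phi> \<in> borel_measurable (PiM \<Gamma> (\<lambda>_. borel) \<Otimes>\<^sub>M PiM ?B (\<lambda>_. borel))"
    unfolding \<Phi>_def by (auto simp: split_beta' indicator_def intro!: measurable_If)
  have slice: "(\<lambda>z. \<Phi> (y, z)) \<in> borel_measurable (PiM ?B (\<lambda>_. borel))" if "y \<in> space (PiM \<Gamma> (\<lambda>_. borel))" for y
    using that by (rule measurable_compose[OF measurable_Pair1' \<Phi>m])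
  have pathR: "(\<lambda>\<omega>. path \<eta> (\<gamma> - 1) (\<Delta> \<eta> - real j * d) \<omega>) \<in> borel_measurable M" if "j \<in> R" for \<gamma> j
  proof (rule path_measurable)
    have "real j * d \<le> real m * d" using mR[OF that] d by (intro mult_right_mono) auto
    then show "\<Delta> \<eta> - real j * d \<in> {0..\<Delta> \<eta>}" using D h d by auto
  qed simp
  define A where "A = {\<omega>\<in>space M. \<exists>j\<in>R. \<forall>\<gamma>\<in>\<Gamma>. path \<eta> (\<gamma> - 1) (\<Delta> \<eta> - real j * d) \<omega> - c * (T - real j * d) > u}"
  note pathR[measurable]
  have A: "A \<in> events" unfolding A_def by measurable
  have tel: "path \<eta> (\<gamma> - 1) (\<Delta> \<eta> - real j * d) \<omega>
     = path \<eta> (\<gamma> - 1) h \<omega> + (\<Sum>k=j..<m. rev_increment d (\<gamma>, k) \<omega>)" if "j \<in> R" "\<gamma> \<in> \<Gamma>" for j \<gamma> \<omega>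
  proof -
    have "(\<Sum>k=j..<m. rev_increment d (\<gamma>, k) \<omega>)
      = - (\<Sum>k=j..<m. W (\<eta>, \<gamma> - 1) (\<Delta> \<eta> - real (Suc k) * d) \<omega> - W (\<eta>, \<gamma> - 1) (\<Delta> \<eta> - real k * d) \<omega>)"
      by (simp add: rev_increment_def sum_negf[symmetric] del: of_nat_Suc)
    also have "\<dots> = W (\<eta>, \<gamma> - 1) (\<Delta> \<eta> - real j * d) \<omega> - W (\<eta>, \<gamma> - 1) (\<Delta> \<eta> - real m * d) \<omega>"
      by (subst sum_Suc_diff'[OF mR[OF that(1)]]) simp
    also have "\<Delta> \<eta> - real m * d = h" using D by simp
    finally have "(\<Sum>k=j..<m. rev_increment d (\<gamma>, k) \<omega>) = W (\<eta>, \<gamma> - 1) (\<Delta> \<eta> - real j * d) \<omega> - W (\<eta>, \<gamma> - 1) h \<omega>" .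
    moreover have "\<gamma> - 1 < K" using that by auto
    ultimately show ?thesis by (simp add: path_last)
  qed
  have "emeasure M A = (\<integral>\<^sup>+\<omega>. indicator A \<omega> \<partial>M)" using A by simp
  also have "\<dots> = (\<integral>\<^sup>+\<omega>. \<Phi> (\<lambda>\<gamma>\<in>\<Gamma>. path \<eta> (\<gamma> - 1) h \<omega>, \<lambda>x\<in>?B. rev_increment d x \<omega>) \<partial>M)"
  proof (rule nn_integral_cong)
    fix \<omega> assume \<omega>: "\<omega> \<in> space M"
    have eq: "(\<Sum>k=j..<m. (\<lambda>x\<in>?B. rev_increment d x \<omega>) (\<gamma>, k)) = (\<Sum>k=j..<m. rev_increment d (\<gamma>, k) \<omega>)" if "\<gamma> \<in> \<Gamma>" for j \<gamma>
      using that by (intro sum.cong) auto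
    have "((\<lambda>\<gamma>\<in>\<Gamma>. path \<eta> (\<gamma> - 1) h \<omega>) \<gamma> + (\<Sum>k=j..<m. (\<lambda>x\<in>?B. rev_increment d x \<omega>) (\<gamma>, k)) - c * (T - real j * d) > u)
      = (path \<eta> (\<gamma> - 1) (\<Delta> \<eta> - real j * d) \<omega> - c * (T - real j * d) > u)" if "j \<in> R" "\<gamma> \<in> \<Gamma>" for j \<gamma>
      unfolding tel[OF that] eq[OF that(2)] using that(2) by simp
    then have "E (\<lambda>\<gamma>\<in>\<Gamma>. path \<eta> (\<gamma> - 1) h \<omega>) (\<lambda>x\<in>?B. rev_increment d x \<omega>)
      \<longleftrightarrow> (\<exists>j\<in>R. \<forall>\<gamma>\<in>\<Gamma>. path \<eta> (\<gamma> - 1) (\<Delta> \<eta> - real j * d) \<omega> - c * (T - real j * d) > u)"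
      unfolding E_def by (intro bex_cong ball_cong refl)
    then have "E (\<lambda>\<gamma>\<in>\<Gamma>. path \<eta> (\<gamma> - 1) h \<omega>) (\<lambda>x\<in>?B. rev_increment d x \<omega>) \<longleftrightarrow> \<omega> \<in> A"
      unfolding A_def using \<omega> by blast
    then show "indicator A \<omega> = \<Phi> (\<lambda>\<gamma>\<in>\<Gamma>. path \<eta> (\<gamma> - 1) h \<omega>, \<lambda>x\<in>?B. rev_increment d x \<omega>)"
      unfolding \<Phi>_def prod.case by (simp only: indicator_def mem_Collect_eq)
  qed
  also have "\<dots> = (\<integral>\<^sup>+y. ennreal (dens h y) * (\<integral>\<^sup>+z. \<Phi> (y, z) \<partial>?G) \<partial>Leb \<Gamma>)"
    unfolding h_def d_def by (rule last_interval_law[OF m \<delta> \<Phi>m])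
  also have "\<dots> = ennreal (\<bar>1\<bar> ^ card \<Gamma>) * (\<integral>\<^sup>+y. ennreal (dens h (\<lambda>\<gamma>\<in>\<Gamma>. \<theta> * rowsum h + 1 * y \<gamma>))
      * (\<integral>\<^sup>+z. \<Phi> (\<lambda>\<gamma>\<in>\<Gamma>. \<theta> * rowsum h + 1 * y \<gamma>, z) \<partial>?G) \<partial>Leb \<Gamma>)"
  proof (rule nn_integral_PiM_lborel_affine)
    interpret G: product_sigma_finite "\<lambda>_::nat \<times> nat. gauss (sqrt d)" by (rule product_sigma_finite_gauss)
    interpret GS: sigma_finite_measure ?G by (rule G.sigma_finite) simp
    have [measurable]: "(\<lambda>y. dens h y) \<in> borel_measurable (PiM \<Gamma> (\<lambda>_. borel))"
      by (rule dens_measurable) simp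
    have "(\<lambda>y. ennreal (dens h y) * (\<integral>\<^sup>+z. \<Phi> (y, z) \<partial>?G)) \<in> borel_measurable (PiM \<Gamma> (\<lambda>_. borel))"
      by measurable
    then show "(\<lambda>y. ennreal (dens h y) * (\<integral>\<^sup>+z. \<Phi> (y, z) \<partial>?G)) \<in> borel_measurable (Leb \<Gamma>)"
      by (simp cong: measurable_cong_sets sets_PiM_cong)
  qed auto
  also have "\<dots> = (\<integral>\<^sup>+y. ennreal (exp (- real K * \<theta>\<^sup>2 * rowsum (\<Delta> \<eta>) / 2)) *
      (\<integral>\<^sup>+z. ennreal (exp (- \<theta> * ((\<Sum>\<gamma>\<in>\<Gamma>. y \<gamma>) + (\<Sum>x\<in>?B. z x))) * dens h y) *
          indicator {z. crossing R m ((\<theta> - c) * d) y z} z \<partial>?G) \<partial>Leb \<Gamma>)"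
  proof -
    have eq: "ennreal (dens h (\<lambda>\<gamma>\<in>\<Gamma>. \<theta> * rowsum h + 1 * y \<gamma>))
      * (\<integral>\<^sup>+z. \<Phi> (\<lambda>\<gamma>\<in>\<Gamma>. \<theta> * rowsum h + 1 * y \<gamma>, z) \<partial>?G)
      = ennreal (exp (- real K * \<theta>\<^sup>2 * rowsum (\<Delta> \<eta>) / 2)) *
      (\<integral>\<^sup>+z. ennreal (exp (- \<theta> * ((\<Sum>\<gamma>\<in>\<Gamma>. y \<gamma>) + (\<Sum>x\<in>?B. z x))) * dens h y) *
          indicator {z. crossing R m ((\<theta> - c) * d) y z} z \<partial>?G)" for y
    proof -
      define y' where "y' = (\<lambda>\<gamma>\<in>\<Gamma>. \<theta> * rowsum h + 1 * y \<gamma>)"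
      have y': "y' \<in> space (PiM \<Gamma> (\<lambda>_. borel))" by (simp add: y'_def space_PiM)
      note sl[measurable] = slice[OF y']
      have dens_y': "dens h y' = exp (- \<theta> * (\<Sum>\<gamma>\<in>\<Gamma>. y \<gamma>) - real K * \<theta>\<^sup>2 * rowsum h / 2) * dens h y"
        unfolding dens_tilt[OF h, of y \<theta>, symmetric] by (rule dens_cong) (simp add: y'_def)
      have expo: "(\<Sum>x\<in>?B. \<theta> * d * z x / (sqrt d)\<^sup>2 + (\<theta> * d)\<^sup>2 / (2 * (sqrt d)\<^sup>2))
          = \<theta> * (\<Sum>x\<in>?B. z x) + real K * \<theta>\<^sup>2 * \<delta> / 2" for z
      proof -
        have "(\<Sum>x\<in>?B. \<theta> * d * z x / (sqrt d)\<^sup>2 + (\<theta> * d)\<^sup>2 / (2 * (sqrt d)\<^sup>2)) = (\<Sum>x\<in>?B. \<theta> * z x + \<theta>\<^sup>2 * d / 2)"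
          using d by (intro sum.cong refl) (simp add: field_simps power2_eq_square)
        also have "\<dots> = \<theta> * (\<Sum>x\<in>?B. z x) + real (card ?B) * (\<theta>\<^sup>2 * d / 2)"
          by (simp only: sum.distrib sum_distrib_left sum_constant)
        also have "real (card ?B) * (\<theta>\<^sup>2 * d / 2) = real K * \<theta>\<^sup>2 * \<delta> / 2"
          using d(2)[symmetric] by (simp add: card_cartesian_product)
        finally show ?thesis .
      qed
      have ind: "\<Phi> (y', \<lambda>x\<in>?B. z x + \<theta> * d)
         = indicator {z. crossing R m ((\<theta> - c) * d) y z} z" for z
      proof -
        have *: "(y' \<gamma> + (\<Sum>k=j..<m. (\<lambda>x\<in>?B. z x + \<theta> * d) (\<gamma>, k)) - c * (T - real j * d) > u)
           = (y \<gamma> + (\<Sum>k=j..<m. z (\<gamma>, k)) > real j * ((\<theta> - c) * d))" if "j \<in> R" "\<gamma> \<in> \<Gamma>" for j \<gamma>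
        proof -
          have "(\<Sum>k=j..<m. (\<lambda>x\<in>?B. z x + \<theta> * d) (\<gamma>, k)) = (\<Sum>k=j..<m. z (\<gamma>, k) + \<theta> * d)"
            using that by (intro sum.cong) auto
          also have "\<dots> = (\<Sum>k=j..<m. z (\<gamma>, k)) + (real m - real j) * (\<theta> * d)"
            using mR[OF that(1)] by (simp add: sum.distrib of_nat_diff)
          finally have 1: "(\<Sum>k=j..<m. (\<lambda>x\<in>?B. z x + \<theta> * d) (\<gamma>, k)) = (\<Sum>k=j..<m. z (\<gamma>, k)) + (real m - real j) * (\<theta> * d)" .
          have 2: "\<theta> * rowsum h + real m * (\<theta> * d) = u + c * T"
            using \<theta> rowsum_add[of h "real m * d"] D by (simp add: algebra_simps)
          then have Y: "y' \<gamma> = u + c * T - real m * (\<theta> * d) + y \<gamma>"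
            using that(2) by (simp add: y'_def)
          show ?thesis
            unfolding 1 Y by (simp add: algebra_simps)
        qed
        have "E y' (\<lambda>x\<in>?B. z x + \<theta> * d) \<longleftrightarrow> (crossing R m ((\<theta> - c) * d) y z)"
          unfolding E_def by (intro bex_cong ball_cong refl *)
        then show ?thesis
          unfolding \<Phi>_def prod.case by (simp only: indicator_def mem_Collect_eq)
      qed
      have "(\<integral>\<^sup>+z. \<Phi> (y', z) \<partial>?G) = (\<integral>\<^sup>+z. ennreal (exp (- (\<Sum>x\<in>?B. \<theta> * d * z x / (sqrt d)\<^sup>2 + (\<theta> * d)\<^sup>2 / (2 * (sqrt d)\<^sup>2))))
            * \<Phi> (y', \<lambda>x\<in>?B. z x + \<theta> * d) \<partial>?G)"
        using d by (intro Cameron_Martin sl) auto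
      also have "\<dots> = (\<integral>\<^sup>+z. ennreal (exp (- (\<theta> * (\<Sum>x\<in>?B. z x) + real K * \<theta>\<^sup>2 * \<delta> / 2)))
            * indicator {z. crossing R m ((\<theta> - c) * d) y z} z \<partial>?G)"
        by (simp only: expo ind)
      finally have 3: "(\<integral>\<^sup>+z. \<Phi> (y', z) \<partial>?G) = \<dots>" .
      have [measurable]: "(\<lambda>z. indicator {z. crossing R m ((\<theta> - c) * d) y z} z :: ennreal)
         \<in> borel_measurable (PiM ?B (\<lambda>_. borel))"
      proof -
        have [measurable]: "(\<lambda>z. z (\<gamma>, k)) \<in> borel_measurable (PiM ?B (\<lambda>_. borel :: real measure))" if "\<gamma> \<in> \<Gamma>" "k < m" for \<gamma> k
          using that by (intro measurable_component_singleton) auto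
        have "Measurable.pred (PiM ?B (\<lambda>_. borel)) (\<lambda>z. crossing R m ((\<theta> - c) * d) y z)"
          by measurable
        then show ?thesis by (auto simp: indicator_def intro!: measurable_If)
      qed
      have w: "exp (- \<theta> * (\<Sum>\<gamma>\<in>\<Gamma>. y \<gamma>) - real K * \<theta>\<^sup>2 * rowsum h / 2) * dens h y * exp (- (\<theta> * (\<Sum>x\<in>?B. z x) + real K * \<theta>\<^sup>2 * \<delta> / 2))
         = exp (- real K * \<theta>\<^sup>2 * rowsum (\<Delta> \<eta>) / 2) * (exp (- \<theta> * ((\<Sum>\<gamma>\<in>\<Gamma>. y \<gamma>) + (\<Sum>x\<in>?B. z x))) * dens h y)" for z
      proof -
        have "rowsum (\<Delta> \<eta>) = rowsum h + \<delta>" using rowsum_add[of h \<delta>] D d by simp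
        then have "- \<theta> * (\<Sum>\<gamma>\<in>\<Gamma>. y \<gamma>) - real K * \<theta>\<^sup>2 * rowsum h / 2 + - (\<theta> * (\<Sum>x\<in>?B. z x) + real K * \<theta>\<^sup>2 * \<delta> / 2)
          = - real K * \<theta>\<^sup>2 * rowsum (\<Delta> \<eta>) / 2 + - \<theta> * ((\<Sum>\<gamma>\<in>\<Gamma>. y \<gamma>) + (\<Sum>x\<in>?B. z x))"
          by (simp add: algebra_simps add_divide_distrib)
        then have "exp (- \<theta> * (\<Sum>\<gamma>\<in>\<Gamma>. y \<gamma>) - real K * \<theta>\<^sup>2 * rowsum h / 2) * exp (- (\<theta> * (\<Sum>x\<in>?B. z x) + real K * \<theta>\<^sup>2 * \<delta> / 2))
          = exp (- real K * \<theta>\<^sup>2 * rowsum (\<Delta> \<eta>) / 2) * exp (- \<theta> * ((\<Sum>\<gamma>\<in>\<Gamma>. y \<gamma>) + (\<Sum>x\<in>?B. z x)))"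
          unfolding exp_add[symmetric] by (rule arg_cong)
        then have "a * D * b = C * (g * D)" if "a = exp (- \<theta> * (\<Sum>\<gamma>\<in>\<Gamma>. y \<gamma>) - real K * \<theta>\<^sup>2 * rowsum h / 2)"
          "b = exp (- (\<theta> * (\<Sum>x\<in>?B. z x) + real K * \<theta>\<^sup>2 * \<delta> / 2))"
          "C = exp (- real K * \<theta>\<^sup>2 * rowsum (\<Delta> \<eta>) / 2)"
          "g = exp (- \<theta> * ((\<Sum>\<gamma>\<in>\<Gamma>. y \<gamma>) + (\<Sum>x\<in>?B. z x)))" for a b C g D
          unfolding that[symmetric] by (simp add: mult.commute mult.left_commute)
        from this[OF refl refl refl refl] show ?thesis .
      qed
      let ?I = "\<lambda>z. indicator {z. crossing R m ((\<theta> - c) * d) y z} z :: ennreal"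
      have "ennreal (dens h y') * (\<integral>\<^sup>+z. \<Phi> (y', z) \<partial>?G)
         = (\<integral>\<^sup>+z. ennreal (dens h y') * (ennreal (exp (- (\<theta> * (\<Sum>x\<in>?B. z x) + real K * \<theta>\<^sup>2 * \<delta> / 2))) * ?I z) \<partial>?G)"
        unfolding 3 by (rule nn_integral_cmult[symmetric]) measurable
      also have "\<dots> = (\<integral>\<^sup>+z. ennreal (exp (- real K * \<theta>\<^sup>2 * rowsum (\<Delta> \<eta>) / 2)) *
          (ennreal (exp (- \<theta> * ((\<Sum>\<gamma>\<in>\<Gamma>. y \<gamma>) + (\<Sum>x\<in>?B. z x))) * dens h y) * ?I z) \<partial>?G)"
        unfolding dens_y'
        by (intro nn_integral_cong)
           (simp only: mult.assoc[symmetric] ennreal_mult[symmetric] mult_nonneg_nonneg exp_ge_zero dens_nonneg w)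
      also have "\<dots> = ennreal (exp (- real K * \<theta>\<^sup>2 * rowsum (\<Delta> \<eta>) / 2)) *
          (\<integral>\<^sup>+z. ennreal (exp (- \<theta> * ((\<Sum>\<gamma>\<in>\<Gamma>. y \<gamma>) + (\<Sum>x\<in>?B. z x))) * dens h y) * ?I z \<partial>?G)"
        by (rule nn_integral_cmult) measurable
      finally show ?thesis unfolding y'_def .
    qed
    show ?thesis unfolding eq by simp
  qed
  also have "\<dots> = ennreal (exp (- real K * \<theta>\<^sup>2 * rowsum (\<Delta> \<eta>) / 2)) *
      (\<integral>\<^sup>+y. (\<integral>\<^sup>+z. ennreal (exp (- \<theta> * ((\<Sum>\<gamma>\<in>\<Gamma>. y \<gamma>) + (\<Sum>x\<in>?B. z x))) * dens h y) *
          indicator {z. crossing R m ((\<theta> - c) * d) y z} z \<partial>?G) \<partial>Leb \<Gamma>)"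
  proof (rule nn_integral_cmult)
    interpret G: product_sigma_finite "\<lambda>_::nat \<times> nat. gauss (sqrt d)" by (rule product_sigma_finite_gauss)
    interpret GS: sigma_finite_measure ?G by (rule G.sigma_finite) simp
    have [measurable]: "(\<lambda>x. dens h (fst x)) \<in> borel_measurable (PiM \<Gamma> (\<lambda>_. borel) \<Otimes>\<^sub>M PiM ?B (\<lambda>_. borel))"
      by (rule dens_measurable) measurable
    have "Measurable.pred (PiM \<Gamma> (\<lambda>_. borel) \<Otimes>\<^sub>M PiM ?B (\<lambda>_. borel))
      (\<lambda>x. \<exists>j\<in>R. \<forall>\<gamma>\<in>\<Gamma>. fst x \<gamma> + (\<Sum>k=j..<m. snd x (\<gamma>, k)) > real j * ((\<theta> - c) * d))"
      by measurable
    then have "(\<lambda>x. indicator {z. \<exists>j\<in>R. \<forall>\<gamma>\<in>\<Gamma>. fst x \<gamma> + (\<Sum>k=j..<m. z (\<gamma>, k)) > real j * ((\<theta> - c) * d)} (snd x) :: ennreal)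
      \<in> borel_measurable (PiM \<Gamma> (\<lambda>_. borel) \<Otimes>\<^sub>M PiM ?B (\<lambda>_. borel))"
      by (auto simp: indicator_def intro!: measurable_If)
    note this[measurable]
    have "(\<lambda>x. ennreal (exp (- \<theta> * ((\<Sum>\<gamma>\<in>\<Gamma>. fst x \<gamma>) + (\<Sum>z\<in>?B. snd x z))) * dens h (fst x)) *
          indicator {z. \<exists>j\<in>R. \<forall>\<gamma>\<in>\<Gamma>. fst x \<gamma> + (\<Sum>k=j..<m. z (\<gamma>, k)) > real j * ((\<theta> - c) * d)} (snd x))
      \<in> borel_measurable (PiM \<Gamma> (\<lambda>_. borel) \<Otimes>\<^sub>M PiM ?B (\<lambda>_. borel))"
      by measurable
    then have "(\<lambda>y. \<integral>\<^sup>+z. ennreal (exp (- \<theta> * ((\<Sum>\<gamma>\<in>\<Gamma>. y \<gamma>) + (\<Sum>x\<in>?B. z x))) * dens h y) *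
          indicator {z. crossing R m ((\<theta> - c) * d) y z} z \<partial>?G)
      \<in> borel_measurable (PiM \<Gamma> (\<lambda>_. borel))"
      by (intro GS.borel_measurable_nn_integral) (simp add: split_beta' cong: measurable_cong_sets sets_pair_measure_cong sets_PiM_cong)
    then show "(\<lambda>y. \<integral>\<^sup>+z. ennreal (exp (- \<theta> * ((\<Sum>\<gamma>\<in>\<Gamma>. y \<gamma>) + (\<Sum>x\<in>?B. z x))) * dens h y) *
          indicator {z. crossing R m ((\<theta> - c) * d) y z} z \<partial>?G)
      \<in> borel_measurable (Leb \<Gamma>)"
      by (simp cong: measurable_cong_sets sets_PiM_cong)
  qed
  finally show ?thesis unfolding A_def .
qed

text \<open>
  In \<open>grid_exceedance_tilted\<close> the increments are realised by the rescaled and reflected motions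
  \<open>B'\<close>, and the position at time \<open>T - \<delta>\<close> is substituted in terms of the position
  \<open>- x \<gamma> / \<nu>\<close> at the final time.  The time scale \<open>e\<close> is chosen such that the drift
  becomes that of \<open>l * B' - l\<^sup>2 * t\<close>.  The two cases needed are \<open>R = {..m}\<close>, the whole grid, and
  \<open>R = {0}\<close>, the final time only.
\<close>
lemma grid_exceedance:
  fixes M' :: "'b measure" and B' :: "nat \<Rightarrow> real \<Rightarrow> 'b \<Rightarrow> real"
  assumes ibm: "indep_brownian_motions M' \<Gamma> (\<lambda>_. {0..}) B'"
    and m: "m > 0" and \<delta>: "0 < \<delta>" "\<delta> < \<Delta> \<eta>" and R: "R \<subseteq> {..m}"
    and \<theta>: "\<theta> * rowsum (\<Delta> \<eta>) = u + c * T" and \<nu>: "\<nu> = \<theta> - c" "\<nu> > 0" and l: "l > 0"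
  defines "h \<equiv> \<Delta> \<eta> - \<delta>" and "d \<equiv> \<delta> / real m"
  defines "e \<equiv> \<nu>\<^sup>2 * d / l\<^sup>2"
  shows "emeasure M {\<omega>\<in>space M. \<exists>j\<in>R. \<forall>\<gamma>\<in>\<Gamma>. path \<eta> (\<gamma> - 1) (\<Delta> \<eta> - real j * d) \<omega> - c * (T - real j * d) > u}
    = ennreal (exp (- real K * \<theta>\<^sup>2 * rowsum (\<Delta> \<eta>) / 2) / \<nu> ^ K) *
      (\<integral>\<^sup>+x. (\<integral>\<^sup>+\<omega>. ennreal (exp (\<theta> / \<nu> * (\<Sum>\<gamma>\<in>\<Gamma>. x \<gamma>)) * dens h (\<lambda>\<gamma>. - x \<gamma> / \<nu> + l / \<nu> * B' \<gamma> (real m * e) \<omega>)) *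
          indicator {\<omega>. \<exists>j\<in>R. \<forall>\<gamma>\<in>\<Gamma>. l * B' \<gamma> (real j * e) \<omega> - l\<^sup>2 * (real j * e) > x \<gamma>} \<omega>
        \<partial>M') \<partial>Leb \<Gamma>)"
proof -
  interpret M': prob_space M' using ibm by (simp add: indep_brownian_motions_def)
  have h: "h > 0" and d: "d > 0" and e: "e > 0"
    using \<delta> m \<nu> l by (auto simp: h_def d_def e_def)
  have K: "K > 0" by (rule P_pos) simp
  have bm': "brownian_motion M' {0..} (B' \<gamma>)" if "\<gamma> \<in> \<Gamma>" for \<gamma>
    using ibm that by (simp add: indep_brownian_motions_def)
  let ?B = "\<Gamma> \<times> {..<m}"
  let ?G = "PiM ?B (\<lambda>_. gauss (sqrt d))"
  have mR: "j \<le> m" if "j \<in> R" for j using R that by auto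
  interpret L: product_sigma_finite "\<lambda>_::nat. lborel :: real measure" by standard
  interpret LS: sigma_finite_measure "Leb \<Gamma>" by (rule L.sigma_finite) simp
  interpret PS: pair_sigma_finite "Leb \<Gamma>" M' ..
  have [measurable]: "B' \<gamma> (real j * e) \<in> borel_measurable M'" if "\<gamma> \<in> \<Gamma>" for \<gamma> j
    using bm'[OF that] e by (simp add: brownian_motion_def)
  define g where "g y z = ennreal (exp (- \<theta> * ((\<Sum>\<gamma>\<in>\<Gamma>. y \<gamma>) + (\<Sum>x\<in>?B. z x))) * dens h y) *
     indicator {z. crossing R m ((\<theta> - c) * d) y z} z" for y and z :: "nat \<times> nat \<Rightarrow> real"
  define g2 where "g2 y \<omega> = ennreal (exp (- \<theta> * (\<Sum>\<gamma>\<in>\<Gamma>. y \<gamma> - l / \<nu> * B' \<gamma> (real m * e) \<omega>)) * dens h y) *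
     indicator {\<omega>. \<exists>j\<in>R. \<forall>\<gamma>\<in>\<Gamma>. y \<gamma> - l / \<nu> * (B' \<gamma> (real m * e) \<omega> - B' \<gamma> (real j * e) \<omega>) > real j * (\<nu> * d)} \<omega>" for y \<omega>
  define g3 where "g3 x \<omega> = ennreal (exp (\<theta> / \<nu> * (\<Sum>\<gamma>\<in>\<Gamma>. x \<gamma>)) * dens h (\<lambda>\<gamma>. - x \<gamma> / \<nu> + l / \<nu> * B' \<gamma> (real m * e) \<omega>)) *
          indicator {\<omega>. \<exists>j\<in>R. \<forall>\<gamma>\<in>\<Gamma>. l * B' \<gamma> (real j * e) \<omega> - l\<^sup>2 * (real j * e) > x \<gamma>} \<omega>" for x \<omega>
  \<comment> \<open>the summand \<open>0\<close> matches the form in which affine images of normal variables are treated\<close>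
  define \<zeta> where "\<zeta> x \<omega> = 0 + - (l / \<nu>) * (B' (fst x) (real (Suc (snd x)) * e) \<omega> - B' (fst x) (real (snd x) * e) \<omega>)" for x \<omega>
  note inc = indep_brownian_increments[OF ibm finite_atLeastAtMost, of "\<lambda>_. m" "\<lambda>_ k. real k * e"]
  have ind\<zeta>: "M'.indep_vars (\<lambda>_. borel) \<zeta> ?B"
  proof -
    have "M'.indep_vars (\<lambda>_. borel) (\<lambda>x \<omega>. B' (fst x) (real (Suc (snd x)) * e) \<omega> - B' (fst x) (real (snd x) * e) \<omega>) ?B"
      by (rule inc(1)) (use e in auto)
    from M'.indep_vars_compose2[OF this, of "\<lambda>_ b. 0 + - (l / \<nu>) * b" "\<lambda>_. borel"] show ?thesis
      by (simp add: \<zeta>_def[abs_def])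
  qed
  have dist\<zeta>: "distributed M' lborel (\<zeta> x) (normal_density 0 (sqrt d))" if "x \<in> ?B" for x
  proof -
    have "distributed M' lborel (\<lambda>\<omega>. B' (fst x) (real (Suc (snd x)) * e) \<omega> - B' (fst x) (real (snd x) * e) \<omega>) (normal_density 0 (sqrt (real (Suc (snd x)) * e - real (snd x) * e)))"
      by (rule inc(2)) (use that e in auto)
    also have "real (Suc (snd x)) * e - real (snd x) * e = e" by (simp add: algebra_simps)
    finally have "distributed M' lborel (\<zeta> x) (normal_density (0 + - (l / \<nu>) * 0) (\<bar>- (l / \<nu>)\<bar> * sqrt e))"
      unfolding \<zeta>_def using e l \<nu> by (intro M'.normal_density_affine) auto
    moreover have "\<bar>- (l / \<nu>)\<bar> * sqrt e = sqrt d"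
      using l \<nu> d by (simp add: e_def real_sqrt_divide real_sqrt_mult)
    ultimately show ?thesis by simp
  qed
  have tel: "(\<Sum>k=j..<m. \<zeta> (\<gamma>, k) \<omega>) = - (l / \<nu>) * (B' \<gamma> (real m * e) \<omega> - B' \<gamma> (real j * e) \<omega>)" if "j \<le> m" for j \<gamma> \<omega>
    unfolding \<zeta>_def fst_conv snd_conv add_0_left sum_distrib_left[symmetric]
    by (subst sum_Suc_diff'[OF that]) simp
  have g\<zeta>: "g y (\<lambda>x\<in>?B. \<zeta> x \<omega>) = g2 y \<omega>" if \<omega>: "\<omega> \<in> space M'" for y \<omega>
  proof -
    have "(\<Sum>x\<in>?B. (\<lambda>x\<in>?B. \<zeta> x \<omega>) x) = (\<Sum>\<gamma>\<in>\<Gamma>. \<Sum>k=0..<m. \<zeta> (\<gamma>, k) \<omega>)"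
      unfolding sum.cartesian_product atLeast0LessThan by (intro sum.cong) auto
    also have "\<dots> = (\<Sum>\<gamma>\<in>\<Gamma>. - (l / \<nu>) * B' \<gamma> (real m * e) \<omega>)"
      using bm' \<omega> by (intro sum.cong refl) (simp add: tel brownian_motion_def)
    finally have 1: "(\<Sum>x\<in>?B. (\<lambda>x\<in>?B. \<zeta> x \<omega>) x) = (\<Sum>\<gamma>\<in>\<Gamma>. - (l / \<nu>) * B' \<gamma> (real m * e) \<omega>)" .
    have 2: "(y \<gamma> + (\<Sum>k=j..<m. (\<lambda>x\<in>?B. \<zeta> x \<omega>) (\<gamma>, k)) > real j * ((\<theta> - c) * d))
      = (y \<gamma> - l / \<nu> * (B' \<gamma> (real m * e) \<omega> - B' \<gamma> (real j * e) \<omega>) > real j * (\<nu> * d))" if "j \<in> R" "\<gamma> \<in> \<Gamma>" for j \<gamma>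
    proof -
      have "(\<Sum>k=j..<m. (\<lambda>x\<in>?B. \<zeta> x \<omega>) (\<gamma>, k)) = (\<Sum>k=j..<m. \<zeta> (\<gamma>, k) \<omega>)"
        using that by (intro sum.cong) auto
      then show ?thesis
        unfolding tel[OF mR[OF that(1)]] \<nu>(1) by simp
    qed
    have "(\<exists>j\<in>R. \<forall>\<gamma>\<in>\<Gamma>. y \<gamma> + (\<Sum>k=j..<m. (\<lambda>x\<in>?B. \<zeta> x \<omega>) (\<gamma>, k)) > real j * ((\<theta> - c) * d))
      = (\<exists>j\<in>R. \<forall>\<gamma>\<in>\<Gamma>. y \<gamma> - l / \<nu> * (B' \<gamma> (real m * e) \<omega> - B' \<gamma> (real j * e) \<omega>) > real j * (\<nu> * d))"
      by (intro bex_cong ball_cong refl 2)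
    moreover have "(\<Sum>\<gamma>\<in>\<Gamma>. y \<gamma>) + (\<Sum>\<gamma>\<in>\<Gamma>. - (l / \<nu>) * B' \<gamma> (real m * e) \<omega>)
       = (\<Sum>\<gamma>\<in>\<Gamma>. y \<gamma> - l / \<nu> * B' \<gamma> (real m * e) \<omega>)"
      by (simp add: sum.distrib[symmetric])
    ultimately show ?thesis
      unfolding g_def g2_def 1 by (simp only: indicator_def mem_Collect_eq)
  qed
  have [measurable]: "(\<lambda>y. dens h y) \<in> borel_measurable (Leb \<Gamma>)"
    by (rule dens_measurable) simp
  have inner: "(\<integral>\<^sup>+z. g y z \<partial>?G) = (\<integral>\<^sup>+\<omega>. g2 y \<omega> \<partial>M')" for y
  proof -
    have [measurable]: "(\<lambda>z. z (\<gamma>, k)) \<in> borel_measurable (PiM ?B (\<lambda>_. borel :: real measure))" if "\<gamma> \<in> \<Gamma>" "k < m" for \<gamma> k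
      using that by (intro measurable_component_singleton) auto
    have "Measurable.pred (PiM ?B (\<lambda>_. borel)) (\<lambda>z. crossing R m ((\<theta> - c) * d) y z)"
      by measurable
    then have [measurable]: "(\<lambda>z. indicator {z. crossing R m ((\<theta> - c) * d) y z} z :: ennreal)
         \<in> borel_measurable (PiM ?B (\<lambda>_. borel))"
      by (auto simp: indicator_def intro!: measurable_If)
    have gm: "g y \<in> borel_measurable (PiM ?B (\<lambda>_. borel))"
      unfolding g_def by measurable
    have B0: "?B \<noteq> {}" using K m by auto
    have "(\<integral>\<^sup>+z. g y z \<partial>?G) = (\<integral>\<^sup>+\<omega>. g y (\<lambda>x\<in>?B. \<zeta> x \<omega>) \<partial>M')"
      by (rule M'.nn_integral_indep_gauss[OF ind\<zeta> B0 dist\<zeta> gm, symmetric])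
    also have "\<dots> = (\<integral>\<^sup>+\<omega>. g2 y \<omega> \<partial>M')"
      by (rule nn_integral_cong) (rule g\<zeta>)
    finally show ?thesis .
  qed
  have "Measurable.pred (Leb \<Gamma> \<Otimes>\<^sub>M M') (\<lambda>x. \<exists>j\<in>R. \<forall>\<gamma>\<in>\<Gamma>. fst x \<gamma> - l / \<nu> * (B' \<gamma> (real m * e) (snd x) - B' \<gamma> (real j * e) (snd x)) > real j * (\<nu> * d))"
    by measurable
  then have [measurable]: "(\<lambda>x. indicator {\<omega>. \<exists>j\<in>R. \<forall>\<gamma>\<in>\<Gamma>. fst x \<gamma> - l / \<nu> * (B' \<gamma> (real m * e) \<omega> - B' \<gamma> (real j * e) \<omega>) > real j * (\<nu> * d)} (snd x) :: ennreal)
     \<in> borel_measurable (Leb \<Gamma> \<Otimes>\<^sub>M M')"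
    by (auto simp: indicator_def intro!: measurable_If)
  have [measurable]: "(\<lambda>x. dens h (fst x)) \<in> borel_measurable (Leb \<Gamma> \<Otimes>\<^sub>M M')"
    by (rule dens_measurable) measurable
  have "(\<lambda>x. g2 (fst x) (snd x)) \<in> borel_measurable (Leb \<Gamma> \<Otimes>\<^sub>M M')"
    unfolding g2_def by measurable
  then have g2m[measurable]: "(\<lambda>(y, \<omega>). g2 y \<omega>) \<in> borel_measurable (Leb \<Gamma> \<Otimes>\<^sub>M M')"
    by (simp add: split_beta')
  have "Measurable.pred (Leb \<Gamma> \<Otimes>\<^sub>M M') (\<lambda>x. \<exists>j\<in>R. \<forall>\<gamma>\<in>\<Gamma>. l * B' \<gamma> (real j * e) (snd x) - l\<^sup>2 * (real j * e) > fst x \<gamma>)"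
    by measurable
  then have [measurable]: "(\<lambda>x. indicator {\<omega>. \<exists>j\<in>R. \<forall>\<gamma>\<in>\<Gamma>. l * B' \<gamma> (real j * e) \<omega> - l\<^sup>2 * (real j * e) > fst x \<gamma>} (snd x) :: ennreal)
     \<in> borel_measurable (Leb \<Gamma> \<Otimes>\<^sub>M M')"
    by (auto simp: indicator_def intro!: measurable_If)
  have [measurable]: "(\<lambda>x. dens h (\<lambda>\<gamma>. - fst x \<gamma> / \<nu> + l / \<nu> * B' \<gamma> (real m * e) (snd x))) \<in> borel_measurable (Leb \<Gamma> \<Otimes>\<^sub>M M')"
    by (rule dens_measurable) measurable
  have "(\<lambda>x. g3 (fst x) (snd x)) \<in> borel_measurable (Leb \<Gamma> \<Otimes>\<^sub>M M')"
    unfolding g3_def by measurable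
  then have g3m[measurable]: "(\<lambda>(y, \<omega>). g3 y \<omega>) \<in> borel_measurable (Leb \<Gamma> \<Otimes>\<^sub>M M')"
    by (simp add: split_beta')
  have swap: "(\<integral>\<^sup>+y. g2 y \<omega> \<partial>Leb \<Gamma>) = ennreal (1 / \<nu> ^ K) * (\<integral>\<^sup>+x. g3 x \<omega> \<partial>Leb \<Gamma>)"
    if \<omega>: "\<omega> \<in> space M'" for \<omega>
  proof -
    have "(\<integral>\<^sup>+y. g2 y \<omega> \<partial>Leb \<Gamma>) = ennreal (\<bar>- (1 / \<nu>)\<bar> ^ card \<Gamma>) *
       (\<integral>\<^sup>+x. g2 (\<lambda>\<gamma>\<in>\<Gamma>. l / \<nu> * B' \<gamma> (real m * e) \<omega> + - (1 / \<nu>) * x \<gamma>) \<omega> \<partial>Leb \<Gamma>)"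
    proof (rule nn_integral_PiM_lborel_affine)
      show "(\<lambda>y. g2 y \<omega>) \<in> borel_measurable (Leb \<Gamma>)"
        using measurable_compose[OF measurable_Pair2'[OF \<omega>] g2m] by simp
    qed (use \<nu> in auto)
    also have "(\<lambda>x. g2 (\<lambda>\<gamma>\<in>\<Gamma>. l / \<nu> * B' \<gamma> (real m * e) \<omega> + - (1 / \<nu>) * x \<gamma>) \<omega>) = (\<lambda>x. g3 x \<omega>)"
    proof
      fix x
      define y where "y = (\<lambda>\<gamma>\<in>\<Gamma>. l / \<nu> * B' \<gamma> (real m * e) \<omega> + - (1 / \<nu>) * x \<gamma>)"
      have y: "y \<gamma> = l / \<nu> * B' \<gamma> (real m * e) \<omega> - x \<gamma> / \<nu>" if "\<gamma> \<in> \<Gamma>" for \<gamma>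
        using that by (simp add: y_def)
      have "(\<Sum>\<gamma>\<in>\<Gamma>. y \<gamma> - l / \<nu> * B' \<gamma> (real m * e) \<omega>) = (\<Sum>\<gamma>\<in>\<Gamma>. - x \<gamma> / \<nu>)"
        by (intro sum.cong refl) (simp add: y)
      then have 1: "- \<theta> * (\<Sum>\<gamma>\<in>\<Gamma>. y \<gamma> - l / \<nu> * B' \<gamma> (real m * e) \<omega>) = \<theta> / \<nu> * (\<Sum>\<gamma>\<in>\<Gamma>. x \<gamma>)"
        by (simp add: sum_negf sum_divide_distrib[symmetric])
      have 2: "dens h y = dens h (\<lambda>\<gamma>. - x \<gamma> / \<nu> + l / \<nu> * B' \<gamma> (real m * e) \<omega>)"
        by (rule dens_cong) (simp add: y)
      have 3: "(y \<gamma> - l / \<nu> * (B' \<gamma> (real m * e) \<omega> - B' \<gamma> (real j * e) \<omega>) > real j * (\<nu> * d))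
         = (l * B' \<gamma> (real j * e) \<omega> - l\<^sup>2 * (real j * e) > x \<gamma>)" if "\<gamma> \<in> \<Gamma>" for j \<gamma>
      proof -
        have 4: "l\<^sup>2 * (real j * e) = \<nu> * (real j * (\<nu> * d))"
          using l by (simp add: e_def power2_eq_square)
        have 5: "y \<gamma> - l / \<nu> * (B' \<gamma> (real m * e) \<omega> - B' \<gamma> (real j * e) \<omega>) = (l * B' \<gamma> (real j * e) \<omega> - x \<gamma>) / \<nu>"
          using \<nu>(2) by (simp add: y[OF that] field_simps)
        show ?thesis
          unfolding 4 5 less_divide_eq using \<nu>(2) by (auto simp: algebra_simps)
      qed
      have "(\<exists>j\<in>R. \<forall>\<gamma>\<in>\<Gamma>. y \<gamma> - l / \<nu> * (B' \<gamma> (real m * e) \<omega> - B' \<gamma> (real j * e) \<omega>) > real j * (\<nu> * d))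
        = (\<exists>j\<in>R. \<forall>\<gamma>\<in>\<Gamma>. l * B' \<gamma> (real j * e) \<omega> - l\<^sup>2 * (real j * e) > x \<gamma>)"
        by (intro bex_cong ball_cong refl 3)
      then show "g2 (\<lambda>\<gamma>\<in>\<Gamma>. l / \<nu> * B' \<gamma> (real m * e) \<omega> + - (1 / \<nu>) * x \<gamma>) \<omega> = g3 x \<omega>"
        unfolding y_def[symmetric] g2_def g3_def 1 2 by (simp only: indicator_def mem_Collect_eq)
    qed
    finally show ?thesis using \<nu>(2) by (simp add: power_divide)
  qed
  have "emeasure M {\<omega>\<in>space M. \<exists>j\<in>R. \<forall>\<gamma>\<in>\<Gamma>. path \<eta> (\<gamma> - 1) (\<Delta> \<eta> - real j * d) \<omega> - c * (T - real j * d) > u}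
    = ennreal (exp (- real K * \<theta>\<^sup>2 * rowsum (\<Delta> \<eta>) / 2)) * (\<integral>\<^sup>+y. (\<integral>\<^sup>+z. g y z \<partial>?G) \<partial>Leb \<Gamma>)"
    unfolding g_def h_def d_def by (rule grid_exceedance_tilted[OF m \<delta> R \<theta>])
  also have "(\<integral>\<^sup>+y. (\<integral>\<^sup>+z. g y z \<partial>?G) \<partial>Leb \<Gamma>) = (\<integral>\<^sup>+y. (\<integral>\<^sup>+\<omega>. g2 y \<omega> \<partial>M') \<partial>Leb \<Gamma>)"
    by (simp only: inner)
  also have "\<dots> = (\<integral>\<^sup>+\<omega>. (\<integral>\<^sup>+y. g2 y \<omega> \<partial>Leb \<Gamma>) \<partial>M')"
    by (rule PS.Fubini'[symmetric]) measurable
  also have "\<dots> = (\<integral>\<^sup>+\<omega>. ennreal (1 / \<nu> ^ K) * (\<integral>\<^sup>+x. g3 x \<omega> \<partial>Leb \<Gamma>) \<partial>M')"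
    by (rule nn_integral_cong) (rule swap)
  also have "\<dots> = ennreal (1 / \<nu> ^ K) * (\<integral>\<^sup>+\<omega>. (\<integral>\<^sup>+x. g3 x \<omega> \<partial>Leb \<Gamma>) \<partial>M')"
    by (rule nn_integral_cmult) measurable
  also have "(\<integral>\<^sup>+\<omega>. (\<integral>\<^sup>+x. g3 x \<omega> \<partial>Leb \<Gamma>) \<partial>M') = (\<integral>\<^sup>+x. (\<integral>\<^sup>+\<omega>. g3 x \<omega> \<partial>M') \<partial>Leb \<Gamma>)"
    by (rule PS.Fubini') measurable
  finally show ?thesis
    unfolding g3_def[symmetric] using \<nu>(2) by (simp add: mult.assoc[symmetric] ennreal_mult[symmetric])
qed

end

section \<open>Motions with negative drift\<close>

lemma integrable_exp_abs: "integrable lborel (\<lambda>x::real. exp (- \<bar>x\<bar> / 2))"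
proof -
  have ed: "integrable lborel (exponential_density (1 / 2))"
  proof (rule integrableI_nonneg)
    interpret prob_space "density lborel (exponential_density (1 / 2))"
      by (rule prob_space_exponential_density) simp
    show "(\<integral>\<^sup>+x. ennreal (exponential_density (1 / 2) x) \<partial>lborel) < \<infinity>"
      using emeasure_space_1 by (simp add: emeasure_density)
  qed (auto simp: exponential_density_nonneg)
  have "integrable lborel (\<lambda>x. exponential_density (1 / 2) (0 + (- 1) * x))"
    by (rule lborel_integrable_real_affine[OF ed]) simp
  with ed have "integrable lborel (\<lambda>x. 2 * (exponential_density (1 / 2) x + exponential_density (1 / 2) (0 + (- 1) * x)))"
    by (intro integrable_mult_right Bochner_Integration.integrable_add)
  then show ?thesis
    by (rule Bochner_Integration.integrable_bound) (auto simp: exponential_density_def)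
qed

lemma integral_exp_negative:
  shows "integrable lborel (\<lambda>x::real. exp x * indicator {..<0} x)"
    and "(\<integral>x. exp (x::real) * indicator {..<0} x \<partial>lborel) = 1"
proof -
  interpret prob_space "density lborel (exponential_density 1)"
    by (rule prob_space_exponential_density) simp
  define f where "f = (\<lambda>x. ennreal (exp x * indicator {..<0::real} x))"
  have f: "f \<in> borel_measurable borel" unfolding f_def by measurable
  have "(\<integral>\<^sup>+x. f x \<partial>lborel) = (\<integral>\<^sup>+x. f (0 + (- 1) * x) \<partial>lborel)"
    using nn_integral_real_affine[OF f, of "- 1" 0] by simp
  also have "\<dots> = (\<integral>\<^sup>+x. ennreal (exponential_density 1 x) \<partial>lborel)"
  proof (rule nn_integral_cong_AE)
    show "AE x in lborel. f (0 + (- 1) * x) = ennreal (exponential_density 1 x)"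
      using AE_lborel_singleton[of "0 :: real"]
    proof eventually_elim
      case (elim x)
      then show ?case
        by (cases "x < 0") (simp_all add: f_def exponential_density_def)
    qed
  qed
  also have "\<dots> = 1"
    using emeasure_space_1 by (simp add: emeasure_density)
  finally have 1: "(\<integral>\<^sup>+x. ennreal (exp x * indicator {..<0} x) \<partial>lborel) = ennreal 1"
    by (simp add: f_def)
  then show "integrable lborel (\<lambda>x::real. exp x * indicator {..<0} x)"
    by (intro integrableI_nonneg) auto
  show "(\<integral>x. exp (x::real) * indicator {..<0} x \<partial>lborel) = 1"
    using 1 by (subst integral_eq_nn_integral) auto
qed

locale drifted_motions =
  fixes M' :: "'b measure" and B' :: "nat \<Rightarrow> real \<Rightarrow> 'b \<Rightarrow> real" and \<Gamma> :: "nat set" and l :: real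
  assumes ibm: "indep_brownian_motions M' \<Gamma> (\<lambda>_. {0..}) B'"
    and fin: "finite \<Gamma>" and ne: "\<Gamma> \<noteq> {}" and l: "l > 0"
begin

sublocale M': prob_space M'
  using ibm by (simp add: indep_brownian_motions_def)

text \<open>
  The event in the definition of \<open>\<H>\<close>, for a set \<open>I\<close> of times.
\<close>
definition hit :: "real set \<Rightarrow> (nat \<Rightarrow> real) \<Rightarrow> 'b set" where
  "hit I x = {\<omega>\<in>space M'. \<exists>t\<in>I. \<forall>\<gamma>\<in>\<Gamma>. l * B' \<gamma> t \<omega> - l\<^sup>2 * t > x \<gamma>}"

definition grid :: "real \<Rightarrow> nat \<Rightarrow> real set" where
  "grid L m = (\<lambda>j. real j * (L / real (Suc m))) ` {..Suc m}"

lemma bm': "\<gamma> \<in> \<Gamma> \<Longrightarrow> brownian_motion M' {0..} (B' \<gamma>)"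
  using ibm by (simp add: indep_brownian_motions_def)

lemma B'_measurable: "\<gamma> \<in> \<Gamma> \<Longrightarrow> t \<ge> 0 \<Longrightarrow> B' \<gamma> t \<in> borel_measurable M'"
  using bm' by (simp add: brownian_motion_def)

lemma B'_0: "\<gamma> \<in> \<Gamma> \<Longrightarrow> \<omega> \<in> space M' \<Longrightarrow> B' \<gamma> 0 \<omega> = 0"
  using bm' by (simp add: brownian_motion_def)

lemma drift_continuous:
  assumes "\<gamma> \<in> \<Gamma>" "\<omega> \<in> space M'"
  shows "continuous_on {0..} (\<lambda>t. l * B' \<gamma> t \<omega> - l\<^sup>2 * t)"
  using bm'[OF assms(1)] assms(2) by (intro continuous_intros) (simp add: brownian_motion_def)

lemma grid_subset:
  assumes "L \<ge> 0"
  shows "grid L m \<subseteq> {0..L}"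
proof -
  have "real j * (L / real (Suc m)) \<le> L" if "j \<le> Suc m" for j
  proof -
    have "real j * L \<le> real (Suc m) * L" using that assms by (intro mult_right_mono) auto
    then show ?thesis by (simp add: divide_le_eq mult.commute)
  qed
  then show ?thesis using assms by (auto simp: grid_def simp del: of_nat_Suc)
qed

lemma hit_mono: "I \<subseteq> J \<Longrightarrow> hit I x \<subseteq> hit J x"
  unfolding hit_def by blast

lemma hit_space: "hit I x \<subseteq> space M'"
  unfolding hit_def by blast

lemma eventually_hit_grid:
  assumes "L > 0" "\<omega> \<in> hit {0..L} x"
  shows "\<forall>\<^sub>F m in sequentially. \<omega> \<in> hit (grid L m) x"
proof -
  from assms(2) obtain t where \<omega>: "\<omega> \<in> space M'" and t: "t \<in> {0..L}" "\<forall>\<gamma>\<in>\<Gamma>. l * B' \<gamma> t \<omega> - l\<^sup>2 * t > x \<gamma>"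
    unfolding hit_def by blast
  have "\<forall>\<^sub>F m in sequentially. \<exists>j\<le>Suc m. \<forall>\<gamma>\<in>\<Gamma>.
      l * B' \<gamma> (real j * (L / real (Suc m))) \<omega> - l\<^sup>2 * (real j * (L / real (Suc m))) > x \<gamma>"
    using t by (intro eventually_grid_point_exceeds[where f = "\<lambda>\<gamma> t. l * B' \<gamma> t \<omega> - l\<^sup>2 * t"]
        fin continuous_on_subset[OF drift_continuous[OF _ \<omega>]] assms(1)) auto
  then show ?thesis
    by eventually_elim (use \<omega> in \<open>auto simp: hit_def grid_def simp del: of_nat_Suc\<close>)
qed

lemma hit_countable_pred:
  assumes "countable I" "I \<subseteq> {0..}"
  shows "Measurable.pred (Leb \<Gamma> \<Otimes>\<^sub>M M') (\<lambda>z. snd z \<in> hit I (fst z))"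
proof -
  have [measurable]: "B' \<gamma> t \<in> borel_measurable M'" if "t \<in> I" "\<gamma> \<in> \<Gamma>" for t \<gamma>
    using B'_measurable that assms by auto
  have "Measurable.pred (Leb \<Gamma> \<Otimes>\<^sub>M M') (\<lambda>z. \<forall>\<gamma>\<in>\<Gamma>. l * B' \<gamma> t (snd z) - l\<^sup>2 * t > fst z \<gamma>)" if "t \<in> I" for t
    using that fin by measurable
  then have "(\<Union>t\<in>I. {z\<in>space (Leb \<Gamma> \<Otimes>\<^sub>M M'). \<forall>\<gamma>\<in>\<Gamma>. l * B' \<gamma> t (snd z) - l\<^sup>2 * t > fst z \<gamma>}) \<in> sets (Leb \<Gamma> \<Otimes>\<^sub>M M')"
    unfolding pred_def by (intro sets.countable_UN' assms(1)) auto
  also have "(\<Union>t\<in>I. {z\<in>space (Leb \<Gamma> \<Otimes>\<^sub>M M'). \<forall>\<gamma>\<in>\<Gamma>. l * B' \<gamma> t (snd z) - l\<^sup>2 * t > fst z \<gamma>})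
     = {z\<in>space (Leb \<Gamma> \<Otimes>\<^sub>M M'). snd z \<in> hit I (fst z)}"
    by (auto simp: hit_def space_pair_measure)
  finally show ?thesis by (simp add: pred_def)
qed

lemma hit_Icc_eq:
  assumes "L > 0"
  shows "hit {0..L} x = hit (\<Union>m. grid L m) x"
proof
  show "hit {0..L} x \<subseteq> hit (\<Union>m. grid L m) x"
  proof
    fix \<omega> assume "\<omega> \<in> hit {0..L} x"
    from eventually_hit_grid[OF assms this] obtain m where "\<omega> \<in> hit (grid L m) x"
      by (auto simp: eventually_sequentially)
    then show "\<omega> \<in> hit (\<Union>m. grid L m) x"
      by (rule subsetD[OF hit_mono, rotated]) blast
  qed
  show "hit (\<Union>m. grid L m) x \<subseteq> hit {0..L} x"
    using grid_subset[of L] assms by (intro hit_mono) auto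
qed

lemma grid_nonneg:
  assumes "L \<ge> 0"
  shows "grid L m \<subseteq> {0..}"
  using grid_subset[OF assms, of m] by auto

lemma hit_Ici_eq: "hit {0..} x = hit (\<Union>N. \<Union>m. grid (real (Suc N)) m) x"
proof
  show "hit {0..} x \<subseteq> hit (\<Union>N. \<Union>m. grid (real (Suc N)) m) x"
  proof
    fix \<omega> assume "\<omega> \<in> hit {0..} x"
    then obtain t where t: "t \<ge> 0" "\<omega> \<in> hit {t} x" unfolding hit_def by auto
    obtain N where N: "t \<le> real N" using real_arch_simple by blast
    have "\<omega> \<in> hit {0..real (Suc N)} x" using t N hit_mono[of "{t}" "{0..real (Suc N)}"] by auto
    then have "\<omega> \<in> hit (\<Union>m. grid (real (Suc N)) m) x" by (subst (asm) hit_Icc_eq) auto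
    then show "\<omega> \<in> hit (\<Union>N. \<Union>m. grid (real (Suc N)) m) x"
      by (rule subsetD[OF hit_mono, rotated]) blast
  qed
  show "hit (\<Union>N. \<Union>m. grid (real (Suc N)) m) x \<subseteq> hit {0..} x"
    by (intro hit_mono UN_least grid_nonneg of_nat_0_le_iff)
qed

lemma countable_grid: "countable (grid L m)"
  unfolding grid_def by simp

lemma hit_pred:
  "Measurable.pred (Leb \<Gamma> \<Otimes>\<^sub>M M') (\<lambda>z. snd z \<in> hit {0..L} (fst z))"
  "Measurable.pred (Leb \<Gamma> \<Otimes>\<^sub>M M') (\<lambda>z. snd z \<in> hit {0..} (fst z))"
proof -
  consider "L < 0" | "L = 0" | "L > 0" by linarith
  then show "Measurable.pred (Leb \<Gamma> \<Otimes>\<^sub>M M') (\<lambda>z. snd z \<in> hit {0..L} (fst z))"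
  proof cases
    case 3
    then show ?thesis
      unfolding hit_Icc_eq[OF 3]
      by (intro hit_countable_pred UN_least grid_nonneg countable_UN countable_grid) auto
  qed (auto intro!: hit_countable_pred)
  show "Measurable.pred (Leb \<Gamma> \<Otimes>\<^sub>M M') (\<lambda>z. snd z \<in> hit {0..} (fst z))"
    unfolding hit_Ici_eq
    by (intro hit_countable_pred UN_least grid_nonneg of_nat_0_le_iff countable_UN countable_grid) auto
qed

text \<open>
  \<^const>\<open>hit\<close> depends on \<open>x\<close> only through its restriction to \<open>\<Gamma>\<close>, which is a point of the product space.
\<close>
lemma hit_sets:
  assumes "Measurable.pred (Leb \<Gamma> \<Otimes>\<^sub>M M') (\<lambda>z. snd z \<in> hit I (fst z))"
  shows "hit I x \<in> sets M'"
proof -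
  define x' where "x' = restrict x \<Gamma>"
  have "x' \<in> space (Leb \<Gamma>)" by (simp add: x'_def space_PiM)
  from measurable_compose[OF measurable_Pair1'[OF this] assms]
  have "Measurable.pred M' (\<lambda>\<omega>. \<omega> \<in> hit I x')" by simp
  then have "{\<omega>\<in>space M'. \<omega> \<in> hit I x'} \<in> sets M'" by (simp add: pred_def)
  also have "{\<omega>\<in>space M'. \<omega> \<in> hit I x'} = hit I x"
    by (auto simp: hit_def x'_def)
  finally show ?thesis .
qed

lemma prob_hit_grid_le:
  assumes "L > 0"
  shows "M'.prob (hit (grid L m) x) \<le> exp (- 2 * (\<Sum>\<gamma>\<in>\<Gamma>. max 0 (x \<gamma>)))"
proof -
  have "hit (grid L m) x = {\<omega>\<in>space M'. \<exists>j\<le>Suc m. \<forall>\<gamma>\<in>\<Gamma>. l * B' \<gamma> (real j * (L / real (Suc m))) \<omega> - l\<^sup>2 * (real j * (L / real (Suc m))) > x \<gamma>}"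
    by (auto simp: hit_def grid_def simp del: of_nat_Suc)
  then show ?thesis
    using indep_brownian_drift_maximal_inequality[OF ibm fin, where d = "L / real (Suc m)" and m = "Suc m" and l = l and x = x] assms by simp
qed

lemma prob_hit_grid_tendsto:
  assumes "L > 0"
  shows "(\<lambda>m. M'.prob (hit (grid L m) x)) \<longlonglongrightarrow> M'.prob (hit {0..L} x)"
proof (rule M'.events_grid_limit(2))
  show "hit (grid L m) x \<in> M'.events" for m
    using grid_subset[of L m] assms by (intro hit_sets hit_countable_pred countable_grid) auto
  show "hit (grid L m) x \<subseteq> hit {0..L} x" for m
    using grid_subset[of L m] assms by (intro hit_mono) auto
qed (rule eventually_hit_grid[OF assms])

lemma prob_hit_le:
  assumes "L > 0"
  shows "M'.prob (hit {0..L} x) \<le> exp (- 2 * (\<Sum>\<gamma>\<in>\<Gamma>. max 0 (x \<gamma>)))"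
  by (rule LIMSEQ_le_const2[OF prob_hit_grid_tendsto[OF assms]]) (use prob_hit_grid_le[OF assms] in auto)

lemma prob_hit_tendsto:
  assumes "filterlim L at_top at_top"
  shows "((\<lambda>u. M'.prob (hit {0..L u} x)) \<longlongrightarrow> M'.prob (hit {0..} x)) (at_top :: real filter)"
proof (rule tendsto_at_topI_sequentially)
  fix X :: "nat \<Rightarrow> real" assume "filterlim X at_top sequentially"
  then have L: "filterlim (\<lambda>n. L (X n)) at_top sequentially"
    using assms filterlim_compose by blast
  show "(\<lambda>n. M'.prob (hit {0..L (X n)} x)) \<longlonglongrightarrow> M'.prob (hit {0..} x)"
  proof (rule M'.events_grid_limit(2))
    show "hit {0..L (X n)} x \<in> M'.events" for n by (intro hit_sets hit_pred)
    show "hit {0..L (X n)} x \<subseteq> hit {0..} x" for n by (intro hit_mono) auto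
    fix \<omega> assume "\<omega> \<in> hit {0..} x"
    then obtain t where t: "t \<ge> 0" "\<omega> \<in> hit {t} x" unfolding hit_def by auto
    have "\<forall>\<^sub>F n in sequentially. t \<le> L (X n)"
      using L by (simp add: filterlim_at_top)
    then show "\<forall>\<^sub>F n in sequentially. \<omega> \<in> hit {0..L (X n)} x"
    proof eventually_elim
      case (elim n)
      then show ?case using t hit_mono[of "{t}" "{0..L (X n)}"] by auto
    qed
  qed
qed

text \<open>
  If the levels are exceeded at time \<open>0\<close>, then by continuity also shortly afterwards.
\<close>
lemma hit_positive_times: "hit {0<..} x = hit {0..} x"
proof
  show "hit {0<..} x \<subseteq> hit {0..} x" by (intro hit_mono) auto
  show "hit {0..} x \<subseteq> hit {0<..} x"
  proof
    fix \<omega> assume "\<omega> \<in> hit {0..} x"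
    then obtain t where \<omega>: "\<omega> \<in> space M'" and t: "t \<ge> 0" "\<forall>\<gamma>\<in>\<Gamma>. l * B' \<gamma> t \<omega> - l\<^sup>2 * t > x \<gamma>"
      unfolding hit_def by auto
    define s where "s n = t + inverse (real (Suc n))" for n
    have s: "s \<longlonglongrightarrow> t" unfolding s_def by real_asymp
    then have "(\<lambda>n. l * B' \<gamma> (s n) \<omega> - l\<^sup>2 * s n) \<longlonglongrightarrow> l * B' \<gamma> t \<omega> - l\<^sup>2 * t" if "\<gamma> \<in> \<Gamma>" for \<gamma>
      using t by (intro continuous_on_tendsto_compose[OF drift_continuous[OF that \<omega>] s] always_eventually) (auto simp: s_def)
    then have "\<forall>\<^sub>F n in sequentially. \<forall>\<gamma>\<in>\<Gamma>. l * B' \<gamma> (s n) \<omega> - l\<^sup>2 * s n > x \<gamma>"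
      using t by (intro eventually_ball_finite[OF fin] ballI order_tendstoD) auto
    then obtain n where "\<forall>\<gamma>\<in>\<Gamma>. l * B' \<gamma> (s n) \<omega> - l\<^sup>2 * s n > x \<gamma>"
      by (auto simp: eventually_sequentially)
    moreover have "s n > 0" using t by (simp add: s_def add_nonneg_pos)
    ultimately show "\<omega> \<in> hit {0<..} x" using \<omega> unfolding hit_def by auto
  qed
qed

lemma hit_0: "hit {0} x = (if \<forall>\<gamma>\<in>\<Gamma>. x \<gamma> < 0 then space M' else {})"
  unfolding hit_def using B'_0 by auto

end

section \<open>Asymptotics for fixed offspring numbers\<close>

text \<open>
  The law depends on \<open>a\<close> and \<open>t\<close> only through \<open>a * sqrt t\<close>.
\<close>
lemma (in drifted_motions) nn_integral_scaled_marginal: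
  assumes a: "a > 0" and t: "t > 0" and f: "f \<in> borel_measurable (PiM \<Gamma> (\<lambda>_. borel))"
  shows "(\<integral>\<^sup>+\<omega>. f (\<lambda>\<gamma>\<in>\<Gamma>. a * B' \<gamma> t \<omega>) \<partial>M') = (\<integral>\<^sup>+z. f z \<partial>PiM \<Gamma> (\<lambda>_. gauss (a * sqrt t)))"
proof -
  note inc = indep_brownian_increments[OF ibm fin, of "\<lambda>_. 1" "\<lambda>_ k. real k * t"]
  define Z where "Z \<gamma> \<omega> = 0 + a * (B' \<gamma> (real (Suc 0) * t) \<omega> - B' \<gamma> (real 0 * t) \<omega>)" for \<gamma> \<omega>
  have "M'.indep_vars (\<lambda>_. borel) (\<lambda>x \<omega>. B' (fst x) (real (Suc (snd x)) * t) \<omega> - B' (fst x) (real (snd x) * t) \<omega>) (SIGMA \<gamma>:\<Gamma>. {..<1})"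
    by (rule inc(1)) (use t in auto)
  from M'.indep_vars_inj_reindex[OF this, of "\<lambda>\<gamma>. (\<gamma>, 0)" \<Gamma>]
  have "M'.indep_vars (\<lambda>_. borel) (\<lambda>\<gamma> \<omega>. B' \<gamma> (real (Suc 0) * t) \<omega> - B' \<gamma> (real 0 * t) \<omega>) \<Gamma>"
    by (simp add: inj_on_def image_subset_iff)
  from M'.indep_vars_compose2[OF this, of "\<lambda>_ b. 0 + a * b" "\<lambda>_. borel"]
  have ind: "M'.indep_vars (\<lambda>_. borel) Z \<Gamma>" by (simp add: Z_def[abs_def])
  have Z: "distributed M' lborel (Z \<gamma>) (normal_density 0 (a * sqrt t))" if "\<gamma> \<in> \<Gamma>" for \<gamma>
  proof -
    have "distributed M' lborel (\<lambda>\<omega>. B' (fst (\<gamma>, 0::nat)) (real (Suc (snd (\<gamma>, 0::nat))) * t) \<omega> - B' (fst (\<gamma>, 0::nat)) (real (snd (\<gamma>, 0::nat)) * t) \<omega>)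
       (normal_density 0 (sqrt (real (Suc (snd (\<gamma>, 0::nat))) * t - real (snd (\<gamma>, 0::nat)) * t)))"
      by (rule inc(2)) (use that t in auto)
    then have "distributed M' lborel (\<lambda>\<omega>. B' \<gamma> (real (Suc 0) * t) \<omega> - B' \<gamma> (real 0 * t) \<omega>) (normal_density 0 (sqrt t))"
      by simp
    then have "distributed M' lborel (Z \<gamma>) (normal_density (0 + a * 0) (\<bar>a\<bar> * sqrt t))"
      unfolding Z_def using t a by (intro M'.normal_density_affine) auto
    then show ?thesis using a by simp
  qed
  have "(\<integral>\<^sup>+\<omega>. f (\<lambda>\<gamma>\<in>\<Gamma>. a * B' \<gamma> t \<omega>) \<partial>M') = (\<integral>\<^sup>+\<omega>. f (\<lambda>\<gamma>\<in>\<Gamma>. Z \<gamma> \<omega>) \<partial>M')"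
    by (intro nn_integral_cong arg_cong[where f = f] restrict_ext) (auto simp: Z_def B'_0)
  also have "\<dots> = (\<integral>\<^sup>+z. f z \<partial>PiM \<Gamma> (\<lambda>_. gauss (a * sqrt t)))"
    by (rule M'.nn_integral_indep_gauss[OF ind ne Z f])
  finally show ?thesis .
qed

text \<open>
  Dominated convergence; the densities of the last level are uniformly bounded as long as \<open>h\<close>
  stays away from \<open>0\<close>.
\<close>
lemma (in gaussian_tree) dens_tendsto:
  assumes h: "(h \<longlongrightarrow> \<Delta> \<eta>) at_top" and z: "\<And>\<gamma>. \<gamma> \<in> \<Gamma> \<Longrightarrow> ((\<lambda>u. z u \<gamma>) \<longlongrightarrow> 0) at_top"
  shows "((\<lambda>u::real. dens (h u) (z u)) \<longlongrightarrow> dens (\<Delta> \<eta>) (\<lambda>_. 0)) at_top"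
  unfolding dens_def
proof (rule integral_dominated_convergence_at_top)
  have D: "\<Delta> \<eta> > 0" by (rule \<Delta>_pos) simp
  show "(\<lambda>\<omega>. \<Prod>\<gamma>\<in>\<Gamma>. normal_density 0 (sqrt (h u)) (z u \<gamma> - X (\<gamma> - 1) \<omega>)) \<in> borel_measurable M" for u
    by measurable
  show "(\<lambda>\<omega>. \<Prod>\<gamma>\<in>\<Gamma>. normal_density 0 (sqrt (\<Delta> \<eta>)) (0 - X (\<gamma> - 1) \<omega>)) \<in> borel_measurable M"
    by measurable
  show "integrable M (\<lambda>_. (1 / sqrt (2 * pi * (\<Delta> \<eta> / 2))) ^ K)" by simp
  have "((\<lambda>u. normal_density 0 (sqrt (h u)) (z u \<gamma> - X (\<gamma> - 1) \<omega>)) \<longlongrightarrow> normal_density 0 (sqrt (\<Delta> \<eta>)) (0 - X (\<gamma> - 1) \<omega>)) at_top"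
    if "\<gamma> \<in> \<Gamma>" for \<gamma> \<omega>
    unfolding normal_density_def using D by (intro tendsto_intros h z that) auto
  then show "AE \<omega> in M. ((\<lambda>u. \<Prod>\<gamma>\<in>\<Gamma>. normal_density 0 (sqrt (h u)) (z u \<gamma> - X (\<gamma> - 1) \<omega>)) \<longlongrightarrow>
      (\<Prod>\<gamma>\<in>\<Gamma>. normal_density 0 (sqrt (\<Delta> \<eta>)) (0 - X (\<gamma> - 1) \<omega>))) at_top"
    by (intro AE_I2 tendsto_prod)
  have "\<forall>\<^sub>F u in at_top. h u > \<Delta> \<eta> / 2"
    using h D by (intro order_tendstoD) auto
  then show "\<forall>\<^sub>F u in at_top. AE \<omega> in M. norm (\<Prod>\<gamma>\<in>\<Gamma>. normal_density 0 (sqrt (h u)) (z u \<gamma> - X (\<gamma> - 1) \<omega>))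
      \<le> (1 / sqrt (2 * pi * (\<Delta> \<eta> / 2))) ^ K"
  proof eventually_elim
    case (elim u)
    have "(\<Prod>\<gamma>\<in>\<Gamma>. normal_density 0 (sqrt (h u)) (z u \<gamma> - X (\<gamma> - 1) \<omega>)) \<le> (1 / sqrt (2 * pi * h u)) ^ K" for \<omega>
      using elim D by (intro prod_density_le) auto
    also have "(1 / sqrt (2 * pi * h u)) ^ K \<le> (1 / sqrt (2 * pi * (\<Delta> \<eta> / 2))) ^ K"
      using elim D by (intro power_mono divide_left_mono) (auto intro!: mult_pos_pos)
    finally show ?case by (intro AE_I2) (simp add: abs_prod)
  qed
qed

lemma (in gaussian_tree) dens_pos:
  assumes h: "h > 0"
  shows "dens h y > 0"
proof -
  have "dens h y \<noteq> 0"
  proof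
    assume "dens h y = 0"
    then have "AE \<omega> in M. (\<Prod>\<gamma>\<in>\<Gamma>. normal_density 0 (sqrt h) (y \<gamma> - X (\<gamma> - 1) \<omega>)) = 0"
      unfolding dens_def
      by (subst (asm) integral_nonneg_eq_0_iff_AE[OF dens_integrable[OF h]]) (auto simp: prod_nonneg)
    moreover have "(\<Prod>\<gamma>\<in>\<Gamma>. normal_density 0 (sqrt h) (y \<gamma> - X (\<gamma> - 1) \<omega>)) \<noteq> 0" for \<omega>
      using h normal_density_pos[of "sqrt h" 0] by (auto simp: less_le)
    ultimately show False by simp
  qed
  then show ?thesis using dens_nonneg[of h y] by simp
qed

text \<open>
  From here on \<open>l\<close> is the constant \<open>1 / \<mu>\<^sub>0(T)\<close> of the theorem.  The quantities below are the parameters of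
  \<open>grid_exceedance\<close> as functions of the level \<open>u\<close>.
\<close>
locale tree_limit = gaussian_tree M W \<tau> n \<eta> + drifted_motions M' B' "{1..offspring_prod n \<eta>}" l
  for M :: "'a measure" and W \<tau> n \<eta> and M' :: "'b measure" and B' l +
  fixes c :: real
  assumes l_eq: "l = 1 / rowsum (\<Delta> \<eta>)"
begin

definition \<theta> :: "real \<Rightarrow> real" where "\<theta> u = (u + c * T) * l"
definition \<nu> :: "real \<Rightarrow> real" where "\<nu> u = \<theta> u - c"
text \<open>
  \<open>\<delta>\<close> tends to \<open>0\<close>, so that the density at time \<open>T - \<delta>\<close> converges; \<open>u\<^sup>2 * \<delta> u\<close> tends to infinity, so that
  the rescaled time interval exhausts the half-line; and it does so faster than \<open>u\<close>, so that earlier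
  exceedances are negligible.  The absolute value keeps \<open>L\<close>, the length of the rescaled interval,
  nonnegative for all \<open>u\<close>.
\<close>
definition \<delta> :: "real \<Rightarrow> real" where "\<delta> u = 1 / sqrt \<bar>u\<bar>"
definition L :: "real \<Rightarrow> real" where "L u = (\<nu> u)\<^sup>2 * \<delta> u / l\<^sup>2"
definition prefactor :: "real \<Rightarrow> real" where
  "prefactor u = exp (- real K * (\<theta> u)\<^sup>2 * rowsum (\<Delta> \<eta>) / 2) / \<nu> u ^ K"
definition endpoint :: "real \<Rightarrow> (nat \<Rightarrow> real) \<Rightarrow> 'b \<Rightarrow> nat \<Rightarrow> real" where
  "endpoint u x \<omega> \<gamma> = - x \<gamma> / \<nu> u + l / \<nu> u * B' \<gamma> (L u) \<omega>"
text \<open>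
  The integrand of the exact formula, as a function of the rescaled final position \<open>x\<close> of the branches;
  \<open>endpoint\<close> is the corresponding position at time \<open>T - \<delta> u\<close>.
\<close>
definition integrand :: "real \<Rightarrow> real set \<Rightarrow> (nat \<Rightarrow> real) \<Rightarrow> real" where
  "integrand u I x = exp (\<theta> u / \<nu> u * (\<Sum>\<gamma>\<in>\<Gamma>. x \<gamma>)) *
     (\<integral>\<omega>. dens (\<Delta> \<eta> - \<delta> u) (endpoint u x \<omega>) * indicator (hit I x) \<omega> \<partial>M')"
definition dens_bound :: real where "dens_bound = (1 / sqrt (2 * pi * (\<Delta> \<eta> / 2))) ^ K"
text \<open>
  What is needed of \<open>u\<close> for the exact formula and for the majorant; true for all large \<open>u\<close>.
\<close>
definition good :: "real \<Rightarrow> bool" where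
  "good u \<longleftrightarrow> 0 < \<delta> u \<and> \<delta> u \<le> \<Delta> \<eta> / 2 \<and> \<nu> u > 0 \<and> L u > 0 \<and> 1 / 2 \<le> \<theta> u / \<nu> u \<and> \<theta> u / \<nu> u \<le> 3 / 2"

lemma D: "\<Delta> \<eta> > 0" by (rule \<Delta>_pos) simp
lemma K: "K > 0" by (rule P_pos) simp

lemma \<theta>_rowsum: "\<theta> u * rowsum (\<Delta> \<eta>) = u + c * T"
proof -
  have "l * rowsum (\<Delta> \<eta>) = 1" using l l_eq by (auto simp: divide_simps split: if_splits)
  then show ?thesis by (simp add: \<theta>_def mult.assoc)
qed

lemma \<theta>_\<nu>_tendsto: "((\<lambda>u. \<theta> u / \<nu> u) \<longlongrightarrow> 1) at_top"
  unfolding \<nu>_def \<theta>_def using l by real_asymp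

lemma \<nu>_at_top: "filterlim \<nu> at_top at_top"
  unfolding \<nu>_def[abs_def] \<theta>_def using l by real_asymp

lemma \<delta>_tendsto: "(\<delta> \<longlongrightarrow> 0) at_top"
  unfolding \<delta>_def[abs_def] by real_asymp

lemma L_at_top: "filterlim L at_top at_top"
  unfolding L_def[abs_def] \<nu>_def \<theta>_def \<delta>_def using l by real_asymp

lemma eventually_good: "\<forall>\<^sub>F u in at_top. good u"
proof -
  have "\<forall>\<^sub>F u in at_top. 0 < \<delta> u"
    unfolding \<delta>_def by real_asymp
  moreover have "\<forall>\<^sub>F u in at_top. \<delta> u < \<Delta> \<eta> / 2"
    using \<delta>_tendsto D by (intro order_tendstoD) auto
  moreover have "\<forall>\<^sub>F u in at_top. \<nu> u > 0" "\<forall>\<^sub>F u in at_top. L u > 0"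
    using \<nu>_at_top L_at_top by (auto simp: filterlim_at_top_dense)
  moreover have "\<forall>\<^sub>F u in at_top. 1 / 2 < \<theta> u / \<nu> u" "\<forall>\<^sub>F u in at_top. \<theta> u / \<nu> u < 3 / 2"
    by (rule order_tendstoD[OF \<theta>_\<nu>_tendsto], simp)+
  ultimately show ?thesis
    by eventually_elim (auto simp: good_def)
qed

lemma endpoint_measurable:
  assumes "\<gamma> \<in> \<Gamma>"
  shows "(\<lambda>z. endpoint u (fst z) (snd z) \<gamma>) \<in> borel_measurable (Leb \<Gamma> \<Otimes>\<^sub>M M')"
proof -
  have [measurable]: "B' \<gamma> (L u) \<in> borel_measurable M'"
    using assms by (intro B'_measurable) (simp_all add: L_def \<delta>_def)
  have [measurable]: "(\<lambda>x. x \<gamma>) \<in> borel_measurable (Leb \<Gamma>)"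
    using assms by measurable
  show ?thesis unfolding endpoint_def by measurable
qed

lemma dens_endpoint_measurable:
  "(\<lambda>z. dens h (endpoint u (fst z) (snd z))) \<in> borel_measurable (Leb \<Gamma> \<Otimes>\<^sub>M M')"
  by (rule dens_measurable[OF endpoint_measurable])

lemma dens_endpoint_slice:
  assumes "x \<in> space (Leb \<Gamma>)"
  shows "(\<lambda>\<omega>. dens h (endpoint u x \<omega>)) \<in> borel_measurable M'"
  using measurable_compose[OF measurable_Pair1'[OF assms] dens_endpoint_measurable] by simp

lemma dens_good_le:
  assumes "good u"
  shows "dens (\<Delta> \<eta> - \<delta> u) y \<le> dens_bound"
proof -
  have h: "\<Delta> \<eta> - \<delta> u \<ge> \<Delta> \<eta> / 2" using assms by (auto simp: good_def)
  have "dens (\<Delta> \<eta> - \<delta> u) y \<le> (1 / sqrt (2 * pi * (\<Delta> \<eta> - \<delta> u))) ^ K"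
    using h D by (intro dens_le) auto
  also have "\<dots> \<le> dens_bound"
    unfolding dens_bound_def using h D by (intro power_mono divide_left_mono) (auto intro!: mult_pos_pos)
  finally show ?thesis .
qed

lemma dens_bound_nonneg: "dens_bound \<ge> 0"
  using D by (simp add: dens_bound_def)

text \<open>
  With the factor \<open>\<theta> u / \<nu> u\<close> between \<open>1/2\<close> and \<open>3/2\<close>, the weight is integrable on the negative half-line, and on the
  positive one it is beaten by the bound with rate \<open>2\<close>.
\<close>
lemma weight_le:
  assumes "good u" "p \<le> exp (- 2 * (\<Sum>\<gamma>\<in>\<Gamma>. max 0 (x \<gamma>)))"
  shows "exp (\<theta> u / \<nu> u * (\<Sum>\<gamma>\<in>\<Gamma>. x \<gamma>)) * p \<le> (\<Prod>\<gamma>\<in>\<Gamma>. exp (- \<bar>x \<gamma>\<bar> / 2))"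
proof -
  define q where "q = \<theta> u / \<nu> u"
  have q: "1 / 2 \<le> q" "q \<le> 3 / 2" using assms(1) by (auto simp: good_def q_def)
  have le: "q * y + - 2 * max 0 y \<le> - \<bar>y\<bar> / 2" for y :: real
  proof (cases "y \<ge> 0")
    case True
    then show ?thesis using mult_right_mono[OF q(2) True] by (simp add: max_def)
  next
    case False
    then show ?thesis using mult_right_mono_neg[OF q(1), of y] by (simp add: max_def)
  qed
  have "exp (q * (\<Sum>\<gamma>\<in>\<Gamma>. x \<gamma>)) * p \<le> exp (q * (\<Sum>\<gamma>\<in>\<Gamma>. x \<gamma>)) * exp (- 2 * (\<Sum>\<gamma>\<in>\<Gamma>. max 0 (x \<gamma>)))"
    using assms(2) by (intro mult_left_mono) auto
  also have "\<dots> = exp (\<Sum>\<gamma>\<in>\<Gamma>. q * x \<gamma> + - 2 * max 0 (x \<gamma>))"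
    by (simp only: exp_add[symmetric] sum.distrib sum_distrib_left)
  also have "\<dots> \<le> exp (\<Sum>\<gamma>\<in>\<Gamma>. - \<bar>x \<gamma>\<bar> / 2)"
    unfolding exp_le_cancel_iff by (intro sum_mono le)
  finally show ?thesis by (simp only: exp_sum finite_atLeastAtMost q_def)
qed

lemma integrable_majorant:
  "integrable (Leb \<Gamma>) (\<lambda>x. dens_bound * (\<Prod>\<gamma>\<in>\<Gamma>. exp (- \<bar>x \<gamma>\<bar> / 2)))"
proof -
  interpret product_sigma_finite "\<lambda>_::nat. lborel :: real measure" by standard
  show ?thesis
    by (intro integrable_mult_right product_integrable_prod integrable_exp_abs finite_atLeastAtMost)
qed

lemma integrand_inner_integrable:
  assumes good: "good u" and x: "x \<in> space (Leb \<Gamma>)" and I: "hit I x \<in> sets M'"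
  shows "integrable M' (\<lambda>\<omega>. dens (\<Delta> \<eta> - \<delta> u) (endpoint u x \<omega>) * indicator (hit I x) \<omega>)"
proof (rule M'.integrable_const_bound[where B = dens_bound])
  note [measurable] = dens_endpoint_slice[OF x] I
  show "(\<lambda>\<omega>. dens (\<Delta> \<eta> - \<delta> u) (endpoint u x \<omega>) * indicator (hit I x) \<omega>) \<in> borel_measurable M'"
    by measurable
  show "AE \<omega> in M'. norm (dens (\<Delta> \<eta> - \<delta> u) (endpoint u x \<omega>) * indicator (hit I x) \<omega>) \<le> dens_bound"
    using dens_good_le[OF good] dens_nonneg dens_bound_nonneg by (intro AE_I2) (auto simp: indicator_def)
qed

lemma integrand_bound:
  assumes good: "good u" and x: "x \<in> space (Leb \<Gamma>)" and I: "hit I x \<in> sets M'"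
    and p: "M'.prob (hit I x) \<le> exp (- 2 * (\<Sum>\<gamma>\<in>\<Gamma>. max 0 (x \<gamma>)))"
  shows "0 \<le> integrand u I x" "norm (integrand u I x) \<le> dens_bound * (\<Prod>\<gamma>\<in>\<Gamma>. exp (- \<bar>x \<gamma>\<bar> / 2))"
proof -
  have "0 \<le> (\<integral>\<omega>. dens (\<Delta> \<eta> - \<delta> u) (endpoint u x \<omega>) * indicator (hit I x) \<omega> \<partial>M')"
    by (intro integral_nonneg_AE AE_I2 mult_nonneg_nonneg dens_nonneg) auto
  then show nn: "0 \<le> integrand u I x" by (simp add: integrand_def)
  have "(\<integral>\<omega>. dens (\<Delta> \<eta> - \<delta> u) (endpoint u x \<omega>) * indicator (hit I x) \<omega> \<partial>M')
    \<le> (\<integral>\<omega>. dens_bound * indicator (hit I x) \<omega> \<partial>M')"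
    using I by (intro integral_mono integrand_inner_integrable[OF good x I] mult_right_mono dens_good_le[OF good])
      (auto intro!: integrable_mult_right M'.integrable_const_bound[where B = 1])
  also have "\<dots> = dens_bound * M'.prob (hit I x)"
    using hit_space[of I x] by (simp add: Int_absorb2)
  finally have "integrand u I x \<le> exp (\<theta> u / \<nu> u * (\<Sum>\<gamma>\<in>\<Gamma>. x \<gamma>)) * (dens_bound * M'.prob (hit I x))"
    unfolding integrand_def by (intro mult_left_mono) auto
  also have "\<dots> = dens_bound * (exp (\<theta> u / \<nu> u * (\<Sum>\<gamma>\<in>\<Gamma>. x \<gamma>)) * M'.prob (hit I x))" by simp
  also have "\<dots> \<le> dens_bound * (\<Prod>\<gamma>\<in>\<Gamma>. exp (- \<bar>x \<gamma>\<bar> / 2))"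
    by (intro mult_left_mono weight_le[OF good p] dens_bound_nonneg)
  finally show "norm (integrand u I x) \<le> dens_bound * (\<Prod>\<gamma>\<in>\<Gamma>. exp (- \<bar>x \<gamma>\<bar> / 2))" using nn by simp
qed

abbreviation (input) "hit_measurable I \<equiv>
  Measurable.pred (Leb \<Gamma> \<Otimes>\<^sub>M M') (\<lambda>z. snd z \<in> hit I (fst z))"

lemma indicator_hit_measurable:
  assumes "hit_measurable I"
  shows "(\<lambda>z. indicator (hit I (fst z)) (snd z) :: real) \<in> borel_measurable (Leb \<Gamma> \<Otimes>\<^sub>M M')"
  using assms unfolding indicator_def by measurable

lemma integrand_measurable:
  assumes "hit_measurable I"
  shows "integrand u I \<in> borel_measurable (Leb \<Gamma>)"
proof -
  note [measurable] = dens_endpoint_measurable indicator_hit_measurable[OF assms]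
  have "(\<lambda>z. dens (\<Delta> \<eta> - \<delta> u) (endpoint u (fst z) (snd z)) * indicator (hit I (fst z)) (snd z))
     \<in> borel_measurable (Leb \<Gamma> \<Otimes>\<^sub>M M')" by measurable
  then have [measurable]: "(\<lambda>x. \<integral>\<omega>. dens (\<Delta> \<eta> - \<delta> u) (endpoint u x \<omega>) * indicator (hit I x) \<omega> \<partial>M')
     \<in> borel_measurable (Leb \<Gamma>)"
    by (intro M'.borel_measurable_lebesgue_integral) (simp add: split_beta')
  show ?thesis unfolding integrand_def[abs_def] by measurable
qed

lemma prob_grid_exceedance:
  assumes good: "good u" and R: "R \<subseteq> {..Suc m}"
  shows "prob {\<omega>\<in>space M. \<exists>j\<in>R. \<forall>\<gamma>\<in>\<Gamma>.
      path \<eta> (\<gamma> - 1) (\<Delta> \<eta> - real j * (\<delta> u / real (Suc m))) \<omega> - c * (T - real j * (\<delta> u / real (Suc m))) > u}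
    = prefactor u * (\<integral>x. integrand u ((\<lambda>j. real j * (L u / real (Suc m))) ` R) x \<partial>Leb \<Gamma>)" (is "prob ?A = _ * (\<integral>x. integrand u ?I x \<partial>_)")
proof -
  let ?g = "\<lambda>x \<omega>. ennreal (exp (\<theta> u / \<nu> u * (\<Sum>\<gamma>\<in>\<Gamma>. x \<gamma>)) * dens (\<Delta> \<eta> - \<delta> u) (\<lambda>\<gamma>. - x \<gamma> / \<nu> u + l / \<nu> u * B' \<gamma> (real (Suc m) * (L u / real (Suc m))) \<omega>)) *
          indicator {\<omega>. \<exists>j\<in>R. \<forall>\<gamma>\<in>\<Gamma>. l * B' \<gamma> (real j * (L u / real (Suc m))) \<omega> - l\<^sup>2 * (real j * (L u / real (Suc m))) > x \<gamma>} \<omega>"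
  have \<delta>: "0 < \<delta> u" "\<delta> u < \<Delta> \<eta>" and \<nu>: "\<nu> u > 0" and L: "L u > 0" using good D by (auto simp: good_def)
  have meas: "hit_measurable ?I"
    using R L finite_subset[OF R] by (intro hit_countable_pred) (auto intro: countable_finite)
  have e: "(\<nu> u)\<^sup>2 * (\<delta> u / real (Suc m)) / l\<^sup>2 = L u / real (Suc m)"
    by (simp add: L_def)
  have "emeasure M ?A = ennreal (prefactor u) * (\<integral>\<^sup>+x. (\<integral>\<^sup>+\<omega>. ?g x \<omega>
        \<partial>M') \<partial>Leb \<Gamma>)"
    unfolding prefactor_def e[symmetric]
    by (rule grid_exceedance[OF ibm _ \<delta> R \<theta>_rowsum \<nu>_def \<nu> l]) simp
  also have "(\<integral>\<^sup>+x. (\<integral>\<^sup>+\<omega>. ?g x \<omega>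
        \<partial>M') \<partial>Leb \<Gamma>) = (\<integral>\<^sup>+x. ennreal (integrand u ?I x) \<partial>Leb \<Gamma>)"
  proof (rule nn_integral_cong)
    fix x :: "nat \<Rightarrow> real" assume x: "x \<in> space (Leb \<Gamma>)"
    have "ennreal (integrand u ?I x) = ennreal (\<integral>\<omega>. exp (\<theta> u / \<nu> u * (\<Sum>\<gamma>\<in>\<Gamma>. x \<gamma>)) * (dens (\<Delta> \<eta> - \<delta> u) (endpoint u x \<omega>) * indicator (hit ?I x) \<omega>) \<partial>M')"
      by (simp add: integrand_def)
    also have "\<dots> = (\<integral>\<^sup>+\<omega>. ennreal (exp (\<theta> u / \<nu> u * (\<Sum>\<gamma>\<in>\<Gamma>. x \<gamma>)) * (dens (\<Delta> \<eta> - \<delta> u) (endpoint u x \<omega>) * indicator (hit ?I x) \<omega>)) \<partial>M')"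
      by (intro nn_integral_eq_integral[symmetric] integrable_mult_right integrand_inner_integrable[OF good x hit_sets[OF meas]])
         (auto simp: dens_nonneg)
    also have "\<dots> = (\<integral>\<^sup>+\<omega>. ?g x \<omega> \<partial>M')"
    proof (rule nn_integral_cong)
      fix \<omega> assume \<omega>: "\<omega> \<in> space M'"
      have "\<omega> \<in> hit ?I x \<longleftrightarrow> \<omega> \<in> {\<omega>. \<exists>j\<in>R. \<forall>\<gamma>\<in>\<Gamma>. l * B' \<gamma> (real j * (L u / real (Suc m))) \<omega> - l\<^sup>2 * (real j * (L u / real (Suc m))) > x \<gamma>}"
        using \<omega> unfolding hit_def by blast
      then show "ennreal (exp (\<theta> u / \<nu> u * (\<Sum>\<gamma>\<in>\<Gamma>. x \<gamma>)) * (dens (\<Delta> \<eta> - \<delta> u) (endpoint u x \<omega>) * indicator (hit ?I x) \<omega>))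
        = ?g x \<omega>"
        by (cases "\<omega> \<in> hit ?I x") (simp_all add: endpoint_def[abs_def] del: of_nat_Suc)
    qed
    finally show "(\<integral>\<^sup>+\<omega>. ?g x \<omega>
        \<partial>M') = ennreal (integrand u ?I x)" by simp
  qed
  finally have "prob ?A = enn2real (ennreal (prefactor u) * (\<integral>\<^sup>+x. ennreal (integrand u ?I x) \<partial>Leb \<Gamma>))"
    by (simp add: measure_def)
  also have "\<dots> = prefactor u * enn2real (\<integral>\<^sup>+x. ennreal (integrand u ?I x) \<partial>Leb \<Gamma>)"
    using \<nu> by (simp add: enn2real_mult prefactor_def)
  also have "enn2real (\<integral>\<^sup>+x. ennreal (integrand u ?I x) \<partial>Leb \<Gamma>) = (\<integral>x. integrand u ?I x \<partial>Leb \<Gamma>)"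
    by (intro integral_eq_nn_integral[symmetric] integrand_measurable meas AE_I2)
       (auto simp: integrand_def intro!: integral_nonneg_AE mult_nonneg_nonneg dens_nonneg)
  finally show ?thesis .
qed

end

text \<open>
  The coordinates are indexed by \<open>{1..K}\<close>, which the simplifier would otherwise rewrite in terms of
  \<open>Suc 0\<close> in some of the facts only.
\<close>
declare One_nat_def [simp del]

context tree_limit begin

lemma prob_late_exceedance:
  assumes good: "good u"
  defines "A \<equiv> {\<omega>\<in>space M. \<exists>s\<in>{0..\<delta> u}. \<forall>\<gamma>\<in>\<Gamma>. path \<eta> (\<gamma> - 1) (\<Delta> \<eta> - s) \<omega> - c * (T - s) > u}"
  shows "A \<in> events" "prob A = prefactor u * (\<integral>x. integrand u {0..L u} x \<partial>Leb \<Gamma>)"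
proof -
  have \<delta>: "0 < \<delta> u" "\<delta> u < \<Delta> \<eta>" and \<nu>: "\<nu> u > 0" and L: "L u > 0" using good D by (auto simp: good_def)
  define G where "G m = {\<omega>\<in>space M. \<exists>j\<in>{..Suc m}. \<forall>\<gamma>\<in>\<Gamma>.
      path \<eta> (\<gamma> - 1) (\<Delta> \<eta> - real j * (\<delta> u / real (Suc m))) \<omega> - c * (T - real j * (\<delta> u / real (Suc m))) > u}" for m
  have gridD: "real j * (\<delta> u / real (Suc m)) \<in> {0..\<delta> u}" if "j \<in> {..Suc m}" for j m
  proof -
    have "real j * \<delta> u \<le> real (Suc m) * \<delta> u" using that \<delta> by (intro mult_right_mono) auto
    then show ?thesis using \<delta> by (simp add: divide_le_eq mult.commute)
  qed
  have [measurable]: "path \<eta> (\<gamma> - 1) (\<Delta> \<eta> - real j * (\<delta> u / real (Suc m))) \<in> borel_measurable M" if "j \<in> {..Suc m}" for \<gamma> j m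
    using gridD[OF that] \<delta> by (intro path_measurable) auto
  have G1: "G m \<in> events" for m unfolding G_def by measurable
  have G2: "G m \<subseteq> A" for m
  proof
    fix \<omega> assume "\<omega> \<in> G m"
    then obtain j where \<omega>: "\<omega> \<in> space M" and j: "j \<in> {..Suc m}" and "\<forall>\<gamma>\<in>\<Gamma>.
      path \<eta> (\<gamma> - 1) (\<Delta> \<eta> - real j * (\<delta> u / real (Suc m))) \<omega> - c * (T - real j * (\<delta> u / real (Suc m))) > u"
      unfolding G_def by blast
    then show "\<omega> \<in> A" unfolding A_def using gridD[OF j] by blast
  qed
  have G3: "\<forall>\<^sub>F m in sequentially. \<omega> \<in> G m" if "\<omega> \<in> A" for \<omega>
  proof -
    from that obtain s where \<omega>: "\<omega> \<in> space M" and s: "s \<in> {0..\<delta> u}"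
      and ex: "\<forall>\<gamma>\<in>\<Gamma>. path \<eta> (\<gamma> - 1) (\<Delta> \<eta> - s) \<omega> - c * (T - s) > u"
      unfolding A_def by blast
    have cont: "continuous_on {0..\<delta> u} (\<lambda>s. path \<eta> (\<gamma> - 1) (\<Delta> \<eta> - s) \<omega> - c * (T - s))" for \<gamma>
      using \<delta> by (intro continuous_intros continuous_on_compose2[OF path_continuous[OF order_refl \<omega>]]) auto
    have "\<forall>\<^sub>F m in sequentially. \<exists>j\<le>Suc m. \<forall>\<gamma>\<in>\<Gamma>.
      path \<eta> (\<gamma> - 1) (\<Delta> \<eta> - real j * (\<delta> u / real (Suc m))) \<omega> - c * (T - real j * (\<delta> u / real (Suc m))) > u"
      using ex s by (intro eventually_grid_point_exceeds[where x = "\<lambda>_. u" and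
          f = "\<lambda>\<gamma> s. path \<eta> (\<gamma> - 1) (\<Delta> \<eta> - s) \<omega> - c * (T - s)"] finite_atLeastAtMost cont \<delta>) auto
    then show ?thesis
      by eventually_elim (use \<omega> in \<open>auto simp: G_def simp del: of_nat_Suc\<close>)
  qed
  note lim = events_grid_limit[of G A, OF G1 G2 G3]
  show "A \<in> events" by (rule lim(1))
  have meas: "hit_measurable (grid (L u) m)" for m
    using L by (intro hit_countable_pred countable_grid grid_nonneg) auto
  have p: "M'.prob (hit (grid (L u) m) x) \<le> exp (- 2 * (\<Sum>\<gamma>\<in>\<Gamma>. max 0 (x \<gamma>)))" for m x
    by (rule prob_hit_grid_le[OF L])
  have pt: "(\<lambda>m. integrand u (grid (L u) m) x) \<longlonglongrightarrow> integrand u {0..L u} x" if x: "x \<in> space (Leb \<Gamma>)" for x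
    unfolding integrand_def
  proof (intro tendsto_mult tendsto_const integral_dominated_convergence[where w = "\<lambda>_. dens_bound"])
    have [measurable]: "hit (grid (L u) m) x \<in> sets M'" "hit {0..L u} x \<in> sets M'" for m
      by (intro hit_sets meas hit_pred)+
    note [measurable] = dens_endpoint_slice[OF x]
    show "(\<lambda>\<omega>. dens (\<Delta> \<eta> - \<delta> u) (endpoint u x \<omega>) * indicator (hit {0..L u} x) \<omega>) \<in> borel_measurable M'"
      "(\<lambda>\<omega>. dens (\<Delta> \<eta> - \<delta> u) (endpoint u x \<omega>) * indicator (hit (grid (L u) m) x) \<omega>) \<in> borel_measurable M'" for m
      by measurable
    show "AE \<omega> in M'. (\<lambda>m. dens (\<Delta> \<eta> - \<delta> u) (endpoint u x \<omega>) * indicator (hit (grid (L u) m) x) \<omega>)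
       \<longlonglongrightarrow> dens (\<Delta> \<eta> - \<delta> u) (endpoint u x \<omega>) * indicator (hit {0..L u} x) \<omega>"
    proof (intro AE_I2 tendsto_mult tendsto_const)
      fix \<omega>
      show "(\<lambda>m. indicator (hit (grid (L u) m) x) \<omega> :: real) \<longlonglongrightarrow> indicator (hit {0..L u} x) \<omega>"
      proof (cases "\<omega> \<in> hit {0..L u} x")
        case True
        have "\<forall>\<^sub>F m in sequentially. indicator (hit (grid (L u) m) x) \<omega> = (indicator (hit {0..L u} x) \<omega> :: real)"
          using eventually_hit_grid[OF L True] by eventually_elim (simp add: True)
        then show ?thesis by (rule tendsto_eventually)
      next
        case False
        have nh: "\<omega> \<notin> hit (grid (L u) m) x" for m
          using hit_mono[OF grid_subset[OF less_imp_le[OF L], of m], of x] False by blast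
        show ?thesis
          by (simp only: indicator_simps(2)[OF nh] indicator_simps(2)[OF False] tendsto_const)
      qed
    qed
    show "AE \<omega> in M'. norm (dens (\<Delta> \<eta> - \<delta> u) (endpoint u x \<omega>) * indicator (hit (grid (L u) m) x) \<omega>) \<le> dens_bound" for m
      using dens_good_le[OF good] dens_nonneg dens_bound_nonneg by (intro AE_I2) (auto simp: indicator_def)
  qed simp
  have "(\<lambda>m. \<integral>x. integrand u (grid (L u) m) x \<partial>Leb \<Gamma>) \<longlonglongrightarrow> (\<integral>x. integrand u {0..L u} x \<partial>Leb \<Gamma>)"
  proof (rule integral_dominated_convergence[OF integrand_measurable integrand_measurable integrable_majorant])
    show "AE x in Leb \<Gamma>. (\<lambda>m. integrand u (grid (L u) m) x) \<longlonglongrightarrow> integrand u {0..L u} x"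
      using pt by (intro AE_I2)
    show "AE x in Leb \<Gamma>. norm (integrand u (grid (L u) m) x) \<le> dens_bound * (\<Prod>\<gamma>\<in>\<Gamma>. exp (- \<bar>x \<gamma>\<bar> / 2))" for m
      by (intro AE_I2 integrand_bound[OF good _ hit_sets[OF meas] p])
  qed (intro meas hit_pred)+
  then have "(\<lambda>m. prefactor u * (\<integral>x. integrand u (grid (L u) m) x \<partial>Leb \<Gamma>)) \<longlonglongrightarrow> prefactor u * (\<integral>x. integrand u {0..L u} x \<partial>Leb \<Gamma>)"
    by (intro tendsto_mult tendsto_const)
  moreover have "prob (G m) = prefactor u * (\<integral>x. integrand u (grid (L u) m) x \<partial>Leb \<Gamma>)" for m
    unfolding G_def grid_def by (rule prob_grid_exceedance[OF good order_refl])
  ultimately have "(\<lambda>m. prob (G m)) \<longlonglongrightarrow> prefactor u * (\<integral>x. integrand u {0..L u} x \<partial>Leb \<Gamma>)"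
    by simp
  with lim(2) show "prob A = prefactor u * (\<integral>x. integrand u {0..L u} x \<partial>Leb \<Gamma>)"
    by (rule LIMSEQ_unique)
qed

lemma prob_final_exceedance:
  assumes good: "good u"
  shows "prob {\<omega>\<in>space M. \<forall>\<gamma>\<in>\<Gamma>. path \<eta> (\<gamma> - 1) (\<Delta> \<eta>) \<omega> - c * T > u}
    = prefactor u * (\<integral>x. integrand u {0} x \<partial>Leb \<Gamma>)"
  using prob_grid_exceedance[OF good, of "{0}" 0] by simp

text \<open>
  The endpoint contains \<open>B'\<close> at the time \<open>L u\<close>, which tends to infinity, so its pointwise convergence is not evident.  But its law is
  that of \<open>sqrt (\<delta> u)\<close> times \<open>B'\<close> at time \<open>1\<close>, up to the shift \<open>- x / \<nu> u\<close>, and this representation converges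
  pointwise to \<open>0\<close>.
\<close>
lemma dens_endpoint_L1_tendsto:
  assumes x: "x \<in> space (Leb \<Gamma>)"
  shows "((\<lambda>u. \<integral>\<omega>. \<bar>dens (\<Delta> \<eta> - \<delta> u) (endpoint u x \<omega>) - dens (\<Delta> \<eta>) (\<lambda>_. 0)\<bar> \<partial>M') \<longlongrightarrow> 0) at_top"
proof -
  define p0 where "p0 = dens (\<Delta> \<eta>) (\<lambda>_. 0)"
  define f where "f u z = \<bar>dens (\<Delta> \<eta> - \<delta> u) (\<lambda>\<gamma>. - x \<gamma> / \<nu> u + z \<gamma>) - p0\<bar>" for u and z :: "nat \<Rightarrow> real"
  have [measurable]: "(\<lambda>z. dens h (\<lambda>\<gamma>. - x \<gamma> / \<nu> u + z \<gamma>)) \<in> borel_measurable (PiM \<Gamma> (\<lambda>_. borel))" for h u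
    by (rule dens_measurable) measurable
  have fm[measurable]: "f u \<in> borel_measurable (PiM \<Gamma> (\<lambda>_. borel))" for u
    unfolding f_def by measurable
  have nn: "0 \<le> f u z" for u z by (simp add: f_def)
  have f_cong: "f u z = f u (\<lambda>\<gamma>\<in>\<Gamma>. z \<gamma>)" for u z
    unfolding f_def by (intro arg_cong[where f = abs] arg_cong2[where f = "(-)"] dens_cong refl) auto
  have B1[measurable]: "B' \<gamma> 1 \<in> borel_measurable M'" if "\<gamma> \<in> \<Gamma>" for \<gamma>
    using that by (intro B'_measurable) auto
  have BL[measurable]: "B' \<gamma> (L u) \<in> borel_measurable M'" if "\<gamma> \<in> \<Gamma>" for \<gamma> u
    using that by (intro B'_measurable) (simp_all add: L_def \<delta>_def)
  have fB1[measurable]: "(\<lambda>\<omega>. f u (\<lambda>\<gamma>. sqrt (\<delta> u) * B' \<gamma> 1 \<omega>)) \<in> borel_measurable M'" for u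
    unfolding f_def by (intro borel_measurable_abs borel_measurable_diff borel_measurable_const dens_measurable) measurable
  have law: "(\<integral>\<omega>. \<bar>dens (\<Delta> \<eta> - \<delta> u) (endpoint u x \<omega>) - p0\<bar> \<partial>M') = (\<integral>\<omega>. f u (\<lambda>\<gamma>. sqrt (\<delta> u) * B' \<gamma> 1 \<omega>) \<partial>M')" if good: "good u" for u
  proof -
    have \<delta>: "0 < \<delta> u" and \<nu>: "\<nu> u > 0" and L: "L u > 0" using good by (auto simp: good_def)
    have s: "l / \<nu> u * sqrt (L u) = sqrt (\<delta> u)"
      using \<nu> l \<delta> by (simp add: L_def real_sqrt_divide real_sqrt_mult)
    have fBL[measurable]: "(\<lambda>\<omega>. f u (\<lambda>\<gamma>. l / \<nu> u * B' \<gamma> (L u) \<omega>)) \<in> borel_measurable M'"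
      unfolding f_def by (intro borel_measurable_abs borel_measurable_diff borel_measurable_const dens_measurable) measurable
    have fe: "(\<lambda>z. ennreal (f u z)) \<in> borel_measurable (PiM \<Gamma> (\<lambda>_. borel))" by measurable
    have "(\<integral>\<^sup>+\<omega>. ennreal (f u (\<lambda>\<gamma>. l / \<nu> u * B' \<gamma> (L u) \<omega>)) \<partial>M') = (\<integral>\<^sup>+z. ennreal (f u z) \<partial>PiM \<Gamma> (\<lambda>_. gauss (l / \<nu> u * sqrt (L u))))"
      using nn_integral_scaled_marginal[OF _ L fe, of "l / \<nu> u"] l \<nu> f_cong[of u "\<lambda>\<gamma>. l / \<nu> u * B' \<gamma> (L u) _"] by simp
    also have "\<dots> = (\<integral>\<^sup>+\<omega>. ennreal (f u (\<lambda>\<gamma>. sqrt (\<delta> u) * B' \<gamma> 1 \<omega>)) \<partial>M')"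
      unfolding s
      using nn_integral_scaled_marginal[OF _ zero_less_one fe, of "sqrt (\<delta> u)"] \<delta> f_cong[of u "\<lambda>\<gamma>. sqrt (\<delta> u) * B' \<gamma> 1 _"] by simp
    finally have "(\<integral>\<omega>. f u (\<lambda>\<gamma>. l / \<nu> u * B' \<gamma> (L u) \<omega>) \<partial>M') = (\<integral>\<omega>. f u (\<lambda>\<gamma>. sqrt (\<delta> u) * B' \<gamma> 1 \<omega>) \<partial>M')"
      using integral_eq_nn_integral[OF fBL AE_I2[OF nn]] integral_eq_nn_integral[OF fB1 AE_I2[OF nn]] by metis
    then show ?thesis by (simp add: f_def endpoint_def[abs_def])
  qed
  have "((\<lambda>u. \<integral>\<omega>. f u (\<lambda>\<gamma>. sqrt (\<delta> u) * B' \<gamma> 1 \<omega>) \<partial>M') \<longlongrightarrow> (\<integral>\<omega>. 0 \<partial>M')) at_top"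
  proof (rule integral_dominated_convergence_at_top[where w = "\<lambda>_. dens_bound + p0"])
    have "((\<lambda>u. - x \<gamma> / \<nu> u + sqrt (\<delta> u) * B' \<gamma> 1 \<omega>) \<longlongrightarrow> 0) at_top" for \<gamma> \<omega>
    proof -
      have 1: "((\<lambda>u. - x \<gamma> / \<nu> u) \<longlongrightarrow> 0) at_top"
        by (rule tendsto_divide_0[OF tendsto_const filterlim_at_top_imp_at_infinity[OF \<nu>_at_top]])
      have 2: "((\<lambda>u. sqrt (\<delta> u) * B' \<gamma> 1 \<omega>) \<longlongrightarrow> sqrt 0 * B' \<gamma> 1 \<omega>) at_top"
        by (intro tendsto_intros \<delta>_tendsto)
      from tendsto_add[OF 1 2] show ?thesis by simp
    qed
    moreover have "((\<lambda>u. \<Delta> \<eta> - \<delta> u) \<longlongrightarrow> \<Delta> \<eta> - 0) at_top"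
      by (intro tendsto_intros \<delta>_tendsto)
    ultimately have "((\<lambda>u. dens (\<Delta> \<eta> - \<delta> u) (\<lambda>\<gamma>. - x \<gamma> / \<nu> u + sqrt (\<delta> u) * B' \<gamma> 1 \<omega>)) \<longlongrightarrow> p0) at_top" for \<omega>
      unfolding p0_def by (intro dens_tendsto) auto
    then show "AE \<omega> in M'. ((\<lambda>u. f u (\<lambda>\<gamma>. sqrt (\<delta> u) * B' \<gamma> 1 \<omega>)) \<longlongrightarrow> 0) at_top"
      unfolding f_def by (intro AE_I2 tendsto_rabs_zero LIM_zero)
    show "\<forall>\<^sub>F u in at_top. AE \<omega> in M'. norm (f u (\<lambda>\<gamma>. sqrt (\<delta> u) * B' \<gamma> 1 \<omega>)) \<le> dens_bound + p0"
      using eventually_good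
    proof eventually_elim
      case (elim u)
      have "\<bar>a - p0\<bar> \<le> dens_bound + p0" if "0 \<le> a" "a \<le> dens_bound" for a
        using that dens_nonneg[of "\<Delta> \<eta>" "\<lambda>_. 0"] dens_bound_nonneg by (auto simp: p0_def)
      then show ?case
        using dens_good_le[OF elim] dens_nonneg by (intro AE_I2) (simp add: f_def)
    qed
  qed (use fB1 in auto)
  then have "((\<lambda>u. \<integral>\<omega>. f u (\<lambda>\<gamma>. sqrt (\<delta> u) * B' \<gamma> 1 \<omega>) \<partial>M') \<longlongrightarrow> 0) at_top" by simp
  moreover have "\<forall>\<^sub>F u in at_top. (\<integral>\<omega>. f u (\<lambda>\<gamma>. sqrt (\<delta> u) * B' \<gamma> 1 \<omega>) \<partial>M') = (\<integral>\<omega>. \<bar>dens (\<Delta> \<eta> - \<delta> u) (endpoint u x \<omega>) - p0\<bar> \<partial>M')"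
    using eventually_good by eventually_elim (simp add: law)
  ultimately show ?thesis
    unfolding p0_def[symmetric] by (rule Lim_transform_eventually)
qed

text \<open>
  For fixed \<open>x\<close> the density can be replaced by its limit by \<open>dens_endpoint_L1_tendsto\<close>; the
  integrals over \<open>x\<close> then converge by domination.  The sets \<open>I u\<close> are \<open>{0..L u}\<close> for the exceedance
  probability and \<open>{0}\<close> for its value at the final time.
\<close>
lemma integral_integrand_tendsto:
  assumes I: "\<And>u. hit_measurable (I u)" and J: "hit_measurable J"
    and p: "\<And>u x. good u \<Longrightarrow> M'.prob (hit (I u) x) \<le> exp (- 2 * (\<Sum>\<gamma>\<in>\<Gamma>. max 0 (x \<gamma>)))"
    and lim: "\<And>x. ((\<lambda>u. M'.prob (hit (I u) x)) \<longlongrightarrow> M'.prob (hit J x)) at_top"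
  shows "((\<lambda>u. \<integral>x. integrand u (I u) x \<partial>Leb \<Gamma>) \<longlongrightarrow>
      dens (\<Delta> \<eta>) (\<lambda>_. 0) * (\<integral>x. exp (\<Sum>\<gamma>\<in>\<Gamma>. x \<gamma>) * M'.prob (hit J x) \<partial>Leb \<Gamma>)) at_top"
    and "integrable (Leb \<Gamma>) (\<lambda>x. exp (\<Sum>\<gamma>\<in>\<Gamma>. x \<gamma>) * M'.prob (hit J x))"
proof -
  define p0 where "p0 = dens (\<Delta> \<eta>) (\<lambda>_. 0)"
  have p0: "p0 > 0" unfolding p0_def by (rule dens_pos[OF D])
  have pt: "((\<lambda>u. integrand u (I u) x) \<longlongrightarrow> p0 * (exp (\<Sum>\<gamma>\<in>\<Gamma>. x \<gamma>) * M'.prob (hit J x))) at_top"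
    if x: "x \<in> space (Leb \<Gamma>)" for x
  proof -
    have [measurable]: "hit (I u) x \<in> sets M'" for u by (intro hit_sets I)
    note [measurable] = dens_endpoint_slice[OF x]
    define a where "a u = (\<integral>\<omega>. dens (\<Delta> \<eta> - \<delta> u) (endpoint u x \<omega>) * indicator (hit (I u) x) \<omega> \<partial>M')" for u
    have bnd: "\<bar>a u - p0 * M'.prob (hit (I u) x)\<bar> \<le> (\<integral>\<omega>. \<bar>dens (\<Delta> \<eta> - \<delta> u) (endpoint u x \<omega>) - p0\<bar> \<partial>M')" if good: "good u" for u
    proof -
      have i1: "integrable M' (\<lambda>\<omega>. dens (\<Delta> \<eta> - \<delta> u) (endpoint u x \<omega>) * indicator (hit (I u) x) \<omega>)"
        by (rule integrand_inner_integrable[OF good x hit_sets[OF I]])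
      have i2: "integrable M' (\<lambda>\<omega>. p0 * indicator (hit (I u) x) \<omega>)"
        by (intro integrable_mult_right M'.integrable_const_bound[where B = 1]) auto
      have "integrable M' (\<lambda>\<omega>. dens (\<Delta> \<eta> - \<delta> u) (endpoint u x \<omega>))"
        by (rule M'.integrable_const_bound[where B = dens_bound]) (use dens_good_le[OF good] dens_nonneg in auto)
      then have i3: "integrable M' (\<lambda>\<omega>. \<bar>dens (\<Delta> \<eta> - \<delta> u) (endpoint u x \<omega>) - p0\<bar>)"
        by (intro integrable_abs Bochner_Integration.integrable_diff) auto
      have eq: "a u - p0 * M'.prob (hit (I u) x)
        = (\<integral>\<omega>. dens (\<Delta> \<eta> - \<delta> u) (endpoint u x \<omega>) * indicator (hit (I u) x) \<omega> - p0 * indicator (hit (I u) x) \<omega> \<partial>M')"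
        unfolding a_def using i1 i2 hit_space[of "I u" x] by (simp add: Int_absorb2)
      have "\<bar>a u - p0 * M'.prob (hit (I u) x)\<bar> \<le> (\<integral>\<omega>. \<bar>dens (\<Delta> \<eta> - \<delta> u) (endpoint u x \<omega>) * indicator (hit (I u) x) \<omega> - p0 * indicator (hit (I u) x) \<omega>\<bar> \<partial>M')"
        unfolding eq by (rule integral_abs_bound)
      also have "\<dots> \<le> (\<integral>\<omega>. \<bar>dens (\<Delta> \<eta> - \<delta> u) (endpoint u x \<omega>) - p0\<bar> \<partial>M')"
        by (intro integral_mono i3 integrable_abs Bochner_Integration.integrable_diff i1 i2) (auto simp: indicator_def)
      finally show ?thesis .
    qed
    have "((\<lambda>u. a u - p0 * M'.prob (hit (I u) x)) \<longlongrightarrow> 0) at_top"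
    proof (rule Lim_null_comparison)
      show "\<forall>\<^sub>F u in at_top. norm (a u - p0 * M'.prob (hit (I u) x)) \<le> (\<integral>\<omega>. \<bar>dens (\<Delta> \<eta> - \<delta> u) (endpoint u x \<omega>) - p0\<bar> \<partial>M')"
        using eventually_good by eventually_elim (use bnd in simp)
      show "((\<lambda>u. \<integral>\<omega>. \<bar>dens (\<Delta> \<eta> - \<delta> u) (endpoint u x \<omega>) - p0\<bar> \<partial>M') \<longlongrightarrow> 0) at_top"
        unfolding p0_def by (rule dens_endpoint_L1_tendsto[OF x])
    qed
    from tendsto_add[OF this tendsto_mult[OF tendsto_const lim[of x], of p0]]
    have "(a \<longlongrightarrow> p0 * M'.prob (hit J x)) at_top" by simp
    moreover have "((\<lambda>u. exp (\<theta> u / \<nu> u * (\<Sum>\<gamma>\<in>\<Gamma>. x \<gamma>))) \<longlongrightarrow> exp (1 * (\<Sum>\<gamma>\<in>\<Gamma>. x \<gamma>))) at_top"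
      by (intro tendsto_intros \<theta>_\<nu>_tendsto)
    ultimately have "((\<lambda>u. exp (\<theta> u / \<nu> u * (\<Sum>\<gamma>\<in>\<Gamma>. x \<gamma>)) * a u) \<longlongrightarrow> exp (1 * (\<Sum>\<gamma>\<in>\<Gamma>. x \<gamma>)) * (p0 * M'.prob (hit J x))) at_top"
      by (rule tendsto_mult[rotated])
    then show ?thesis
      unfolding integrand_def a_def by (simp add: mult.left_commute)
  qed
  have [measurable]: "(\<lambda>x. M'.prob (hit J x)) \<in> borel_measurable (Leb \<Gamma>)"
  proof -
    have "(\<lambda>x. \<integral>\<omega>. (indicator (hit J x) \<omega> :: real) \<partial>M') \<in> borel_measurable (Leb \<Gamma>)"
      using indicator_hit_measurable[OF J] by (intro M'.borel_measurable_lebesgue_integral) (simp add: split_beta')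
    then show ?thesis using hit_space[of J] by (simp add: Int_absorb2)
  qed
  have m: "(\<lambda>x. p0 * (exp (\<Sum>\<gamma>\<in>\<Gamma>. x \<gamma>) * M'.prob (hit J x))) \<in> borel_measurable (Leb \<Gamma>)"
    by measurable
  have bound: "\<forall>\<^sub>F u in at_top. AE x in Leb \<Gamma>. norm (integrand u (I u) x) \<le> dens_bound * (\<Prod>\<gamma>\<in>\<Gamma>. exp (- \<bar>x \<gamma>\<bar> / 2))"
    using eventually_good
  proof eventually_elim
    case (elim u)
    show ?case by (intro AE_I2 integrand_bound[OF elim _ hit_sets[OF I] p[OF elim]])
  qed
  have ptAE: "AE x in Leb \<Gamma>. ((\<lambda>u. integrand u (I u) x) \<longlongrightarrow> p0 * (exp (\<Sum>\<gamma>\<in>\<Gamma>. x \<gamma>) * M'.prob (hit J x))) at_top"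
    using pt by (intro AE_I2)
  have "((\<lambda>u. \<integral>x. integrand u (I u) x \<partial>Leb \<Gamma>) \<longlongrightarrow> (\<integral>x. p0 * (exp (\<Sum>\<gamma>\<in>\<Gamma>. x \<gamma>) * M'.prob (hit J x)) \<partial>Leb \<Gamma>)) at_top"
    by (rule integral_dominated_convergence_at_top[OF m integrand_measurable[OF I] integrable_majorant ptAE bound])
  then show "((\<lambda>u. \<integral>x. integrand u (I u) x \<partial>Leb \<Gamma>) \<longlongrightarrow>
      dens (\<Delta> \<eta>) (\<lambda>_. 0) * (\<integral>x. exp (\<Sum>\<gamma>\<in>\<Gamma>. x \<gamma>) * M'.prob (hit J x) \<partial>Leb \<Gamma>)) at_top"
    by (simp add: p0_def)
  have "integrable (Leb \<Gamma>) (\<lambda>x. p0 * (exp (\<Sum>\<gamma>\<in>\<Gamma>. x \<gamma>) * M'.prob (hit J x)))"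
    by (rule integrable_dominated_convergence_at_top[OF m integrand_measurable[OF I] integrable_majorant ptAE bound])
  then show "integrable (Leb \<Gamma>) (\<lambda>x. exp (\<Sum>\<gamma>\<in>\<Gamma>. x \<gamma>) * M'.prob (hit J x))"
    using p0 by simp
qed

end

text \<open>
  The two exponents arise from lowering the variance by a multiple of \<open>1 / sqrt u\<close> and by a constant.
\<close>
lemma subgaussian_decay:
  fixes l g e \<alpha> \<beta> :: real
  assumes "l > 0" "g > 0"
  shows "((\<lambda>u. (l * u + e) ^ k * exp (\<alpha> * u + \<beta> - g * (u\<^sup>2 / sqrt \<bar>u\<bar>))) \<longlongrightarrow> 0) at_top"
    and "((\<lambda>u. (l * u + e) ^ k * exp (\<alpha> * u + \<beta> - g * u\<^sup>2)) \<longlongrightarrow> 0) at_top"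
  using assms by real_asymp+

context tree_limit begin

definition H :: real where
  "H = (\<integral>x. exp (\<Sum>\<gamma>\<in>\<Gamma>. x \<gamma>) * M'.prob (hit {0..} x) \<partial>Leb \<Gamma>)"

definition p0 :: real where "p0 = dens (\<Delta> \<eta>) (\<lambda>_. 0)"

lemma p0_pos: "p0 > 0"
  unfolding p0_def by (rule dens_pos[OF D])

lemma H_eq: "\<H> M' B' K l = H"
proof -
  have "{\<omega>\<in>space M'. \<exists>t>0. \<forall>i\<in>{1..K}. l * B' i t \<omega> - l\<^sup>2 * t > x i} = hit {0..} x" for x
    unfolding hit_positive_times[symmetric] by (auto simp: hit_def)
  then show ?thesis
    unfolding \<H>_def H_def by (simp add: mult.commute)
qed

lemma prefactor_pos: "good u \<Longrightarrow> prefactor u > 0"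
  by (simp add: prefactor_def good_def)

lemma hit_0_le:
  "M'.prob (hit {0} x) \<le> exp (- 2 * (\<Sum>\<gamma>\<in>\<Gamma>. max 0 (x \<gamma>)))"
proof (cases "\<forall>\<gamma>\<in>\<Gamma>. x \<gamma> < 0")
  case True
  then have "(\<Sum>\<gamma>\<in>\<Gamma>. max 0 (x \<gamma>)) = 0"
    by (intro sum.neutral) (auto simp: max_def not_le)
  then show ?thesis by simp
next
  case False
  then have "hit {0} x = {}" by (simp only: hit_0 if_False)
  then show ?thesis by simp
qed

lemma hit_0_integral: "(\<integral>x. exp (\<Sum>\<gamma>\<in>\<Gamma>. x \<gamma>) * M'.prob (hit {0} x) \<partial>Leb \<Gamma>) = 1"
proof -
  interpret product_sigma_finite "\<lambda>_::nat. lborel :: real measure" by standard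
  have "exp (\<Sum>\<gamma>\<in>\<Gamma>. x \<gamma>) * M'.prob (hit {0} x) = (\<Prod>\<gamma>\<in>\<Gamma>. exp (x \<gamma>) * indicator {..<0} (x \<gamma>))" for x :: "nat \<Rightarrow> real"
  proof (cases "\<forall>\<gamma>\<in>\<Gamma>. x \<gamma> < 0")
    case True
    then show ?thesis by (simp add: hit_0 M'.prob_space exp_sum)
  next
    case False
    then obtain \<gamma> where "\<gamma> \<in> \<Gamma>" "\<not> x \<gamma> < 0" by blast
    then have "(\<Prod>\<gamma>\<in>\<Gamma>. exp (x \<gamma>) * indicator {..<0} (x \<gamma>)) = 0"
      by (intro prod_zero bexI[of _ \<gamma>]) auto
    moreover have "hit {0} x = {}" using False by (simp only: hit_0 if_False)
    ultimately show ?thesis by simp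
  qed
  then have "(\<integral>x. exp (\<Sum>\<gamma>\<in>\<Gamma>. x \<gamma>) * M'.prob (hit {0} x) \<partial>Leb \<Gamma>)
    = (\<integral>x. (\<Prod>\<gamma>\<in>\<Gamma>. exp (x \<gamma>) * indicator {..<0} (x \<gamma>)) \<partial>Leb \<Gamma>)" by simp
  also have "\<dots> = (\<Prod>\<gamma>\<in>\<Gamma>. \<integral>x. exp x * indicator {..<0} x \<partial>lborel)"
    by (rule product_integral_prod) (auto intro: integral_exp_negative(1))
  finally show ?thesis by (simp add: integral_exp_negative(2))
qed

lemma hit_0_measurable: "hit_measurable {0}"
  by (rule hit_countable_pred) auto

lemma late_measurable: "hit_measurable {0..L u}" "hit_measurable {0..}"
  by (rule hit_pred)+

lemma late_tendsto: "((\<lambda>u. \<integral>x. integrand u {0..L u} x \<partial>Leb \<Gamma>) \<longlongrightarrow> p0 * H) at_top"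
  and H_integrable: "integrable (Leb \<Gamma>) (\<lambda>x. exp (\<Sum>\<gamma>\<in>\<Gamma>. x \<gamma>) * M'.prob (hit {0..} x))"
proof -
  have p: "M'.prob (hit {0..L u} x) \<le> exp (- 2 * (\<Sum>\<gamma>\<in>\<Gamma>. max 0 (x \<gamma>)))" if "good u" for u x
    using that by (intro prob_hit_le) (simp add: good_def)
  show "((\<lambda>u. \<integral>x. integrand u {0..L u} x \<partial>Leb \<Gamma>) \<longlongrightarrow> p0 * H) at_top"
    unfolding p0_def H_def
    by (rule integral_integrand_tendsto(1)[OF late_measurable p prob_hit_tendsto[OF L_at_top]])
  show "integrable (Leb \<Gamma>) (\<lambda>x. exp (\<Sum>\<gamma>\<in>\<Gamma>. x \<gamma>) * M'.prob (hit {0..} x))"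
    by (rule integral_integrand_tendsto(2)[OF late_measurable p prob_hit_tendsto[OF L_at_top]])
qed

lemma final_tendsto: "((\<lambda>u. \<integral>x. integrand u {0} x \<partial>Leb \<Gamma>) \<longlongrightarrow> p0) at_top"
  and hit_0_integrable: "integrable (Leb \<Gamma>) (\<lambda>x. exp (\<Sum>\<gamma>\<in>\<Gamma>. x \<gamma>) * M'.prob (hit {0} x))"
proof -
  show "((\<lambda>u. \<integral>x. integrand u {0} x \<partial>Leb \<Gamma>) \<longlongrightarrow> p0) at_top"
    using integral_integrand_tendsto(1)[OF hit_0_measurable hit_0_measurable hit_0_le tendsto_const]
    by (simp add: p0_def hit_0_integral)
  show "integrable (Leb \<Gamma>) (\<lambda>x. exp (\<Sum>\<gamma>\<in>\<Gamma>. x \<gamma>) * M'.prob (hit {0} x))"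
    by (rule integral_integrand_tendsto(2)[OF hit_0_measurable hit_0_measurable hit_0_le tendsto_const])
qed

text \<open>
  The event contains the one in which all \<open>x \<gamma>\<close> are negative, where the levels are exceeded at time \<open>0\<close>.
\<close>
lemma H_ge_1: "H \<ge> 1"
proof -
  have "(\<integral>x. exp (\<Sum>\<gamma>\<in>\<Gamma>. x \<gamma>) * M'.prob (hit {0} x) \<partial>Leb \<Gamma>) \<le> H"
    unfolding H_def
    by (intro integral_mono hit_0_integrable H_integrable mult_left_mono M'.finite_measure_mono
        hit_mono hit_sets late_measurable(2)) auto
  then show ?thesis by (simp add: hit_0_integral)
qed

lemma v_eq: "v = 1 / (real K * l)"
proof -
  have "real K * v = rowsum (\<Delta> \<eta>)"
  proof -
    have "v = (\<Sum>i<\<eta>. \<Delta> i / real (P i)) + \<Delta> \<eta> / real K"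
      by (simp add: v_def lessThan_Suc_atMost[symmetric])
    moreover have "real K * (\<Sum>i<\<eta>. \<Delta> i / real (P i)) = (\<Sum>i<\<eta>. \<Delta> i * real K / real (P i))"
      unfolding sum_distrib_left by (intro sum.cong refl) (simp only: times_divide_eq_right mult.commute)
    moreover have "real K * (d / real K) = d" for d :: real using K by simp
    ultimately show ?thesis
      by (simp only: rowsum_def distrib_left add.commute)
  qed
  moreover have "l * rowsum (\<Delta> \<eta>) = 1" using l l_eq by (auto simp: divide_simps split: if_splits)
  ultimately have "v * (real K * l) = 1" by (simp add: algebra_simps)
  then show ?thesis using K l by (simp add: field_simps)
qed

lemma inverse_prefactor:
  "1 / prefactor u = (l * u + (l * c * T - c)) ^ K * exp (real K * l * (u + c * T)\<^sup>2 / 2)"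
proof -
  have "(\<theta> u)\<^sup>2 * rowsum (\<Delta> \<eta>) = \<theta> u * (\<theta> u * rowsum (\<Delta> \<eta>))" by (simp add: power2_eq_square)
  also have "\<dots> = l * (u + c * T)\<^sup>2"
    unfolding \<theta>_rowsum by (simp add: \<theta>_def power2_eq_square)
  finally have A: "- real K * (\<theta> u)\<^sup>2 * rowsum (\<Delta> \<eta>) / 2 = - (real K * l * (u + c * T)\<^sup>2 / 2)"
    by (simp add: mult.assoc)
  have B: "\<nu> u = l * u + (l * c * T - c)"
    by (simp add: \<nu>_def \<theta>_def algebra_simps)
  have C: "1 / (exp (- E) / N ^ K) = N ^ K * exp E" for E N :: real
    by (simp add: exp_minus field_simps)
  show ?thesis
    unfolding prefactor_def A C B[symmetric] ..
qed

text \<open>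
  For the parameter \<open>K * l * u\<close>, which is optimal to leading order, the terms with \<open>u\<^sup>2\<close> in the tail bound and in
  the inverse of the prefactor cancel except for the one that contains the decrease \<open>\<rho>\<close> of the variance.
\<close>
lemma exponent_eq:
  "exp (- (real K * l * u) * (u - b) + (real K * l * u)\<^sup>2 * (v - \<rho>) / 2) * exp (real K * l * (u + c * T)\<^sup>2 / 2)
   = exp ((real K * l * b + real K * l * c * T) * u + real K * l * (c * T)\<^sup>2 / 2 - (real K * l)\<^sup>2 / 2 * (u\<^sup>2 * \<rho>))"
proof -
  have "(real K * l)\<^sup>2 * v = real K * l"
    using K l by (simp add: v_eq power2_eq_square)
  then have 1: "(real K * l * u)\<^sup>2 * (v - \<rho>) = real K * l * u\<^sup>2 - (real K * l)\<^sup>2 * (u\<^sup>2 * \<rho>)"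
    by (simp add: power_mult_distrib right_diff_distrib)
  have "- (real K * l * u) * (u - b) + (real K * l * u)\<^sup>2 * (v - \<rho>) / 2 + real K * l * (u + c * T)\<^sup>2 / 2
    = (real K * l * b + real K * l * c * T) * u + real K * l * (c * T)\<^sup>2 / 2 - (real K * l)\<^sup>2 / 2 * (u\<^sup>2 * \<rho>)"
    unfolding 1 by (simp add: power2_eq_square field_simps)
  then show ?thesis unfolding exp_add[symmetric] by (rule arg_cong)
qed

lemma early_bound_negligible:
  "((\<lambda>u. exp (- (real K * l * u) * (u - b) + (real K * l * u)\<^sup>2 * (v - \<delta> u / real K) / 2) / prefactor u) \<longlongrightarrow> 0) at_top"
proof -
  have "((\<lambda>u. (l * u + (l * c * T - c)) ^ K * exp ((real K * l * b + real K * l * c * T) * u + real K * l * (c * T)\<^sup>2 / 2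
      - ((real K * l)\<^sup>2 / 2 / real K) * (u\<^sup>2 / sqrt \<bar>u\<bar>))) \<longlongrightarrow> 0) at_top"
    using K l by (intro subgaussian_decay) auto
  moreover have "\<forall>\<^sub>F u in at_top. (l * u + (l * c * T - c)) ^ K * exp ((real K * l * b + real K * l * c * T) * u + real K * l * (c * T)\<^sup>2 / 2
      - ((real K * l)\<^sup>2 / 2 / real K) * (u\<^sup>2 / sqrt \<bar>u\<bar>))
    = exp (- (real K * l * u) * (u - b) + (real K * l * u)\<^sup>2 * (v - \<delta> u / real K) / 2) / prefactor u"
    using eventually_good
  proof eventually_elim
    case (elim u)
    have \<rho>: "(real K * l)\<^sup>2 / 2 / real K * (u\<^sup>2 / sqrt \<bar>u\<bar>) = (real K * l)\<^sup>2 / 2 * (u\<^sup>2 * (\<delta> u / real K))"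
      by (simp add: \<delta>_def)
    have "x / prefactor u = x * (1 / prefactor u)" for x by simp
    then show ?case
      unfolding \<rho> exponent_eq[symmetric] by (simp only: inverse_prefactor mult_ac)
  qed
  ultimately show ?thesis by (rule Lim_transform_eventually)
qed

lemma smaller_variance_negligible:
  assumes "\<epsilon> > 0"
  shows "((\<lambda>u. exp (- (real K * l * u) * (u - b) + (real K * l * u)\<^sup>2 * (v - \<epsilon>) / 2) / prefactor u) \<longlongrightarrow> 0) at_top"
proof -
  have "((\<lambda>u. (l * u + (l * c * T - c)) ^ K * exp ((real K * l * b + real K * l * c * T) * u + real K * l * (c * T)\<^sup>2 / 2
      - ((real K * l)\<^sup>2 / 2 * \<epsilon>) * u\<^sup>2)) \<longlongrightarrow> 0) at_top"
    using K l assms by (intro subgaussian_decay) auto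
  moreover have "\<forall>\<^sub>F u in at_top. (l * u + (l * c * T - c)) ^ K * exp ((real K * l * b + real K * l * c * T) * u + real K * l * (c * T)\<^sup>2 / 2
      - ((real K * l)\<^sup>2 / 2 * \<epsilon>) * u\<^sup>2)
    = exp (- (real K * l * u) * (u - b) + (real K * l * u)\<^sup>2 * (v - \<epsilon>) / 2) / prefactor u"
    using eventually_good
  proof eventually_elim
    case (elim u)
    have \<rho>: "(real K * l)\<^sup>2 / 2 * \<epsilon> * u\<^sup>2 = (real K * l)\<^sup>2 / 2 * (u\<^sup>2 * \<epsilon>)" by simp
    have "x / prefactor u = x * (1 / prefactor u)" for x by simp
    then show ?case
      unfolding \<rho> exponent_eq[symmetric] by (simp only: inverse_prefactor mult_ac)
  qed
  ultimately show ?thesis by (rule Lim_transform_eventually)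
qed

definition exceed :: "real \<Rightarrow> 'a set" where
  "exceed u = {\<omega>\<in>space M. \<exists>t\<in>{0..T}. \<forall>\<gamma><K. tree_branch \<omega> \<gamma> t - c * t > u}"

definition exceed_final :: "real \<Rightarrow> 'a set" where
  "exceed_final u = {\<omega>\<in>space M. \<forall>\<gamma><K. tree_branch \<omega> \<gamma> T - c * T > u}"

lemma all_\<Gamma>: "(\<forall>\<gamma>\<in>\<Gamma>. Q (\<gamma> - 1)) \<longleftrightarrow> (\<forall>\<gamma><K. Q \<gamma>)" for Q :: "nat \<Rightarrow> bool"
proof
  assume *: "\<forall>\<gamma>\<in>\<Gamma>. Q (\<gamma> - 1)"
  show "\<forall>\<gamma><K. Q \<gamma>"
  proof (intro allI impI)
    fix \<gamma> assume "\<gamma> < K"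
    then show "Q \<gamma>" using *[rule_format, of "Suc \<gamma>"] by simp
  qed
qed auto

lemma exceed_final_eq:
  "exceed_final u = {\<omega>\<in>space M. \<forall>\<gamma>\<in>\<Gamma>. path \<eta> (\<gamma> - 1) (\<Delta> \<eta>) \<omega> - c * T > u}"
  unfolding exceed_final_def all_\<Gamma>[of "\<lambda>\<gamma>. path \<eta> \<gamma> (\<Delta> \<eta>) _ - c * T > u"]
  using branch_eq[of _ \<eta> T] D by auto

lemma exceed_final_events: "exceed_final u \<in> events"
proof -
  have [measurable]: "path \<eta> (\<gamma> - 1) (\<Delta> \<eta>) \<in> borel_measurable M" for \<gamma>
    using D by (intro path_measurable) auto
  show ?thesis unfolding exceed_final_eq by measurable
qed

lemma exceed_events: "exceed u \<in> events"
  using early_exceedance_bound(1)[where \<delta> = 0 and \<theta> = 0 and u = u and c = c] D by (simp add: exceed_def)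

lemma exceed_final_tendsto: "((\<lambda>u. prob (exceed_final u) / prefactor u) \<longlongrightarrow> p0) at_top"
proof (rule Lim_transform_eventually[OF final_tendsto])
  show "\<forall>\<^sub>F u in at_top. (\<integral>x. integrand u {0} x \<partial>Leb \<Gamma>) = prob (exceed_final u) / prefactor u"
    using eventually_good
  proof eventually_elim
    case (elim u)
    show ?case
      unfolding exceed_final_eq prob_final_exceedance[OF elim] using prefactor_pos[OF elim] by simp
  qed
qed

lemma exceed_tendsto: "((\<lambda>u. prob (exceed u) / prefactor u) \<longlongrightarrow> p0 * H) at_top"
proof -
  define late where "late u = {\<omega>\<in>space M. \<exists>s\<in>{0..\<delta> u}. \<forall>\<gamma>\<in>\<Gamma>. path \<eta> (\<gamma> - 1) (\<Delta> \<eta> - s) \<omega> - c * (T - s) > u}" for u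
  define early where "early u = {\<omega>\<in>space M. \<exists>t\<in>{0..T - \<delta> u}. \<forall>\<gamma><K. tree_branch \<omega> \<gamma> t - c * t > u}" for u
  define eb where "eb u = exp (- (real K * l * u) * (u - \<bar>c\<bar> * T) + (real K * l * u)\<^sup>2 * (v - \<delta> u / real K) / 2)" for u
  have T0: "T - \<Delta> \<eta> \<ge> 0" using \<tau>_mono[of 0 \<eta>] \<tau>0 by simp
  have late_eq: "late u = {\<omega>\<in>space M. \<exists>t\<in>{T - \<delta> u..T}. \<forall>\<gamma><K. tree_branch \<omega> \<gamma> t - c * t > u}" if "good u" for u
  proof -
    have \<delta>: "0 < \<delta> u" "\<delta> u < \<Delta> \<eta>" using that D by (auto simp: good_def)
    have iff: "(\<forall>\<gamma>\<in>\<Gamma>. path \<eta> (\<gamma> - 1) (\<Delta> \<eta> - s) \<omega> - c * (T - s) > u) \<longleftrightarrow> (\<forall>\<gamma><K. tree_branch \<omega> \<gamma> (T - s) - c * (T - s) > u)"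
      if "\<omega> \<in> space M" "s \<in> {0..\<delta> u}" for \<omega> s
    proof -
      have "tree_branch \<omega> \<gamma> (T - s) = path \<eta> \<gamma> (\<Delta> \<eta> - s) \<omega>" for \<gamma>
      proof -
        have "T - s \<in> {\<tau> \<eta>..T}" using that(2) \<delta> by auto
        moreover have "T - s - \<tau> \<eta> = \<Delta> \<eta> - s" by simp
        ultimately show ?thesis using branch_eq[OF that(1) order_refl, of "T - s" \<gamma>] by metis
      qed
      then show ?thesis
        unfolding all_\<Gamma>[of "\<lambda>\<gamma>. path \<eta> \<gamma> (\<Delta> \<eta> - s) \<omega> - c * (T - s) > u"] by simp
    qed
    show ?thesis
    proof safe
      fix \<omega> assume "\<omega> \<in> late u"
      then obtain s where "\<omega> \<in> space M" "s \<in> {0..\<delta> u}" "\<forall>\<gamma>\<in>\<Gamma>. path \<eta> (\<gamma> - 1) (\<Delta> \<eta> - s) \<omega> - c * (T - s) > u"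
        unfolding late_def by blast
      then show "\<omega> \<in> space M" "\<exists>t\<in>{T - \<delta> u..T}. \<forall>\<gamma><K. tree_branch \<omega> \<gamma> t - c * t > u"
        using iff by (auto intro!: bexI[of _ "T - s"])
    next
      fix \<omega> t assume "\<omega> \<in> space M" "t \<in> {T - \<delta> u..T}" "\<forall>\<gamma><K. tree_branch \<omega> \<gamma> t - c * t > u"
      then show "\<omega> \<in> late u"
        unfolding late_def using iff[of \<omega> "T - t"] by (auto intro!: bexI[of _ "T - t"])
    qed
  qed
  have split: "exceed u = early u \<union> late u" if "good u" for u
  proof -
    have \<delta>: "0 < \<delta> u" "\<delta> u < \<Delta> \<eta>" using that D by (auto simp: good_def)
    have "{0..T} = {0..T - \<delta> u} \<union> {T - \<delta> u..T}" using \<delta> T0 by auto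
    then show ?thesis unfolding late_eq[OF that] exceed_def early_def by auto
  qed
  have bounds: "prob (late u) / prefactor u \<le> prob (exceed u) / prefactor u"
    "prob (exceed u) / prefactor u \<le> eb u / prefactor u + prob (late u) / prefactor u" if good: "good u" and u: "u \<ge> 0" for u
  proof -
    have \<delta>: "0 \<le> \<delta> u" "\<delta> u < \<Delta> \<eta>" using good D by (auto simp: good_def)
    have late_ev: "late u \<in> events" unfolding late_def by (rule prob_late_exceedance[OF good])
    have \<theta>0: "real K * l * u \<ge> 0" using K l u by simp
    have early_ev: "early u \<in> events" unfolding early_def by (rule early_exceedance_bound(1)[OF \<delta> order_refl])
    have "prob (early u) \<le> eb u"
      using early_exceedance_bound(2)[OF \<delta> \<theta>0, where u = u and c = c] by (simp add: early_def eb_def)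
    then have "prob (exceed u) \<le> eb u + prob (late u)"
      using measure_Un_le[OF early_ev late_ev] split[OF good] by simp
    moreover have "prob (late u) \<le> prob (exceed u)"
      using split[OF good] by (intro finite_measure_mono exceed_events) auto
    ultimately show "prob (late u) / prefactor u \<le> prob (exceed u) / prefactor u"
      "prob (exceed u) / prefactor u \<le> eb u / prefactor u + prob (late u) / prefactor u"
      using prefactor_pos[OF good] by (auto simp: divide_right_mono add_divide_distrib[symmetric])
  qed
  have ev: "\<forall>\<^sub>F u in at_top. good u \<and> u \<ge> (0::real)"
    using eventually_good eventually_ge_at_top by (rule eventually_conj)
  have late: "((\<lambda>u. prob (late u) / prefactor u) \<longlongrightarrow> p0 * H) at_top"
  proof (rule Lim_transform_eventually[OF late_tendsto])
    show "\<forall>\<^sub>F u in at_top. (\<integral>x. integrand u {0..L u} x \<partial>Leb \<Gamma>) = prob (late u) / prefactor u"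
      using eventually_good
    proof eventually_elim
      case (elim u)
      show ?case unfolding late_def prob_late_exceedance(2)[OF elim] using prefactor_pos[OF elim] by simp
    qed
  qed
  have "((\<lambda>u. eb u / prefactor u + prob (late u) / prefactor u) \<longlongrightarrow> 0 + p0 * H) at_top"
    unfolding eb_def by (intro tendsto_add early_bound_negligible late)
  then have upper: "((\<lambda>u. eb u / prefactor u + prob (late u) / prefactor u) \<longlongrightarrow> p0 * H) at_top" by simp
  show ?thesis
  proof (rule tendsto_sandwich[OF _ _ late upper])
    show "\<forall>\<^sub>F u in at_top. prob (late u) / prefactor u \<le> prob (exceed u) / prefactor u"
      using ev by eventually_elim (use bounds in simp)
    show "\<forall>\<^sub>F u in at_top. prob (exceed u) / prefactor u \<le> eb u / prefactor u + prob (late u) / prefactor u"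
      using ev by eventually_elim (use bounds in simp)
  qed
qed

end

section \<open>Random offspring numbers\<close>

lemma (in prob_space) essinf_attained:
  fixes X :: "'a \<Rightarrow> nat"
  assumes X: "X \<in> measurable M (count_space UNIV)"
  shows "AE \<omega> in M. essinf M X \<le> X \<omega>" and "prob {\<omega>\<in>space M. X \<omega> = essinf M X} > 0"
proof -
  note X[measurable]
  define S where "S = {k. AE \<omega> in M. k \<le> X \<omega>}"
  have "\<exists>k. k \<notin> S"
  proof (rule ccontr)
    assume "\<nexists>k. k \<notin> S"
    then have "AE \<omega> in M. \<forall>k. k \<le> X \<omega>" by (simp add: AE_all_countable S_def)
    then have "AE \<omega> in M. False"
    proof eventually_elim
      case (elim \<omega>)
      from elim[rule_format, of "Suc (X \<omega>)"] show ?case by simp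
    qed
    then show False by simp
  qed
  then obtain k where k: "k \<notin> S" by blast
  have "i < k" if "i \<in> S" for i
  proof (rule ccontr)
    assume "\<not> i < k"
    with that have "k \<in> S" unfolding S_def by (auto elim: eventually_mono)
    with k show False by simp
  qed
  then have fin: "finite S" by (intro finite_subset[of S "{..<k}"]) auto
  have "0 \<in> S" by (simp add: S_def)
  then have Max: "essinf M X = Max S"
    unfolding essinf_def S_def[symmetric] using fin by (intro cSup_eq_Max) auto
  have "Max S \<in> S" using fin \<open>0 \<in> S\<close> by (intro Max_in) auto
  then show ae: "AE \<omega> in M. essinf M X \<le> X \<omega>" by (simp add: S_def Max)
  show "prob {\<omega>\<in>space M. X \<omega> = essinf M X} > 0"
  proof (rule ccontr)
    assume "\<not> prob {\<omega>\<in>space M. X \<omega> = essinf M X} > 0"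
    then have "prob {\<omega>\<in>space M. X \<omega> = essinf M X} = 0" using measure_nonneg[of M] by (metis less_eq_real_def)
    then have "AE \<omega> in M. X \<omega> \<noteq> essinf M X"
      by (subst (asm) prob_eq_0) auto
    with ae have "AE \<omega> in M. Suc (essinf M X) \<le> X \<omega>" by eventually_elim simp
    then have "Suc (Max S) \<in> S" by (simp add: S_def Max)
    then show False using Max_ge[OF fin] by fastforce
  qed
qed

lemma (in prob_space) completion_measure_eq_AE:
  assumes X: "X \<in> sets M" and Y: "Y \<subseteq> space M" and eq: "AE \<omega> in M. \<omega> \<in> Y \<longleftrightarrow> \<omega> \<in> X"
  shows "Y \<in> sets (completion M)" "measure (completion M) Y = measure M X"
proof -
  have "AE \<omega> in M. \<not> (\<omega> \<in> Y \<and> \<omega> \<notin> X)" "AE \<omega> in M. \<not> (\<omega> \<in> X \<and> \<omega> \<notin> Y)"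
    using eq by (auto elim: eventually_mono)
  then have "Measurable.pred (completion M) (\<lambda>\<omega>. \<omega> \<in> Y \<and> \<omega> \<notin> X)"
    "Measurable.pred (completion M) (\<lambda>\<omega>. \<omega> \<in> X \<and> \<omega> \<notin> Y)"
    by (auto intro: sets_completion_AE)
  then have "{\<omega>\<in>space M. \<omega> \<in> Y \<and> \<omega> \<notin> X} \<in> sets (completion M)" "{\<omega>\<in>space M. \<omega> \<in> X \<and> \<omega> \<notin> Y} \<in> sets (completion M)"
    by (simp_all add: pred_def)
  moreover have "X \<in> sets (completion M)" using X by auto
  ultimately have "(X - {\<omega>\<in>space M. \<omega> \<in> X \<and> \<omega> \<notin> Y}) \<union> {\<omega>\<in>space M. \<omega> \<in> Y \<and> \<omega> \<notin> X} \<in> sets (completion M)"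
    by auto
  also have "(X - {\<omega>\<in>space M. \<omega> \<in> X \<and> \<omega> \<notin> Y}) \<union> {\<omega>\<in>space M. \<omega> \<in> Y \<and> \<omega> \<notin> X} = Y"
    using Y sets.sets_into_space[OF X] by auto
  finally show YC: "Y \<in> sets (completion M)" .
  have "measure (completion M) Y = measure (completion M) X"
    using eq X YC by (intro measure_eq_AE) (auto simp: AE_completion)
  then show "measure (completion M) Y = measure M X" using X by simp
qed

text \<open>
  An event that on \<open>A\<close> is described by a measurable set up to conditional null sets is measurable in the
  completion.
\<close>
lemma (in prob_space) completion_measure_conditioned:
  assumes A: "A \<in> sets M" "prob A > 0" and X: "X \<in> sets M"
    and eq: "AE \<omega> in uniform_measure M A. Q \<omega> \<longleftrightarrow> \<omega> \<in> X"
  shows "{\<omega>\<in>space M. \<omega> \<in> A \<and> Q \<omega>} \<in> sets (completion M)"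
    and "measure (completion M) {\<omega>\<in>space M. \<omega> \<in> A \<and> Q \<omega>} = prob A * measure (uniform_measure M A) X"
proof -
  have pos: "0 < emeasure M A" using A by (simp add: emeasure_eq_measure)
  have "AE \<omega> in M. \<omega> \<in> A \<longrightarrow> (Q \<omega> \<longleftrightarrow> \<omega> \<in> X)"
    using eq by (subst (asm) AE_uniform_measure) (use pos A in \<open>auto simp: emeasure_eq_measure\<close>)
  then have "AE \<omega> in M. \<omega> \<in> {\<omega>\<in>space M. \<omega> \<in> A \<and> Q \<omega>} \<longleftrightarrow> \<omega> \<in> A \<inter> X"
    using AE_space by eventually_elim auto
  note * = completion_measure_eq_AE[OF sets.Int[OF A(1) X] _ this]
  show "{\<omega>\<in>space M. \<omega> \<in> A \<and> Q \<omega>} \<in> sets (completion M)" by (rule *(1)) auto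
  have "measure (completion M) {\<omega>\<in>space M. \<omega> \<in> A \<and> Q \<omega>} = prob (A \<inter> X)" by (rule *(2)) auto
  also have "\<dots> = prob A * measure (uniform_measure M A) X"
    using A X pos by (subst measure_uniform_measure) (auto simp: emeasure_eq_measure)
  finally show "measure (completion M) {\<omega>\<in>space M. \<omega> \<in> A \<and> Q \<omega>} = prob A * measure (uniform_measure M A) X" .
qed

lemma (in gaussian_tree) rowsum_eq_\<mu>\<^sub>0: "rowsum (\<Delta> \<eta>) = \<mu>\<^sub>0 \<tau> n \<eta> T"
proof -
  have "(\<Sum>i<\<eta>. \<Delta> i * real K / real (P i)) = (\<Sum>i<\<eta>. \<Delta> i * real (\<Prod>j=Suc i..\<eta>. n j))"
  proof (intro sum.cong refl)
    fix i assume "i \<in> {..<\<eta>}"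
    then have i: "i < \<eta>" by simp
    have "{1..\<eta>} = {1..i} \<union> {Suc i..\<eta>}" using i by auto
    then have "K = P i * (\<Prod>j=Suc i..\<eta>. n j)"
      unfolding offspring_prod_def by (simp only:) (rule prod.union_disjoint, auto)
    then show "\<Delta> i * real K / real (P i) = \<Delta> i * real (\<Prod>j=Suc i..\<eta>. n j)"
      using P_pos[of i] i by simp
  qed
  also have "\<dots> = (\<Sum>l=1..\<eta>. (\<tau> l - \<tau> (l - 1)) * real (\<Prod>j=l..\<eta>. n j))"
    by (rule sum.reindex_bij_witness[of _ "\<lambda>l. l - 1" Suc]) auto
  finally show ?thesis by (simp add: rowsum_def \<mu>\<^sub>0_def)
qed

lemma offspring_prod_mono:
  assumes "\<And>j. j \<in> {1..i} \<Longrightarrow> n j \<le> n' j"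
  shows "offspring_prod n i \<le> offspring_prod n' i"
  unfolding offspring_prod_def by (intro prod_mono) (use assms in auto)

lemma offspring_prod_strict_mono:
  assumes le: "\<And>j. j \<in> {1..\<eta>} \<Longrightarrow> n j \<le> n' j" and pos: "\<And>j. j \<in> {1..\<eta>} \<Longrightarrow> n j \<ge> 1"
    and k: "k \<in> {1..\<eta>}" "n k < n' k"
  shows "offspring_prod n \<eta> < offspring_prod n' \<eta>"
proof -
  have "offspring_prod n \<eta> = n k * (\<Prod>j\<in>{1..\<eta>} - {k}. n j)"
    unfolding offspring_prod_def using k by (intro prod.remove) auto
  also have "\<dots> < n' k * (\<Prod>j\<in>{1..\<eta>} - {k}. n j)"
    using k(2) pos by (intro mult_strict_right_mono prod_pos) (force simp: Suc_le_eq)+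
  also have "\<dots> \<le> n' k * (\<Prod>j\<in>{1..\<eta>} - {k}. n' j)"
    using le by (intro mult_left_mono prod_mono) auto
  also have "\<dots> = offspring_prod n' \<eta>"
    unfolding offspring_prod_def using k by (intro prod.remove[symmetric]) auto
  finally show ?thesis .
qed

text \<open>
  A larger offspring number increases \<open>P \<eta>\<close> by at least \<open>1\<close>; the bound takes into account only the
  contribution of the last interval and does not depend on \<open>n'\<close>.
\<close>
lemma gaussian_tree_v_le:
  assumes T: "gaussian_tree M W \<tau> n \<eta>" and T': "gaussian_tree M' W' \<tau> n' \<eta>"
    and le: "\<And>j. j \<in> {1..\<eta>} \<Longrightarrow> n j \<le> n' j" and k: "k \<in> {1..\<eta>}" "n k < n' k"
  shows "gaussian_tree.v \<tau> n' \<eta> \<le> gaussian_tree.v \<tau> n \<eta>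
    - (\<tau> (Suc \<eta>) - \<tau> \<eta>) * (1 / real (offspring_prod n \<eta>) - 1 / real (offspring_prod n \<eta> + 1))"
proof -
  interpret T: gaussian_tree M W \<tau> n \<eta> by fact
  interpret T': gaussian_tree M' W' \<tau> n' \<eta> by fact
  have pos: "n j \<ge> 1" if "j \<in> {1..\<eta>}" for j using T.n that .
  have less: "offspring_prod n \<eta> + 1 \<le> offspring_prod n' \<eta>"
    using offspring_prod_strict_mono[where n = n and n' = n' and \<eta> = \<eta>, OF le pos k] by simp
  have "T'.v = (\<Sum>i<\<eta>. (\<tau> (Suc i) - \<tau> i) / real (offspring_prod n' i)) + (\<tau> (Suc \<eta>) - \<tau> \<eta>) / real (offspring_prod n' \<eta>)"
    unfolding T'.v_def by (simp add: lessThan_Suc_atMost[symmetric])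
  also have "\<dots> \<le> (\<Sum>i<\<eta>. (\<tau> (Suc i) - \<tau> i) / real (offspring_prod n i)) + (\<tau> (Suc \<eta>) - \<tau> \<eta>) / real (offspring_prod n \<eta> + 1)"
  proof (intro add_mono sum_mono divide_left_mono)
    show "real (offspring_prod n i) \<le> real (offspring_prod n' i)" if "i \<in> {..<\<eta>}" for i
      by (intro of_nat_mono offspring_prod_mono le) (use that in auto)
    show "real (offspring_prod n \<eta> + 1) \<le> real (offspring_prod n' \<eta>)"
      using less by (simp only: of_nat_le_iff)
    show "0 < real (offspring_prod n' \<eta>) * real (offspring_prod n \<eta> + 1)"
      using T'.P_pos[of \<eta>] by simp
    show "0 < real (offspring_prod n' i) * real (offspring_prod n i)" if "i \<in> {..<\<eta>}" for i
      using T'.P_pos[of i] T.P_pos[of i] that by simp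
  qed (use T.\<tau> in \<open>auto intro: less_imp_le\<close>)
  also have "\<dots> = T.v - (\<tau> (Suc \<eta>) - \<tau> \<eta>) * (1 / real (offspring_prod n \<eta>) - 1 / real (offspring_prod n \<eta> + 1))"
    unfolding T.v_def by (simp add: lessThan_Suc_atMost[symmetric] right_diff_distrib)
  finally show ?thesis .
qed

text \<open>
  Condition on the vector of offspring numbers.  On the slice where it is minimal, the asymptotics for fixed
  offspring numbers apply.  All other slices satisfy the tail bound with a smaller variance, with the same
  constant \<open>\<epsilon>\<close> for each of them, so their union is negligible as well.
\<close>
theorem corollary3p6:
  fixes M :: "'a measure" and T c :: real and \<eta> :: nat and \<tau> :: "nat \<Rightarrow> real"
    and N :: "nat \<Rightarrow> 'a \<Rightarrow> nat" and B :: "nat \<Rightarrow> real \<Rightarrow> 'a \<Rightarrow> real"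
    and M' :: "'b measure" and B' :: "nat \<Rightarrow> real \<Rightarrow> 'b \<Rightarrow> real"
  assumes "prob_space M"
    and "T > 0" and "\<eta> \<ge> 1"
    and "\<tau> 0 = 0" and "\<tau> (Suc \<eta>) = T" and "\<And>i. i \<le> \<eta> \<Longrightarrow> \<tau> i < \<tau> (Suc i)"
    and "prob_space.indep_vars M (\<lambda>_. count_space UNIV) N {1..\<eta>}"
    and "\<And>i \<omega>. i \<in> {1..\<eta>} \<Longrightarrow> \<omega> \<in> space M \<Longrightarrow> N i \<omega> \<ge> 1"
    and "random_brownian_decision_tree M \<tau> N \<eta> B"
    \<comment> \<open>the Brownian motions in the definition of the constant\<close>
    and "indep_brownian_motions M' {1..offspring_prod (essinf_vec M N) \<eta>} (\<lambda>_. {0..}) B'"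
  \<comment> \<open>the completion only serves to make events measurable that are determined up to null sets\<close>
  shows "((\<lambda>u.
      \<P>(\<omega> in completion M. \<exists>t\<in>{0..T}. \<forall>\<gamma><offspring_prod (\<lambda>i. N i \<omega>) \<eta>. B \<gamma> t \<omega> - c * t > u) /
      (\<H> M' B' (offspring_prod (essinf_vec M N) \<eta>) (1 / \<mu>\<^sub>0 \<tau> (essinf_vec M N) \<eta> T) *
       (\<Prod>i=1..\<eta>. \<P>(\<omega> in M. N i \<omega> = essinf M (N i))) *
       \<P>(\<omega> in completion M. (\<forall>\<gamma><offspring_prod (\<lambda>i. N i \<omega>) \<eta>. B \<gamma> T \<omega> - c * T > u) \<bar>
            (\<forall>i\<in>{1..\<eta>}. N i \<omega> = essinf_vec M N i))))
    \<longlongrightarrow> 1) at_top"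
proof -
  interpret M: prob_space M by fact
  note \<tau> = assms(6) and T = assms(5)
  define n0 where "n0 = essinf_vec M N"
  define A where "A n = {\<omega>\<in>space M. \<forall>i\<in>{1..\<eta>}. N i \<omega> = n i}" for n
  define Mn where "Mn n = uniform_measure M (A n)" for n
  have Nm[measurable]: "N i \<in> measurable M (count_space UNIV)" if "i \<in> {1..\<eta>}" for i
    using assms(7) that by (auto simp: M.indep_vars_def)
  have A_meas[measurable]: "A n \<in> sets M" for n unfolding A_def by measurable
  have spaceMn: "space (Mn n) = space M" "sets (Mn n) = sets M" for n by (simp_all add: Mn_def)
  have n0_prob: "M.prob {\<omega>\<in>space M. N i \<omega> = n0 i} > 0" and n0_le: "AE \<omega> in M. n0 i \<le> N i \<omega>"
    if "i \<in> {1..\<eta>}" for i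
    using M.essinf_attained[OF Nm[OF that]] by (simp_all add: n0_def essinf_vec_def)
  have prob_A0: "M.prob (A n0) = (\<Prod>i=1..\<eta>. M.prob {\<omega>\<in>space M. N i \<omega> = n0 i})"
  proof -
    have "M.prob (\<Inter>i\<in>{1..\<eta>}. N i -` {n0 i} \<inter> space M) = (\<Prod>i=1..\<eta>. M.prob (N i -` {n0 i} \<inter> space M))"
      using assms(3) by (intro M.indep_varsD_finite[OF assms(7)]) auto
    moreover have "(\<Inter>i\<in>{1..\<eta>}. N i -` {n0 i} \<inter> space M) = A n0"
      using assms(3) by (auto simp: A_def)
    moreover have "N i -` {n0 i} \<inter> space M = {\<omega>\<in>space M. N i \<omega> = n0 i}" for i by auto
    ultimately show ?thesis by simp
  qed
  have A0_pos: "M.prob (A n0) > 0"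
    unfolding prob_A0 by (intro prod_pos n0_prob) auto
  have tree: "\<exists>W. gaussian_tree (Mn n) W \<tau> n \<eta> \<and>
      (AE \<omega> in Mn n. \<forall>t\<in>{0..T}. \<forall>\<gamma><offspring_prod n \<eta>. B \<gamma> t \<omega> = branch (\<lambda>j s. W j s \<omega>) \<tau> n \<eta> \<gamma> t)"
    if An: "M.prob (A n) > 0" for n
  proof -
    have "brownian_decision_tree (Mn n) \<tau> n \<eta> B"
      using assms(9) An by (simp add: random_brownian_decision_tree_def Mn_def A_def)
    then obtain W where W: "indep_brownian_motions (Mn n) (SIGMA i:{..\<eta>}. {..<offspring_prod n i})
          (\<lambda>(i, k). {0..\<tau> (Suc i) - \<tau> i}) W"
      and ae: "AE \<omega> in Mn n. \<forall>t\<in>{0..T}. \<forall>\<gamma><offspring_prod n \<eta>. B \<gamma> t \<omega> = branch (\<lambda>j s. W j s \<omega>) \<tau> n \<eta> \<gamma> t"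
      unfolding brownian_decision_tree_def T by blast
    have "A n \<noteq> {}"
    proof
      assume "A n = {}"
      with An show False by simp
    qed
    then obtain \<omega> where "\<omega> \<in> A n" by blast
    then have "n i \<ge> 1" if "i \<in> {1..\<eta>}" for i
      using assms(8)[OF that, of \<omega>] that by (auto simp: A_def)
    moreover have "prob_space (Mn n)" using W by (simp add: indep_brownian_motions_def)
    ultimately have "gaussian_tree (Mn n) W \<tau> n \<eta>"
      using W assms(3,4) \<tau> by (auto simp: gaussian_tree_def gaussian_tree_axioms_def)
    then show ?thesis using ae by blast
  qed
  obtain W where W: "gaussian_tree (Mn n0) W \<tau> n0 \<eta>"
    and W_ae: "AE \<omega> in Mn n0. \<forall>t\<in>{0..T}. \<forall>\<gamma><offspring_prod n0 \<eta>. B \<gamma> t \<omega> = branch (\<lambda>j s. W j s \<omega>) \<tau> n0 \<eta> \<gamma> t"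
    using tree[OF A0_pos] by blast
  interpret G: gaussian_tree "Mn n0" W \<tau> n0 \<eta> by (rule W)
  define l where "l = 1 / \<mu>\<^sub>0 \<tau> n0 \<eta> T"
  have rowsum: "G.rowsum (\<tau> (Suc \<eta>) - \<tau> \<eta>) = \<mu>\<^sub>0 \<tau> n0 \<eta> T"
    using G.rowsum_eq_\<mu>\<^sub>0 by (simp add: T)
  have "G.rowsum (\<tau> (Suc \<eta>) - \<tau> \<eta>) > 0"
    unfolding G.rowsum_def using G.\<Delta>_pos G.P_pos
    by (intro add_pos_nonneg sum_nonneg) (auto simp: less_imp_le)
  then have l: "l > 0" "l = 1 / G.rowsum (\<tau> (Suc \<eta>) - \<tau> \<eta>)" by (simp_all add: l_def rowsum)
  interpret L: tree_limit "Mn n0" W \<tau> n0 \<eta> M' B' l c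
    using assms(10) l G.P_pos[of \<eta>]
    by unfold_locales (auto simp: n0_def[symmetric])
  define K where "K = offspring_prod n0 \<eta>"
  define \<epsilon> where "\<epsilon> = (\<tau> (Suc \<eta>) - \<tau> \<eta>) * (1 / real K - 1 / real (K + 1))"
  have K: "K > 0" unfolding K_def by (rule G.P_pos) simp
  have \<epsilon>: "\<epsilon> > 0"
    unfolding \<epsilon>_def using K \<tau>[of \<eta>] by (intro mult_pos_pos) (auto simp: divide_strict_left_mono)
  define Q where "Q u = exp (- (real K * l * u) * (u - \<bar>c\<bar> * T) + (real K * l * u)\<^sup>2 * (G.v - \<epsilon>) / 2)" for u
  define Ex where "Ex u \<omega> \<longleftrightarrow> (\<exists>t\<in>{0..T}. \<forall>\<gamma><offspring_prod (\<lambda>i. N i \<omega>) \<eta>. B \<gamma> t \<omega> - c * t > u)" for u \<omega>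
  define Fx where "Fx u \<omega> \<longleftrightarrow> (\<forall>\<gamma><offspring_prod (\<lambda>i. N i \<omega>) \<eta>. B \<gamma> T \<omega> - c * T > u)" for u \<omega>
  have prod_N: "offspring_prod (\<lambda>i. N i \<omega>) \<eta> = offspring_prod n \<eta>" if "\<omega> \<in> A n" for \<omega> n
    unfolding offspring_prod_def using that by (intro prod.cong) (auto simp: A_def)
  have AE_A: "AE \<omega> in Mn n. \<omega> \<in> A n" if "M.prob (A n) > 0" for n
    unfolding Mn_def using that by (intro AE_uniform_measureI) (auto simp: M.emeasure_eq_measure)
  \<comment> \<open>where the offspring numbers are constant, \<open>B\<close> can be replaced by the branches built from driving motions\<close>
  have slice: "{\<omega>\<in>space M. \<omega> \<in> A n \<and> Ex u \<omega>} \<in> sets (completion M)"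
    "measure (completion M) {\<omega>\<in>space M. \<omega> \<in> A n \<and> Ex u \<omega>}
      = M.prob (A n) * measure (Mn n) {\<omega>\<in>space (Mn n). \<exists>t\<in>{0..T}. \<forall>\<gamma><offspring_prod n \<eta>. branch (\<lambda>j s. W j s \<omega>) \<tau> n \<eta> \<gamma> t - c * t > u}"
    if An: "M.prob (A n) > 0" and W: "gaussian_tree (Mn n) W \<tau> n \<eta>"
      and ae: "AE \<omega> in Mn n. \<forall>t\<in>{0..T}. \<forall>\<gamma><offspring_prod n \<eta>. B \<gamma> t \<omega> = branch (\<lambda>j s. W j s \<omega>) \<tau> n \<eta> \<gamma> t" for n W u
  proof -
    interpret G': gaussian_tree "Mn n" W \<tau> n \<eta> by (rule W)
    let ?X = "{\<omega>\<in>space (Mn n). \<exists>t\<in>{0..T}. \<forall>\<gamma><offspring_prod n \<eta>. branch (\<lambda>j s. W j s \<omega>) \<tau> n \<eta> \<gamma> t - c * t > u}"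
    have X: "?X \<in> sets M"
      using G'.early_exceedance_bound(1)[where \<delta> = 0 and \<theta> = 0 and u = u and c = c] \<tau>[of \<eta>] by (simp add: T spaceMn)
    have "AE \<omega> in uniform_measure M (A n). Ex u \<omega> \<longleftrightarrow> \<omega> \<in> ?X"
      using ae AE_A[OF An] AE_space unfolding Mn_def[symmetric]
    proof eventually_elim
      case (elim \<omega>)
      have "(\<forall>\<gamma><offspring_prod (\<lambda>i. N i \<omega>) \<eta>. B \<gamma> t \<omega> - c * t > u)
        = (\<forall>\<gamma><offspring_prod n \<eta>. branch (\<lambda>j s. W j s \<omega>) \<tau> n \<eta> \<gamma> t - c * t > u)" if "t \<in> {0..T}" for t
        unfolding prod_N[OF elim(2)] using elim(1) that by auto
      then show ?case unfolding Ex_def using elim(3) by auto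
    qed
    from M.completion_measure_conditioned[OF A_meas An X this]
    show "{\<omega>\<in>space M. \<omega> \<in> A n \<and> Ex u \<omega>} \<in> sets (completion M)"
      "measure (completion M) {\<omega>\<in>space M. \<omega> \<in> A n \<and> Ex u \<omega>} = M.prob (A n) * measure (Mn n) ?X"
      by (simp_all only: Mn_def)
  qed
  have main: "measure (completion M) {\<omega>\<in>space M. \<omega> \<in> A n0 \<and> Ex u \<omega>} = M.prob (A n0) * measure (Mn n0) (L.exceed u)"
    "{\<omega>\<in>space M. \<omega> \<in> A n0 \<and> Ex u \<omega>} \<in> sets (completion M)" for u
    using slice[OF A0_pos W W_ae, of u] by (simp_all add: L.exceed_def T)
  have final: "measure (completion M) {\<omega>\<in>space M. \<omega> \<in> A n0 \<and> Fx u \<omega>} = M.prob (A n0) * measure (Mn n0) (L.exceed_final u)" for u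
  proof -
    have X: "L.exceed_final u \<in> sets M" using L.exceed_final_events by (simp add: spaceMn)
    have "AE \<omega> in uniform_measure M (A n0). Fx u \<omega> \<longleftrightarrow> \<omega> \<in> L.exceed_final u"
      using W_ae AE_A[OF A0_pos] AE_space unfolding Mn_def[symmetric]
    proof eventually_elim
      case (elim \<omega>)
      have "T \<in> {0..T}" using assms(2) by simp
      then show ?case
        unfolding Fx_def L.exceed_final_def prod_N[OF elim(2)] using elim(1,3) by (auto simp: T)
    qed
    from M.completion_measure_conditioned(2)[OF A_meas A0_pos X this] show ?thesis by (simp only: Mn_def)
  qed
  \<comment> \<open>any other slice of positive probability has offspring numbers at least, and somewhere greater than, those in \<open>n0\<close>\<close>
  have other: "{\<omega>\<in>space M. \<omega> \<in> A n \<and> Ex u \<omega>} \<in> sets (completion M)"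
    "emeasure (completion M) {\<omega>\<in>space M. \<omega> \<in> A n \<and> Ex u \<omega>} \<le> ennreal (Q u) * emeasure M (A n)"
    if u: "u \<ge> 0" and ne: "\<exists>k\<in>{1..\<eta>}. n k \<noteq> n0 k" for n u
  proof -
    interpret C: prob_space "completion M" by (rule M.prob_space_completion)
    have "{\<omega>\<in>space M. \<omega> \<in> A n \<and> Ex u \<omega>} \<in> sets (completion M) \<and>
      measure (completion M) {\<omega>\<in>space M. \<omega> \<in> A n \<and> Ex u \<omega>} \<le> Q u * M.prob (A n)"
    proof (cases "M.prob (A n) > 0")
      case False
      then have 0: "M.prob (A n) = 0" using measure_nonneg[of M "A n"] by linarith
      then have "AE \<omega> in M. \<omega> \<notin> A n" by (subst (asm) M.prob_eq_0) auto
      then have "AE \<omega> in M. \<omega> \<in> {\<omega>\<in>space M. \<omega> \<in> A n \<and> Ex u \<omega>} \<longleftrightarrow> \<omega> \<in> {}" by eventually_elim simp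
      from M.completion_measure_eq_AE[OF _ _ this] show ?thesis using 0 by auto
    next
      case True
      from tree[OF this] obtain W' where W': "gaussian_tree (Mn n) W' \<tau> n \<eta>"
        and ae: "AE \<omega> in Mn n. \<forall>t\<in>{0..T}. \<forall>\<gamma><offspring_prod n \<eta>. B \<gamma> t \<omega> = branch (\<lambda>j s. W' j s \<omega>) \<tau> n \<eta> \<gamma> t"
        by blast
      interpret G': gaussian_tree "Mn n" W' \<tau> n \<eta> by (rule W')
      have le: "n0 j \<le> n j" if j: "j \<in> {1..\<eta>}" for j
      proof (rule ccontr)
        assume "\<not> n0 j \<le> n j"
        then have lt: "n j < n0 j" by simp
        have "AE \<omega> in M. \<omega> \<notin> A n"
          using n0_le[OF j]
        proof eventually_elim
          case (elim \<omega>)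
          then have "N j \<omega> \<noteq> n j" using lt by simp
          then show ?case using j unfolding A_def by blast
        qed
        then have "M.prob (A n) = 0" by (subst M.prob_eq_0) auto
        with True show False by simp
      qed
      from ne obtain k where k: "k \<in> {1..\<eta>}" "n0 k < n k" using le by (metis le_neq_implies_less)
      have v: "G'.v \<le> G.v - \<epsilon>"
        unfolding \<epsilon>_def K_def by (rule gaussian_tree_v_le[OF W W' le k])
      have \<theta>0: "0 \<le> real K * l * u" using u l by simp
      have "measure (Mn n) {\<omega>\<in>space (Mn n). \<exists>t\<in>{0..T}. \<forall>\<gamma><offspring_prod n \<eta>. branch (\<lambda>j s. W' j s \<omega>) \<tau> n \<eta> \<gamma> t - c * t > u}
        \<le> exp (- (real K * l * u) * (u - \<bar>c\<bar> * T) + (real K * l * u)\<^sup>2 * G'.v / 2)"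
        using G'.early_exceedance_bound(2)[OF order_refl _ \<theta>0, where u = u and c = c] \<tau>[of \<eta>] by (simp add: T)
      also have "\<dots> \<le> Q u"
        unfolding Q_def exp_le_cancel_iff using v by (intro add_left_mono divide_right_mono mult_left_mono) auto
      finally have "measure (completion M) {\<omega>\<in>space M. \<omega> \<in> A n \<and> Ex u \<omega>} \<le> M.prob (A n) * Q u"
        unfolding slice(2)[OF True W' ae] by (intro mult_left_mono) auto
      then show ?thesis using slice(1)[OF True W' ae] by (simp add: mult.commute)
    qed
    then show "{\<omega>\<in>space M. \<omega> \<in> A n \<and> Ex u \<omega>} \<in> sets (completion M)"
      "emeasure (completion M) {\<omega>\<in>space M. \<omega> \<in> A n \<and> Ex u \<omega>} \<le> ennreal (Q u) * emeasure M (A n)"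
      by (auto simp: C.emeasure_eq_measure M.emeasure_eq_measure ennreal_mult[symmetric] Q_def intro!: ennreal_leI)
  qed
  define rest where "rest u = {\<omega>\<in>space M. \<omega> \<notin> A n0 \<and> Ex u \<omega>}" for u
  have rest: "rest u \<in> sets (completion M)" "measure (completion M) (rest u) \<le> Q u" if u: "u \<ge> 0" for u
  proof -
    interpret C: prob_space "completion M" by (rule M.prob_space_completion)
    define I where "I = {n \<in> ({1..\<eta>} \<rightarrow>\<^sub>E (UNIV :: nat set)). \<exists>k\<in>{1..\<eta>}. n k \<noteq> n0 k}"
    have I: "countable I"
      unfolding I_def by (intro countable_Collect countable_PiE) auto
    have rest_eq: "rest u = (\<Union>n\<in>I. {\<omega>\<in>space M. \<omega> \<in> A n \<and> Ex u \<omega>})"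
    proof safe
      fix \<omega> assume "\<omega> \<in> rest u"
      then have \<omega>: "\<omega> \<in> space M" "\<omega> \<notin> A n0" "Ex u \<omega>" by (auto simp: rest_def)
      then have "(\<lambda>i\<in>{1..\<eta>}. N i \<omega>) \<in> I" "\<omega> \<in> A (\<lambda>i\<in>{1..\<eta>}. N i \<omega>)" by (auto simp: I_def A_def)
      then show "\<omega> \<in> (\<Union>n\<in>I. {\<omega>\<in>space M. \<omega> \<in> A n \<and> Ex u \<omega>})" using \<omega> by blast
    next
      fix \<omega> n assume "n \<in> I" "\<omega> \<in> space M" "\<omega> \<in> A n" "Ex u \<omega>"
      then show "\<omega> \<in> rest u" by (force simp: rest_def I_def A_def)
    qed
    have disjA: "disjoint_family_on A I"
      unfolding disjoint_family_on_def
    proof safe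
      fix n m \<omega> assume nm: "n \<in> I" "m \<in> I" "n \<noteq> m" and \<omega>: "\<omega> \<in> A n" "\<omega> \<in> A m"
      have "n = m" using nm \<omega> by (intro PiE_ext[of n "{1..\<eta>}" "\<lambda>_. UNIV" m]) (auto simp: I_def A_def)
      with nm show "\<omega> \<in> {}" by simp
    qed
    have sets: "{\<omega>\<in>space M. \<omega> \<in> A n \<and> Ex u \<omega>} \<in> sets (completion M)" if "n \<in> I" for n
      using that by (intro other(1)[OF u]) (simp add: I_def)
    show "rest u \<in> sets (completion M)"
      unfolding rest_eq using sets I by (intro sets.countable_UN') auto
    \<comment> \<open>countably many slices; the bound is proportional to their probabilities\<close>
    have "emeasure (completion M) (rest u) = (\<integral>\<^sup>+n. emeasure (completion M) {\<omega>\<in>space M. \<omega> \<in> A n \<and> Ex u \<omega>} \<partial>count_space I)"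
      unfolding rest_eq using sets I disjA
      by (intro emeasure_UN_countable) (auto simp: disjoint_family_on_def)
    also have "\<dots> \<le> (\<integral>\<^sup>+n. ennreal (Q u) * emeasure M (A n) \<partial>count_space I)"
      by (intro nn_integral_mono other(2)[OF u]) (simp add: I_def)
    also have "\<dots> = ennreal (Q u) * (\<integral>\<^sup>+n. emeasure M (A n) \<partial>count_space I)"
      by (rule nn_integral_cmult) simp
    also have "(\<integral>\<^sup>+n. emeasure M (A n) \<partial>count_space I) = emeasure M (\<Union>n\<in>I. A n)"
      using I disjA by (intro emeasure_UN_countable[symmetric]) auto
    also have "ennreal (Q u) * emeasure M (\<Union>n\<in>I. A n) \<le> ennreal (Q u) * 1"
      by (intro mult_left_mono M.emeasure_le_1) auto
    finally show "measure (completion M) (rest u) \<le> Q u"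
      by (simp add: C.emeasure_eq_measure Q_def)
  qed
  have total: "measure (completion M) {\<omega>\<in>space M. Ex u \<omega>}
     = M.prob (A n0) * measure (Mn n0) (L.exceed u) + measure (completion M) (rest u)" if u: "u \<ge> 0" for u
  proof -
    interpret C: prob_space "completion M" by (rule M.prob_space_completion)
    have "{\<omega>\<in>space M. Ex u \<omega>} = {\<omega>\<in>space M. \<omega> \<in> A n0 \<and> Ex u \<omega>} \<union> rest u" by (auto simp: rest_def)
    then have "measure (completion M) {\<omega>\<in>space M. Ex u \<omega>} = measure (completion M) {\<omega>\<in>space M. \<omega> \<in> A n0 \<and> Ex u \<omega>} + measure (completion M) (rest u)"
      using C.finite_measure_Union[OF main(2) rest(1)[OF u]] by (auto simp: rest_def)
    then show ?thesis by (simp add: main(1))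
  qed
  define den where "den u = L.H * M.prob (A n0) * (measure (Mn n0) (L.exceed_final u))" for u
  have ev: "\<forall>\<^sub>F u in at_top. L.good u \<and> u \<ge> (0::real)"
    using L.eventually_good eventually_ge_at_top by (rule eventually_conj)
  have rest_lim: "((\<lambda>u. measure (completion M) (rest u) / L.prefactor u) \<longlongrightarrow> 0) at_top"
  proof (rule tendsto_sandwich[OF _ _ tendsto_const])
    show "((\<lambda>u. Q u / L.prefactor u) \<longlongrightarrow> 0) at_top"
      unfolding Q_def K_def by (rule L.smaller_variance_negligible[OF \<epsilon>])
    show "\<forall>\<^sub>F u in at_top. 0 \<le> measure (completion M) (rest u) / L.prefactor u"
      using ev by eventually_elim (use L.prefactor_pos in \<open>simp add: less_imp_le\<close>)
    show "\<forall>\<^sub>F u in at_top. measure (completion M) (rest u) / L.prefactor u \<le> Q u / L.prefactor u"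
      using ev by eventually_elim (use rest(2) L.prefactor_pos in \<open>simp add: divide_right_mono less_imp_le\<close>)
  qed
  have H: "L.H > 0" using L.H_ge_1 by linarith
  have "((\<lambda>u. (M.prob (A n0) * (measure (Mn n0) (L.exceed u) / L.prefactor u) + measure (completion M) (rest u) / L.prefactor u)
      / (L.H * M.prob (A n0) * (measure (Mn n0) (L.exceed_final u) / L.prefactor u)))
    \<longlongrightarrow> (M.prob (A n0) * (L.p0 * L.H) + 0) / (L.H * M.prob (A n0) * L.p0)) at_top"
    using H A0_pos L.p0_pos
    by (intro tendsto_intros L.exceed_tendsto L.exceed_final_tendsto rest_lim) auto
  also have "(M.prob (A n0) * (L.p0 * L.H) + 0) / (L.H * M.prob (A n0) * L.p0) = 1"
    using H A0_pos L.p0_pos by simp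
  finally have lim: "((\<lambda>u. (M.prob (A n0) * (measure (Mn n0) (L.exceed u) / L.prefactor u) + measure (completion M) (rest u) / L.prefactor u)
      / (L.H * M.prob (A n0) * (measure (Mn n0) (L.exceed_final u) / L.prefactor u))) \<longlongrightarrow> 1) at_top" .
  have "((\<lambda>u. measure (completion M) {\<omega>\<in>space M. Ex u \<omega>} / den u) \<longlongrightarrow> 1) at_top"
  proof (rule Lim_transform_eventually[OF lim])
    show "\<forall>\<^sub>F u in at_top. (M.prob (A n0) * (measure (Mn n0) (L.exceed u) / L.prefactor u) + measure (completion M) (rest u) / L.prefactor u)
      / (L.H * M.prob (A n0) * (measure (Mn n0) (L.exceed_final u) / L.prefactor u)) = measure (completion M) {\<omega>\<in>space M. Ex u \<omega>} / den u"
      using ev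
    proof eventually_elim
      case (elim u)
      then have p: "L.prefactor u > 0" using L.prefactor_pos by simp
      have "(a * (b / q) + r / q) / (h * a * (f / q)) = (a * b + r) / (h * a * f)" if "q > 0" for a b r h f q :: real
      proof -
        have 1: "a * (b / q) + r / q = (a * b + r) / q" by (simp add: add_divide_distrib)
        have 2: "h * a * (f / q) = (h * a * f) / q" by simp
        show ?thesis unfolding 1 2 using that by simp
      qed
      from this[OF p] show ?case using total elim by (simp add: den_def)
    qed
  qed
  moreover have "den u = \<H> M' B' (offspring_prod n0 \<eta>) l * (\<Prod>i=1..\<eta>. M.prob {\<omega>\<in>space M. N i \<omega> = essinf M (N i)}) *
      cond_prob (completion M) (Fx u) (\<lambda>\<omega>. \<forall>i\<in>{1..\<eta>}. N i \<omega> = n0 i)" for u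
  proof -
    have "{\<omega>\<in>space M. Fx u \<omega> \<and> (\<forall>i\<in>{1..\<eta>}. N i \<omega> = n0 i)} = {\<omega>\<in>space M. \<omega> \<in> A n0 \<and> Fx u \<omega>}"
      by (auto simp: A_def)
    moreover have "measure (completion M) {\<omega>\<in>space M. \<forall>i\<in>{1..\<eta>}. N i \<omega> = n0 i} = M.prob (A n0)"
      unfolding A_def[symmetric] by simp
    ultimately have "cond_prob (completion M) (Fx u) (\<lambda>\<omega>. \<forall>i\<in>{1..\<eta>}. N i \<omega> = n0 i) = measure (Mn n0) (L.exceed_final u)"
      unfolding cond_prob_def using A0_pos by (simp add: final)
    moreover have "(\<Prod>i=1..\<eta>. M.prob {\<omega>\<in>space M. N i \<omega> = essinf M (N i)}) = M.prob (A n0)"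
      unfolding prob_A0 by (simp add: n0_def essinf_vec_def)
    ultimately show ?thesis by (simp add: den_def L.H_eq)
  qed
  ultimately show ?thesis
    unfolding Ex_def Fx_def n0_def l_def by simp
qed

end
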